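(* Let $K\ge1$, $n_1,\ldots,n_K\ge2$, $n=\sum_kn_k$, and let $C=QDQ'$ be a nonsingular $n\times n$ block correlation matrix with canonical $K\times K$ block $A$ and $\lambda_k=(n_k-A_{kk})/(n_k-1)$ (see context). Let $V_0\sim t^{\mathrm{std}}_{\nu_0}(0,I_K)$ and $V_k\sim t^{\mathrm{std}}_{\nu_k}(0,I_{n_k-1})$, $k=1,\ldots,K$, be independent with $\nu_0,\ldots,\nu_K>2$, $V=(V_0',V_1',\ldots,V_K')'$, and $Z=C^{1/2}QV$ (i.e. $Z\sim\mathrm{CT}^{\mathrm{std}}_{\boldsymbol m,\boldsymbol\nu}(0,C^{1/2}Q)$ with $\boldsymbol m=(K,n_1-1,\ldots,n_K-1)'$). Let $\ell$ be the log-density of $Z$ viewed as a function of $A$, $\nabla_A=\partial\ell/\partial\mathrm{vec}(A)$, $\mathcal I_A=\mathbb E[\nabla_A\nabla_A']$. Then $$\nabla_A=\tfrac12A_\otimes^{-1/2}\big[W_0\mathrm{vec}(X_0X_0')-\mathrm{vec}(I_K)\big]+\tfrac12E_d'S,$$ $$\mathcal I_A=\tfrac14\big[\phi_0A_\otimes^{-1}H_K+(\phi_0-1)\mathrm{vec}(A^{-1})\mathrm{vec}(A^{-1})'+E_d'\Xi E_d\big],$$ where $S\in\mathbb R^K$ has entries $S_k=\frac1{\lambda_k}-\frac{W_kX_k'X_k}{\lambda_k(n_k-1)}$, $\Xi$ is diagonal with $\Xi_{kk}=\frac{\phi_k-1}{\lambda_k^2}+\frac{2\phi_k}{\lambda_k^2(n_k-1)}$,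 and $$W_0=\frac{\nu_0+K}{\nu_0-2+X_0'X_0},\quad W_k=\frac{\nu_k+n_k-1}{\nu_k-2+X_k'X_k},\quad \phi_0=\frac{\nu_0+K}{\nu_0+K+2},\quad\phi_k=\frac{\nu_k+n_k-1}{\nu_k+n_k+1}.$$
   Context: For $\nu>2$ and positive definite $\Sigma$ ($m\times m$), $t^{\mathrm{std}}_\nu(0,\Sigma)$ has density $\frac{\Gamma((\nu+m)/2)}{\Gamma(\nu/2)}[(\nu-2)\pi]^{-m/2}|\Sigma|^{-1/2}[1+\tfrac1{\nu-2}y'\Sigma^{-1}y]^{-(\nu+m)/2}$. Block setting: $v_m=m^{-1/2}(1,\ldots,1)'\in\mathbb R^m$, $v_m^\perp$ an $m\times(m-1)$ matrix with orthonormal columns orthogonal to $v_m$; $Q=[\mathrm{blockdiag}(v_{n_1},\ldots,v_{n_K}),\ \mathrm{blockdiag}(v_{n_1}^\perp,\ldots,v_{n_K}^\perp)]$. A block correlation matrix $C$ (consecutive groups of sizes $n_k$, $(k,l)$ block constant $\rho_{kl}$ off the unit diagonal) satisfies $C=QDQ'$, $D=\mathrm{blockdiag}(A,\lambda_1I_{n_1-1},\ldots,\lambda_KI_{n_K-1})$, $A$ symmetric positive definite with $A_{kl}=\rho_{kl}\sqrt{n_kn_l}$ ($k\ne l$), $A_{kk}=1+(n_k-1)\rho_{kk}$, $\lambda_k=(n_k-A_{kk})/(n_k-1)>0$; $C$ is thereby a function of $A$. Square roots are symmetric positive definite. With $Y=Q'Z=(Y_0',Y_1',\ldots,Y_K')'$,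 $Y_0\in\mathbb R^K$, $Y_k\in\mathbb R^{n_k-1}$: $X_0=A^{-1/2}Y_0$, $X_k=\lambda_k^{-1/2}Y_k$. Notation: $B_\otimes=B\otimes B$; $K_K$ is the $K^2\times K^2$ commutation matrix, $H_K=I_{K^2}+K_K$; $E_d$ is the $K\times K^2$ matrix with $E_d\mathrm{vec}(B)=\mathrm{diag}(B)$. *)

theory Defs
  imports "HOL-Probability.Probability"
begin

section \<open>Matrices as functions nat => nat => real with explicit dimension (0-based indices)\<close>

type_synonym rmat = "nat \<Rightarrow> nat \<Rightarrow> real"

definition mat_on :: "nat \<Rightarrow> rmat \<Rightarrow> bool" where
  "mat_on m M \<longleftrightarrow> (\<forall>i j. (m \<le> i \<or> m \<le> j) \<longrightarrow> M i j = 0)"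

definition mid :: "nat \<Rightarrow> rmat" where
  "mid m = (\<lambda>i j. if i < m \<and> i = j then 1 else 0)"

definition mmult :: "nat \<Rightarrow> rmat \<Rightarrow> rmat \<Rightarrow> rmat" where
  "mmult m M N = (\<lambda>i j. \<Sum>l<m. M i l * N l j)"

definition msym :: "nat \<Rightarrow> rmat \<Rightarrow> bool" where
  "msym m M \<longleftrightarrow> (\<forall>i<m. \<forall>j<m. M i j = M j i)"

definition mpd :: "nat \<Rightarrow> rmat \<Rightarrow> bool" where
  "mpd m M \<longleftrightarrow> (\<forall>x::nat\<Rightarrow>real. (\<exists>i<m. x i \<noteq> 0) \<longrightarrow>
                    (\<Sum>i<m. \<Sum>j<m. x i * M i j * x j) > 0)"

definition mdet :: "nat \<Rightarrow> rmat \<Rightarrow> real" where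
  "mdet m M = (\<Sum>p\<in>{p. p permutes {..<m}}. of_int (sign p) * (\<Prod>i<m. M i (p i)))"

definition minv :: "nat \<Rightarrow> rmat \<Rightarrow> rmat" where
  "minv m M = (THE N. mat_on m N \<and> (\<forall>i<m. \<forall>j<m. mmult m M N i j = mid m i j))"

definition msqrt :: "nat \<Rightarrow> rmat \<Rightarrow> rmat" where
  "msqrt m M = (THE R. mat_on m R \<and> msym m R \<and> mpd m R \<and>
                      (\<forall>i<m. \<forall>j<m. mmult m R R i j = M i j))"

text \<open>Kronecker product of two K x K matrices, compatible with vec stacking columns:
  vec(B) at index i + K*j is B i j (row i, column j).\<close>
definition kron :: "nat \<Rightarrow> rmat \<Rightarrow> rmat \<Rightarrow> rmat" where
  "kron K B C = (\<lambda>a b. if a < K*K \<and> b < K*K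
       then B (a div K) (b div K) * C (a mod K) (b mod K) else 0)"

definition vecm :: "nat \<Rightarrow> rmat \<Rightarrow> nat \<Rightarrow> real" where
  "vecm K B = (\<lambda>p. if p < K*K then B (p mod K) (p div K) else 0)"

text \<open>Commutation matrix K_K: K_K vec(B) = vec(B').\<close>
definition commK :: "nat \<Rightarrow> rmat" where
  "commK K = (\<lambda>p q. if p < K*K \<and> q < K*K \<and> q = p div K + K * (p mod K) then 1 else 0)"

definition HK :: "nat \<Rightarrow> rmat" where
  "HK K = (\<lambda>p q. mid (K*K) p q + commK K p q)"

text \<open>E_d: K x K^2 with E_d vec(B) = diag(B).\<close>
definition Ed :: "nat \<Rightarrow> rmat" where
  "Ed K = (\<lambda>k p. if k < K \<and> p = k + K*k then 1 else 0)"

definition fro :: "nat \<Rightarrow> rmat \<Rightarrow> real" where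
  "fro m M = sqrt (\<Sum>i<m. \<Sum>j<m. (M i j)\<^sup>2)"

definition tstd_density :: "real \<Rightarrow> nat \<Rightarrow> rmat \<Rightarrow> (nat \<Rightarrow> real) \<Rightarrow> real" where
  "tstd_density \<nu> m \<Sigma> y =
     Gamma ((\<nu> + real m) / 2) / Gamma (\<nu> / 2) * ((\<nu> - 2) * pi) powr (- real m / 2)
     * mdet m \<Sigma> powr (-1/2)
     * (1 + (\<Sum>i<m. \<Sum>j<m. y i * minv m \<Sigma> i j * y j) / (\<nu> - 2)) powr (- (\<nu> + real m) / 2)"

text \<open>K blocks of sizes nb 0, ..., nb (K-1) (consecutive); total dimension and offsets.\<close>
definition ntot :: "nat \<Rightarrow> (nat \<Rightarrow> nat) \<Rightarrow> nat" where
  "ntot K nb = (\<Sum>k<K. nb k)"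

definition roff :: "(nat \<Rightarrow> nat) \<Rightarrow> nat \<Rightarrow> nat" where
  "roff nb k = (\<Sum>j<k. nb j)"

text \<open>offset (within the last n-K coordinates) of the (n_k - 1)-block\<close>
definition coff :: "(nat \<Rightarrow> nat) \<Rightarrow> nat \<Rightarrow> nat" where
  "coff nb k = (\<Sum>j<k. nb j - 1)"

definition inblk :: "(nat \<Rightarrow> nat) \<Rightarrow> nat \<Rightarrow> nat \<Rightarrow> bool" where
  "inblk nb k r \<longleftrightarrow> roff nb k \<le> r \<and> r < roff nb k + nb k"

text \<open>U k is the chosen n_k x (n_k - 1) matrix v_{n_k}^perp (orthonormal columns orthogonal to
  the vector of ones).\<close>
definition is_vperp :: "nat \<Rightarrow> rmat \<Rightarrow> bool" where
  "is_vperp m U \<longleftrightarrow>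
     (\<forall>i<m-1. \<forall>j<m-1. (\<Sum>r<m. U r i * U r j) = (if i = j then 1 else 0)) \<and>
     (\<forall>i<m-1. (\<Sum>r<m. U r i) = 0)"

text \<open>Q = [blockdiag(v_{n_1},...,v_{n_K}), blockdiag(v_{n_1}^perp,...,v_{n_K}^perp)].\<close>
definition Qmat :: "nat \<Rightarrow> (nat \<Rightarrow> nat) \<Rightarrow> (nat \<Rightarrow> rmat) \<Rightarrow> rmat" where
  "Qmat K nb U = (\<lambda>r c. if r < ntot K nb \<and> c < ntot K nb then
      (\<Sum>k<K. if inblk nb k r then
          (if c = k then 1 / sqrt (real (nb k))
           else if K + coff nb k \<le> c \<and> c < K + coff nb k + (nb k - 1)
                then U k (r - roff nb k) (c - K - coff nb k) else 0)
        else 0)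
      else 0)"

definition lam :: "(nat \<Rightarrow> nat) \<Rightarrow> rmat \<Rightarrow> nat \<Rightarrow> real" where
  "lam nb A k = (real (nb k) - A k k) / (real (nb k) - 1)"

text \<open>Block correlation parameters rho_{kl} recovered from A.\<close>
definition rho :: "(nat \<Rightarrow> nat) \<Rightarrow> rmat \<Rightarrow> nat \<Rightarrow> nat \<Rightarrow> real" where
  "rho nb A k l = (if k = l then (A k k - 1) / (real (nb k) - 1)
                   else A k l / sqrt (real (nb k) * real (nb l)))"

definition Cmat :: "nat \<Rightarrow> (nat \<Rightarrow> nat) \<Rightarrow> rmat \<Rightarrow> rmat" where
  "Cmat K nb A = (\<lambda>r s. if r < ntot K nb \<and> s < ntot K nb then
      (if r = s then 1 else
        (\<Sum>k<K. \<Sum>l<K. if inblk nb k r \<and> inblk nb l s then rho nb A k l else 0))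
      else 0)"

definition Lmat :: "nat \<Rightarrow> (nat \<Rightarrow> nat) \<Rightarrow> (nat \<Rightarrow> rmat) \<Rightarrow> rmat \<Rightarrow> rmat" where
  "Lmat K nb U A = mmult (ntot K nb) (msqrt (ntot K nb) (Cmat K nb A)) (Qmat K nb U)"

definition mapply :: "nat \<Rightarrow> rmat \<Rightarrow> (nat \<Rightarrow> real) \<Rightarrow> nat \<Rightarrow> real" where
  "mapply m M v = (\<lambda>i. \<Sum>j<m. M i j * v j)"

definition fV :: "nat \<Rightarrow> (nat \<Rightarrow> nat) \<Rightarrow> real \<Rightarrow> (nat \<Rightarrow> real) \<Rightarrow> (nat \<Rightarrow> real) \<Rightarrow> real" where
  "fV K nb \<nu>0 \<nu> v =
     tstd_density \<nu>0 K (mid K) (\<lambda>i. if i < K then v i else 0) *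
     (\<Prod>k<K. tstd_density (\<nu> k) (nb k - 1) (mid (nb k - 1))
                 (\<lambda>i. if i < nb k - 1 then v (K + coff nb k + i) else 0))"

text \<open>Density of Z = L V (change of variables) and its logarithm, as functions of A.\<close>
definition fZ :: "nat \<Rightarrow> (nat \<Rightarrow> nat) \<Rightarrow> (nat \<Rightarrow> rmat) \<Rightarrow> real \<Rightarrow> (nat \<Rightarrow> real) \<Rightarrow> rmat \<Rightarrow> (nat \<Rightarrow> real) \<Rightarrow> real" where
  "fZ K nb U \<nu>0 \<nu> A z =
     fV K nb \<nu>0 \<nu> (mapply (ntot K nb) (minv (ntot K nb) (Lmat K nb U A)) z)
     / \<bar>mdet (ntot K nb) (Lmat K nb U A)\<bar>"

definition loglik :: "nat \<Rightarrow> (nat \<Rightarrow> nat) \<Rightarrow> (nat \<Rightarrow> rmat) \<Rightarrow> real \<Rightarrow> (nat \<Rightarrow> real) \<Rightarrow> rmat \<Rightarrow> (nat \<Rightarrow> real) \<Rightarrow> real" where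
  "loglik K nb U \<nu>0 \<nu> A z = ln (fZ K nb U \<nu>0 \<nu> A z)"

text \<open>g (a vector of length K^2) is the gradient of f at A w.r.t. vec(A), where f is viewed as a
  function of symmetric K x K matrices (Frechet derivative within the symmetric matrices).\<close>
definition has_sym_grad :: "nat \<Rightarrow> (rmat \<Rightarrow> real) \<Rightarrow> rmat \<Rightarrow> (nat \<Rightarrow> real) \<Rightarrow> bool" where
  "has_sym_grad K f A g \<longleftrightarrow>
     (\<forall>e>0. \<exists>d>0. \<forall>B. msym K B \<and> fro K (\<lambda>i j. B i j - A i j) < d \<longrightarrow>
        \<bar>f B - f A - (\<Sum>p<K*K. g p * (vecm K B p - vecm K A p))\<bar>
          \<le> e * fro K (\<lambda>i j. B i j - A i j))"

definition Yv :: "nat \<Rightarrow> (nat \<Rightarrow> nat) \<Rightarrow> (nat \<Rightarrow> rmat) \<Rightarrow> (nat \<Rightarrow> real) \<Rightarrow> nat \<Rightarrow> real" where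
  "Yv K nb U z = (\<lambda>c. \<Sum>r<ntot K nb. Qmat K nb U r c * z r)"

definition X0 :: "nat \<Rightarrow> (nat \<Rightarrow> nat) \<Rightarrow> (nat \<Rightarrow> rmat) \<Rightarrow> rmat \<Rightarrow> (nat \<Rightarrow> real) \<Rightarrow> nat \<Rightarrow> real" where
  "X0 K nb U A z = (\<lambda>i. \<Sum>j<K. minv K (msqrt K A) i j * Yv K nb U z j)"

definition Xk :: "nat \<Rightarrow> (nat \<Rightarrow> nat) \<Rightarrow> (nat \<Rightarrow> rmat) \<Rightarrow> rmat \<Rightarrow> (nat \<Rightarrow> real) \<Rightarrow> nat \<Rightarrow> nat \<Rightarrow> real" where
  "Xk K nb U A z k = (\<lambda>i. lam nb A k powr (-1/2) * Yv K nb U z (K + coff nb k + i))"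

definition X0sq where
  "X0sq K nb U A z = (\<Sum>i<K. (X0 K nb U A z i)\<^sup>2)"

definition Xksq where
  "Xksq K nb U A z k = (\<Sum>i<nb k - 1. (Xk K nb U A z k i)\<^sup>2)"

definition W0 :: "nat \<Rightarrow> (nat \<Rightarrow> nat) \<Rightarrow> (nat \<Rightarrow> rmat) \<Rightarrow> real \<Rightarrow> rmat \<Rightarrow> (nat \<Rightarrow> real) \<Rightarrow> real" where
  "W0 K nb U \<nu>0 A z = (\<nu>0 + real K) / (\<nu>0 - 2 + X0sq K nb U A z)"

definition Wk :: "nat \<Rightarrow> (nat \<Rightarrow> nat) \<Rightarrow> (nat \<Rightarrow> rmat) \<Rightarrow> (nat \<Rightarrow> real) \<Rightarrow> rmat \<Rightarrow> (nat \<Rightarrow> real) \<Rightarrow> nat \<Rightarrow> real" where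
  "Wk K nb U \<nu> A z k = (\<nu> k + real (nb k) - 1) / (\<nu> k - 2 + Xksq K nb U A z k)"

definition phi0 :: "nat \<Rightarrow> real \<Rightarrow> real" where
  "phi0 K \<nu>0 = (\<nu>0 + real K) / (\<nu>0 + real K + 2)"

definition phik :: "(nat \<Rightarrow> nat) \<Rightarrow> (nat \<Rightarrow> real) \<Rightarrow> nat \<Rightarrow> real" where
  "phik nb \<nu> k = (\<nu> k + real (nb k) - 1) / (\<nu> k + real (nb k) + 1)"

definition Svec where
  "Svec K nb U \<nu> A z k = 1 / lam nb A k
      - Wk K nb U \<nu> A z k * Xksq K nb U A z k / (lam nb A k * (real (nb k) - 1))"

definition Xi :: "(nat \<Rightarrow> nat) \<Rightarrow> (nat \<Rightarrow> real) \<Rightarrow> rmat \<Rightarrow> rmat" where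
  "Xi nb \<nu> A = (\<lambda>k l. if k = l then
      (phik nb \<nu> k - 1) / (lam nb A k)\<^sup>2 + 2 * phik nb \<nu> k / ((lam nb A k)\<^sup>2 * (real (nb k) - 1))
      else 0)"

definition Aot_invsqrt :: "nat \<Rightarrow> rmat \<Rightarrow> rmat" where
  "Aot_invsqrt K A = minv (K*K) (msqrt (K*K) (kron K A A))"

definition Aot_inv :: "nat \<Rightarrow> rmat \<Rightarrow> rmat" where
  "Aot_inv K A = minv (K*K) (kron K A A)"

definition score :: "nat \<Rightarrow> (nat \<Rightarrow> nat) \<Rightarrow> (nat \<Rightarrow> rmat) \<Rightarrow> real \<Rightarrow> (nat \<Rightarrow> real) \<Rightarrow> rmat \<Rightarrow> (nat \<Rightarrow> real) \<Rightarrow> nat \<Rightarrow> real" where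
  "score K nb U \<nu>0 \<nu> A z = (\<lambda>p.
     1/2 * (\<Sum>q<K*K. Aot_invsqrt K A p q *
        (W0 K nb U \<nu>0 A z * vecm K (\<lambda>i j. X0 K nb U A z i * X0 K nb U A z j) q - vecm K (mid K) q))
     + 1/2 * (\<Sum>k<K. Ed K k p * Svec K nb U \<nu> A z k))"

definition info :: "nat \<Rightarrow> (nat \<Rightarrow> nat) \<Rightarrow> real \<Rightarrow> (nat \<Rightarrow> real) \<Rightarrow> rmat \<Rightarrow> rmat" where
  "info K nb \<nu>0 \<nu> A = (\<lambda>p q. 1/4 * (
      phi0 K \<nu>0 * mmult (K*K) (Aot_inv K A) (HK K) p q
      + (phi0 K \<nu>0 - 1) * vecm K (minv K A) p * vecm K (minv K A) q
      + (\<Sum>k<K. \<Sum>l<K. Ed K k p * Xi nb \<nu> A k l * Ed K l q)))"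

end

theory Submission
  imports Defs "Jordan_Normal_Form.Determinant"
begin

text \<open>
  Conjugation by the orthogonal matrix \<open>Q\<close> turns \<open>C\<^sup>1\<^sup>/\<^sup>2\<close> into the block diagonal matrix \<open>D\<^sup>1\<^sup>/\<^sup>2\<close>,
  so the log-density depends on \<open>A\<close> only through \<open>Y\<^sub>0' A\<^sup>-\<^sup>1 Y\<^sub>0\<close>, the \<open>\<lambda>\<^sub>k\<close> and \<open>ln det D\<close>, and
  \<open>D\<close> is affine in \<open>A\<close>. The directional derivatives along symmetric matrices are explicit and depend
  continuously on \<open>A\<close>, which by the mean value theorem gives the gradient.

  At the true parameter \<open>X\<^sub>0 = V\<^sub>0\<close> and \<open>X\<^sub>k = V\<^sub>k\<close>, so the score is a linear combination of the centred
  variables \<open>W V\<^sub>a V\<^sub>b - \<delta>\<^sub>a\<^sub>b\<close> of the independent blocks. A t density is a Gamma mixture of Gaussian ones, and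
  the factors \<open>W\<close> only shift the Gamma exponent; the second and fourth moments of the weighted variables
  are therefore Gaussian moments, up to the factor \<open>\<phi>\<close>.
\<close>

section \<open>Matrix algebra on functions\<close>

text \<open>\<open>minv\<close> and \<open>msqrt\<close> are definite descriptions, so each use of
  them rests on existence and uniqueness. The root of a positive definite matrix is constructed
  without eigenvalues, from the binomial series of (1 - E)^a; uniqueness then evaluates
  \<open>msqrt\<close> at C and at the Kronecker square of A, where a root can be written down. The
  factor Q in Z gives C^(1/2) Q = Q D^(1/2), hence L^(-1) z = D^(-1/2) Q' z. As only X_0'X_0 = Y_0'
  A^(-1) Y_0 enters the density, no matrix root is ever differentiated.

  For the moments put a = (\<nu> + m)/2. A monomial of degree 2r weighted with W^r has expectation
  a^r Gamma(a)/Gamma(a + r) times the standard normal moment: one power of W per pair of coordinates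
  is what compensates the random scale. The ratio is 1 for r = 1, which gives the centring, and a/(a
  + 1) = \<phi> for r = 2. Of the three pairings in a Gaussian fourth moment, two produce H_K, or
  the term 2 \<phi>_k/(n_k - 1); the third, less the product of the means of the uncentred
  variables, produces the factor \<phi> - 1.\<close>

definition is_inv :: "nat \<Rightarrow> rmat \<Rightarrow> rmat \<Rightarrow> bool" where
  "is_inv m M N \<longleftrightarrow> (\<forall>i<m. \<forall>j<m. mmult m M N i j = mid m i j)"

lemma mmult_assoc: "mmult m (mmult m A B) C = mmult m A (mmult m B C)"
  unfolding mmult_def
  by (intro ext, simp add: sum_distrib_left sum_distrib_right mult.assoc, rule sum.swap)

lemma mid_sum_left: "i < m \<Longrightarrow> (\<Sum>l<m. mid m i l * f l) = (f i :: real)"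
  by (simp add: mid_def if_distrib[of "\<lambda>x. x * _"] cong: if_cong)

lemma mid_sum_right: "i < m \<Longrightarrow> (\<Sum>l<m. f l * mid m l i) = (f i :: real)"
  by (simp add: mid_def if_distrib[of "\<lambda>x. _ * x"] cong: if_cong)

lemma mmult_mid_left: "i < m \<Longrightarrow> mmult m (mid m) M i j = M i j"
  by (simp add: mmult_def mid_sum_left)

lemma mmult_mid_right: "j < m \<Longrightarrow> mmult m M (mid m) i j = M i j"
  by (simp add: mmult_def mid_sum_right)

lemma mmult_cong:
  assumes "\<And>l. l < m \<Longrightarrow> A i l = A' i l" "\<And>l. l < m \<Longrightarrow> B l j = B' l j"
  shows "mmult m A B i j = mmult m A' B' i j"
  using assms by (simp add: mmult_def)

section \<open>Determinants and inverses, by transfer to \<open>real mat\<close>\<close>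

definition tom :: "nat \<Rightarrow> rmat \<Rightarrow> real mat" where
  "tom m M = mat m m (\<lambda>(i,j). M i j)"

lemma tom_carrier [simp]: "tom m M \<in> carrier_mat m m"
  by (simp add: tom_def)

lemma tom_index [simp]: "i < m \<Longrightarrow> j < m \<Longrightarrow> tom m M $$ (i,j) = M i j"
  by (simp add: tom_def)

lemma tom_dim [simp]: "dim_row (tom m M) = m" "dim_col (tom m M) = m"
  by (simp_all add: tom_def)

lemma tom_mult: "tom m (mmult m M N) = tom m M * tom m N"
  by (rule eq_matI) (auto simp: mmult_def scalar_prod_def lessThan_atLeast0)

lemma tom_mid: "tom m (mid m) = 1\<^sub>m m"
  by (rule eq_matI) (auto simp: mid_def)

lemma tom_eq_iff: "tom m M = tom m N \<longleftrightarrow> (\<forall>i<m. \<forall>j<m. M i j = N i j)"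
  by (metis tom_index eq_matI tom_dim)

lemma mdet_det: "mdet m M = det (tom m M)"
  by (simp add: mdet_def det_def lessThan_atLeast0 permutes_in_image)

lemma mdet_cong: "(\<And>i j. i < m \<Longrightarrow> j < m \<Longrightarrow> M i j = N i j) \<Longrightarrow> mdet m M = mdet m N"
  unfolding mdet_det by (metis tom_eq_iff)

lemma mdet_mmult: "mdet m (mmult m M N) = mdet m M * mdet m N"
  by (simp add: mdet_det tom_mult det_mult[of _ m])

lemma mdet_mid: "mdet m (mid m) = 1"
  by (simp add: mdet_det tom_mid)

lemma mdet_transpose: "mdet m (\<lambda>i j. M j i) = mdet m M"
proof -
  have "tom m (\<lambda>i j. M j i) = transpose_mat (tom m M)"
    by (rule eq_matI) auto
  then show ?thesis by (simp add: mdet_det det_transpose[of _ m])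
qed

lemma is_inv_tom: "is_inv m M N \<longleftrightarrow> tom m M * tom m N = 1\<^sub>m m"
  unfolding is_inv_def tom_mult[symmetric] tom_mid[symmetric] tom_eq_iff ..

lemma is_inv_commute: "is_inv m M N \<Longrightarrow> is_inv m N M"
  unfolding is_inv_tom by (rule mat_mult_left_right_inverse[of _ m]) auto

lemma is_inv_mdet_nonzero: "is_inv m M N \<Longrightarrow> mdet m M \<noteq> 0"
  unfolding is_inv_tom mdet_det
  by (metis det_mult det_one mult_zero_left tom_carrier zero_neq_one)

lemma is_inv_unique:
  assumes MN: "is_inv m M N" and MN': "is_inv m M N'" and ij: "i < m" "j < m"
  shows "N i j = N' i j"
proof -
  have "N i j = mmult m N (mmult m M N') i j"
    using MN' ij by (subst mmult_cong[of m N i N "mmult m M N'" j "mid m"])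
      (auto simp: is_inv_def mmult_mid_right)
  also have "\<dots> = mmult m (mmult m N M) N' i j" by (simp add: mmult_assoc)
  also have "\<dots> = N' i j"
    using is_inv_commute[OF MN] ij
    by (subst mmult_cong[of m _ i "mid m" N' j N']) (auto simp: is_inv_def mmult_mid_left)
  finally show ?thesis .
qed

text \<open>The description defining \<open>minv\<close> is unique only thanks to
  \<open>mat_on\<close>, which forces zeros outside the m x m block. \<open>N\<close> is arbitrary
  there, so it is cut off first, and the conclusion holds inside the block only.\<close>

lemma minv_eqI:
  assumes "is_inv m M N" "i < m" "j < m"
  shows "minv m M i j = N i j"
proof -
  let ?N = "\<lambda>i j. if i < m \<and> j < m then N i j else 0"
  have 1: "mat_on m ?N" by (auto simp: mat_on_def)
  have 2: "is_inv m M ?N"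
    using assms(1) by (simp add: is_inv_def mmult_def)
  have "minv m M = ?N" unfolding minv_def is_inv_def[symmetric]
  proof (rule the_equality)
    fix N' assume N': "mat_on m N' \<and> is_inv m M N'"
    show "N' = ?N"
    proof (intro ext)
      fix i j show "N' i j = ?N i j"
        using N' is_inv_unique[OF conjunct2[OF N'] 2, of i j] by (auto simp: mat_on_def)
    qed
  qed (use 1 2 in auto)
  then show ?thesis using assms by simp
qed

lemma minv_mid: "i < m \<Longrightarrow> j < m \<Longrightarrow> minv m (mid m) i j = mid m i j"
  by (rule minv_eqI) (auto simp: is_inv_def mmult_mid_left)

text \<open>The adjugate, spelled out through \<open>mdet\<close> of minors so that continuity of
  the inverse reduces to continuity of determinants (\<open>tendsto_minv\<close>).\<close>

definition madj :: "nat \<Rightarrow> rmat \<Rightarrow> rmat" where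
  "madj m M = (\<lambda>i j. (-1) ^ (j + i) *
     mdet (m - 1) (\<lambda>a b. M (if a < j then a else Suc a) (if b < i then b else Suc b)))"

lemma madj_adj_mat: "i < m \<Longrightarrow> j < m \<Longrightarrow> madj m M i j = adj_mat (tom m M) $$ (i,j)"
  by (auto simp: madj_def adj_mat_def cofactor_def mat_delete_def mdet_det tom_def
      intro!: arg_cong[where f = det] eq_matI)

lemma is_inv_madj:
  assumes "mdet m M \<noteq> 0"
  shows "is_inv m M (\<lambda>i j. madj m M i j / mdet m M)"
  unfolding is_inv_def
proof (intro allI impI)
  fix i j assume ij: "i < m" "j < m"
  have adj: "tom m M * adj_mat (tom m M) = mdet m M \<cdot>\<^sub>m 1\<^sub>m m" "adj_mat (tom m M) \<in> carrier_mat m m"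
    using adj_mat[OF tom_carrier[of m M]] by (auto simp: mdet_det)
  have "mmult m M (\<lambda>i j. madj m M i j / mdet m M) i j
      = (\<Sum>l<m. M i l * adj_mat (tom m M) $$ (l,j)) / mdet m M"
    using ij by (simp add: mmult_def madj_adj_mat sum_divide_distrib)
  also have "(\<Sum>l<m. M i l * adj_mat (tom m M) $$ (l,j)) = (tom m M * adj_mat (tom m M)) $$ (i,j)"
    using ij adj(2) by (auto simp: scalar_prod_def lessThan_atLeast0 intro!: sum.cong)
  also have "\<dots> = mdet m M * mid m i j" using ij by (simp add: adj(1) mid_def)
  finally show "mmult m M (\<lambda>i j. madj m M i j / mdet m M) i j = mid m i j"
    using assms by simp
qed

lemma minv_madj:
  "mdet m M \<noteq> 0 \<Longrightarrow> i < m \<Longrightarrow> j < m \<Longrightarrow> minv m M i j = madj m M i j / mdet m M"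
  by (rule minv_eqI[OF is_inv_madj])

lemma is_inv_minv:
  assumes "mdet m M \<noteq> 0" shows "is_inv m M (minv m M)"
proof -
  have "is_inv m M (minv m M) \<longleftrightarrow> is_inv m M (\<lambda>i j. madj m M i j / mdet m M)"
    by (simp add: is_inv_def mmult_def minv_madj[OF assms])
  then show ?thesis using is_inv_madj[OF assms] by simp
qed

lemma minv_sym:
  assumes "msym m M" "mdet m M \<noteq> 0" "i < m" "j < m"
  shows "minv m M i j = minv m M j i"
proof (rule minv_eqI[OF _ assms(3,4)])
  have "is_inv m (minv m M) M" using is_inv_minv[OF assms(2)] by (rule is_inv_commute)
  then have *: "(\<Sum>l<m. minv m M j l * M l i) = mid m j i" if "i < m" "j < m" for i j
    using that by (auto simp: is_inv_def mmult_def)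
  show "is_inv m M (\<lambda>i j. minv m M j i)" unfolding is_inv_def mmult_def
  proof (intro allI impI)
    fix i j assume ij: "i < m" "j < m"
    have "(\<Sum>l<m. M i l * minv m M j l) = (\<Sum>l<m. minv m M j l * M l i)"
      using assms(1) ij by (intro sum.cong) (auto simp: msym_def)
    also have "\<dots> = mid m i j" using *[OF ij] by (auto simp: mid_def)
    finally show "(\<Sum>l<m. M i l * minv m M j l) = mid m i j" .
  qed
qed

lemma mdet_zero_kernel:
  assumes "mdet m M = 0"
  obtains x where "\<exists>i<m. x i \<noteq> 0" "\<And>i. i < m \<Longrightarrow> (\<Sum>j<m. M i j * x j) = 0"
proof -
  obtain v where v: "v \<in> carrier_vec m" "v \<noteq> 0\<^sub>v m" "tom m M *\<^sub>v v = 0\<^sub>v m"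
    using assms det_0_iff_vec_prod_zero_field[OF tom_carrier[of m M]] by (auto simp: mdet_det)
  have "\<exists>i<m. Matrix.vec_index v i \<noteq> 0"
  proof (rule ccontr)
    assume "\<not> ?thesis"
    then have "v = 0\<^sub>v m" using v(1) by (intro eq_vecI) auto
    then show False using v(2) by simp
  qed
  moreover have "(\<Sum>j<m. M i j * Matrix.vec_index v j) = 0" if "i < m" for i
  proof -
    have "(\<Sum>j<m. M i j * Matrix.vec_index v j) = Matrix.vec_index (tom m M *\<^sub>v v) i"
      using that v(1) by (auto simp: scalar_prod_def lessThan_atLeast0 intro!: sum.cong)
    then show ?thesis using v(3) that by simp
  qed
  ultimately show ?thesis using that by blast
qed

lemma mpd_mdet_nonzero:
  assumes "mpd m M" shows "mdet m M \<noteq> 0"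
proof
  assume "mdet m M = 0"
  then obtain x where x: "\<exists>i<m. x i \<noteq> 0" "\<And>i. i < m \<Longrightarrow> (\<Sum>j<m. M i j * x j) = 0"
    by (rule mdet_zero_kernel) blast
  have "(\<Sum>i<m. \<Sum>j<m. x i * M i j * x j) = (\<Sum>i<m. x i * (\<Sum>j<m. M i j * x j))"
    by (simp add: sum_distrib_left mult.assoc)
  also have "\<dots> = 0" using x(2) by simp
  finally show False using assms x(1) by (auto simp: mpd_def)
qed

lemma mapply_mmult: "mapply m (mmult m M N) x = mapply m M (mapply m N x)"
  unfolding mapply_def mmult_def
  by (intro ext, simp add: sum_distrib_left sum_distrib_right mult.assoc, rule sum.swap)

lemma mmult_inv_cancel: "is_inv m M N \<Longrightarrow> i < m \<Longrightarrow> mmult m (mmult m M N) X i j = X i j"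
  by (simp add: is_inv_def mmult_def[of m "mmult m M N"] mid_sum_left)

lemma mapply_inv_cancel: "is_inv m M N \<Longrightarrow> i < m \<Longrightarrow> mapply m (mmult m M N) x i = x i"
  by (simp add: is_inv_def mapply_def mid_sum_left)

text \<open>The quadratic form of \<open>T T\<close> at \<open>x\<close> is the squared length of \<open>T x\<close>.\<close>

lemma mpd_square:
  assumes "msym m T" "mdet m T \<noteq> 0"
    and M: "\<And>i j. i < m \<Longrightarrow> j < m \<Longrightarrow> M i j = mmult m T T i j"
  shows "mpd m M"
  unfolding mpd_def
proof (intro allI impI)
  fix x :: "nat \<Rightarrow> real" assume x: "\<exists>i<m. x i \<noteq> 0"
  have "(\<Sum>i<m. \<Sum>j<m. x i * M i j * x j) = (\<Sum>i<m. \<Sum>j<m. \<Sum>l<m. x i * T l i * (T l j * x j))"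
    using assms(1) by (intro sum.cong refl) (auto simp: M mmult_def sum_distrib_left sum_distrib_right msym_def mult.assoc intro!: sum.cong)
  also have "\<dots> = (\<Sum>i<m. \<Sum>l<m. \<Sum>j<m. x i * T l i * (T l j * x j))"
    by (intro sum.cong refl sum.swap)
  also have "\<dots> = (\<Sum>l<m. \<Sum>i<m. \<Sum>j<m. x i * T l i * (T l j * x j))"
    by (rule sum.swap)
  also have "\<dots> = (\<Sum>l<m. (mapply m T x l)\<^sup>2)"
    by (simp add: mapply_def power2_eq_square sum_product mult_ac)
  finally have eq: "(\<Sum>i<m. \<Sum>j<m. x i * M i j * x j) = (\<Sum>l<m. (mapply m T x l)\<^sup>2)" .
  have "(\<Sum>l<m. (mapply m T x l)\<^sup>2) \<noteq> 0"
  proof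
    assume "(\<Sum>l<m. (mapply m T x l)\<^sup>2) = 0"
    then have Tx: "mapply m T x l = 0" if "l < m" for l
      using that by (subst (asm) sum_nonneg_eq_0_iff) auto
    have inv: "is_inv m (minv m T) T" using is_inv_minv[OF assms(2)] by (rule is_inv_commute)
    have "x i = 0" if "i < m" for i
    proof -
      have "x i = mapply m (mid m) x i" using that by (simp add: mapply_def mid_sum_left)
      also have "\<dots> = mapply m (mmult m (minv m T) T) x i"
        using inv that by (simp add: mapply_def is_inv_def)
      also have "\<dots> = 0" unfolding mapply_mmult using Tx by (simp add: mapply_def[of m "minv m T"])
      finally show ?thesis .
    qed
    with x show False by auto
  qed
  moreover have "(\<Sum>l<m. (mapply m T x l)\<^sup>2) \<ge> 0" by (intro sum_nonneg) auto
  ultimately show "(\<Sum>i<m. \<Sum>j<m. x i * M i j * x j) > 0" unfolding eq by linarith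
qed

section \<open>Positive definite square roots\<close>

definition dotm :: "nat \<Rightarrow> (nat \<Rightarrow> real) \<Rightarrow> (nat \<Rightarrow> real) \<Rightarrow> real" where
  "dotm m x y = (\<Sum>i<m. x i * y i)"

definition qf :: "nat \<Rightarrow> rmat \<Rightarrow> (nat \<Rightarrow> real) \<Rightarrow> real" where
  "qf m M x = (\<Sum>i<m. \<Sum>j<m. x i * M i j * x j)"

lemma mpd_qf: "mpd m M \<longleftrightarrow> (\<forall>x. (\<exists>i<m. x i \<noteq> 0) \<longrightarrow> qf m M x > 0)"
  by (simp add: mpd_def qf_def)

lemma mpd_cong: "(\<And>i j. i < m \<Longrightarrow> j < m \<Longrightarrow> M i j = N i j) \<Longrightarrow> mpd m M \<longleftrightarrow> mpd m N"
  by (simp add: mpd_def)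

lemma qf_nonneg: "mpd m M \<Longrightarrow> qf m M x \<ge> 0"
  by (cases "\<exists>i<m. x i \<noteq> 0") (auto simp: mpd_qf qf_def intro: less_imp_le)

lemma qf_dotm: "qf m M x = dotm m x (mapply m M x)"
  by (simp add: qf_def dotm_def mapply_def sum_distrib_left mult.assoc)

lemma dotm_self_nonneg: "dotm m x x \<ge> 0"
  unfolding dotm_def by (intro sum_nonneg) simp

lemma dotm_self_eq_0: "dotm m x x = 0 \<Longrightarrow> i < m \<Longrightarrow> x i = 0"
  unfolding dotm_def by (subst (asm) sum_nonneg_eq_0_iff) auto

lemma dotm_component: "i < m \<Longrightarrow> (x i)\<^sup>2 \<le> dotm m x x"
  unfolding dotm_def power2_eq_square
  by (rule member_le_sum[of i "{..<m}" "\<lambda>i. x i * x i"]) auto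

lemma dotm_sym_mapply:
  assumes "msym m M"
  shows "dotm m x (mapply m M y) = dotm m y (mapply m M x)"
proof -
  have "dotm m x (mapply m M y) = (\<Sum>i<m. \<Sum>j<m. x i * (M i j * y j))"
    by (simp add: dotm_def mapply_def sum_distrib_left)
  also have "\<dots> = (\<Sum>j<m. \<Sum>i<m. x i * (M i j * y j))" by (rule sum.swap)
  also have "\<dots> = (\<Sum>j<m. \<Sum>i<m. y j * (M j i * x i))"
    using assms by (intro sum.cong refl) (auto simp: msym_def)
  finally show ?thesis by (simp add: dotm_def mapply_def sum_distrib_left)
qed

text \<open>The form at x + t y is a quadratic polynomial in t that is never negative; evaluating it
  at its minimum gives the discriminant inequality. The form may be degenerate, so a vanishing
  leading coefficient is a separate case.\<close>

lemma psd_cauchy_schwarz: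
  assumes sym: "msym m M" and psd: "\<And>x. qf m M x \<ge> 0"
  shows "(dotm m x (mapply m M y))\<^sup>2 \<le> qf m M x * qf m M y"
proof -
  define a b c where "a = qf m M y" and "b = dotm m x (mapply m M y)" and "c = qf m M x"
  have pos: "c + 2 * t * b + t\<^sup>2 * a \<ge> 0" for t
  proof -
    have "0 \<le> qf m M (\<lambda>i. x i + t * y i)" by (rule psd)
    also have "qf m M (\<lambda>i. x i + t * y i) = qf m M x + t * dotm m x (mapply m M y)
        + t * dotm m y (mapply m M x) + t\<^sup>2 * qf m M y"
      unfolding qf_dotm
      by (simp add: dotm_def mapply_def sum.distrib sum_distrib_left distrib_left distrib_right
          power2_eq_square mult_ac)
    also have "dotm m y (mapply m M x) = b" unfolding b_def by (rule dotm_sym_mapply[OF sym])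
    finally show ?thesis by (simp add: a_def b_def c_def)
  qed
  have a0: "a \<ge> 0" unfolding a_def by (rule psd)
  show ?thesis
  proof (cases "a = 0")
    case True
    have "b = 0"
    proof (rule ccontr)
      assume b: "b \<noteq> 0"
      \<comment> \<open>For a = 0 the polynomial is affine in t, and this t is the point where its
        value is -1.\<close>
      have "c + 2 * (- (c + 1) / (2 * b)) * b + (- (c + 1) / (2 * b))\<^sup>2 * a = - 1"
        using b True by (simp add: field_simps)
      then show False using pos[of "- (c + 1) / (2 * b)"] by simp
    qed
    then show ?thesis using True by (simp add: a_def b_def)
  next
    case False
    have "c + 2 * (- b / a) * b + (- b / a)\<^sup>2 * a = (c * a - b\<^sup>2) / a"
      using False by (simp add: field_simps power2_eq_square)
    then have "(c * a - b\<^sup>2) / a \<ge> 0" using pos[of "- b / a"] by simp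
    then have "c * a - b\<^sup>2 \<ge> 0" using a0 False by (simp add: zero_le_divide_iff)
    then show ?thesis by (simp add: a_def b_def c_def)
  qed
qed

text \<open>A crude operator norm bound from |x_i x_j| <= |x|^2. Besides boundedness it serves to
  show that positive definiteness survives small perturbations.\<close>

lemma qf_abs_le: "\<bar>qf m M x\<bar> \<le> (\<Sum>i<m. \<Sum>j<m. \<bar>M i j\<bar>) * dotm m x x"
proof -
  have "\<bar>qf m M x\<bar> \<le> (\<Sum>i<m. \<Sum>j<m. \<bar>x i * M i j * x j\<bar>)"
    unfolding qf_def by (rule order_trans[OF sum_abs]) (intro sum_mono sum_abs)
  also have "\<dots> \<le> (\<Sum>i<m. \<Sum>j<m. \<bar>M i j\<bar> * dotm m x x)"
  proof (intro sum_mono)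
    fix i j assume "i \<in> {..<m}" "j \<in> {..<m}"
    then have *: "(x i)\<^sup>2 \<le> dotm m x x" "(x j)\<^sup>2 \<le> dotm m x x" by (auto intro: dotm_component)
    have "0 \<le> (\<bar>x i\<bar> - \<bar>x j\<bar>)\<^sup>2" by simp
    then have "2 * (\<bar>x i\<bar> * \<bar>x j\<bar>) \<le> (x i)\<^sup>2 + (x j)\<^sup>2" by (simp add: power2_diff)
    then have "\<bar>x i\<bar> * \<bar>x j\<bar> \<le> dotm m x x" using * by linarith
    then show "\<bar>x i * M i j * x j\<bar> \<le> \<bar>M i j\<bar> * dotm m x x"
      by (simp add: abs_mult mult.assoc mult.left_commute[of "\<bar>x i\<bar>"] mult_left_mono)
  qed
  finally show ?thesis by (simp add: sum_distrib_right)
qed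

lemma qf_bounded:
  obtains c where "c > 0" "\<And>x. \<bar>qf m M x\<bar> \<le> c * dotm m x x"
proof
  let ?s = "\<Sum>i<m. \<Sum>j<m. \<bar>M i j\<bar>"
  have "?s \<ge> 0" by (intro sum_nonneg) simp
  then show "?s + 1 > 0" by simp
  show "\<bar>qf m M x\<bar> \<le> (?s + 1) * dotm m x x" for x
    using qf_abs_le[of m M x] dotm_self_nonneg[of m x] by (simp add: distrib_right)
qed

text \<open>Instead of compactness of the sphere: Cauchy-Schwarz for M with x and M^(-1) x gives
  |x|^4 <= (x'Mx)(x'M^(-1)x), and the last factor is at most c |x|^2. Hence the constant
  1/c.\<close>

lemma mpd_coercive:
  assumes sym: "msym m M" and pd: "mpd m M"
  obtains \<delta> where "\<delta> > 0" "\<And>x. \<delta> * dotm m x x \<le> qf m M x"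
proof -
  obtain c where c: "c > 0" "\<And>x. \<bar>qf m (minv m M) x\<bar> \<le> c * dotm m x x"
    by (rule qf_bounded[of m "minv m M"]) blast
  have inv: "is_inv m M (minv m M)" by (rule is_inv_minv[OF mpd_mdet_nonzero[OF pd]])
  have "1 / c * dotm m x x \<le> qf m M x" for x
  proof (cases "dotm m x x = 0")
    case True then show ?thesis using qf_nonneg[OF pd] by simp
  next
    case False
    then have pos: "dotm m x x > 0" using dotm_self_nonneg[of m x] by simp
    define y where "y = mapply m (minv m M) x"
    have My: "mapply m M y i = x i" if "i < m" for i
    proof -
      have "mapply m M y i = mapply m (mmult m M (minv m M)) x i" by (simp add: y_def mapply_mmult)
      also have "\<dots> = mapply m (mid m) x i" using inv that by (simp add: mapply_def is_inv_def)
      finally show ?thesis using that by (simp add: mapply_def mid_sum_left)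
    qed
    have "(dotm m x (mapply m M y))\<^sup>2 \<le> qf m M x * qf m M y"
      by (rule psd_cauchy_schwarz[OF sym qf_nonneg[OF pd]])
    moreover have "dotm m x (mapply m M y) = dotm m x x" by (simp add: dotm_def My)
    moreover have "qf m M y = qf m (minv m M) x"
      unfolding qf_dotm y_def[symmetric] by (simp add: dotm_def My mult.commute)
    ultimately have "(dotm m x x)\<^sup>2 \<le> qf m M x * qf m (minv m M) x" by simp
    also have "\<dots> \<le> qf m M x * (c * dotm m x x)"
      using c(2)[of x] by (intro mult_left_mono qf_nonneg[OF pd]) auto
    finally have "dotm m x x * dotm m x x \<le> (qf m M x * c) * dotm m x x"
      by (simp add: power2_eq_square mult_ac)
    then have "dotm m x x \<le> qf m M x * c" using pos by simp
    then show ?thesis using c(1) by (simp add: field_simps)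
  qed
  then show ?thesis using that[of "1 / c"] c(1) by simp
qed

lemma mpd_sqrt_unique:
  assumes R: "msym m R" "mpd m R" and S: "msym m S" "mpd m S"
    and eq: "\<And>i j. i < m \<Longrightarrow> j < m \<Longrightarrow> mmult m R R i j = mmult m S S i j"
    and ij: "i < m" "j < m"
  shows "R i j = S i j"
proof -
  define D where "D = (\<lambda>i j. R i j - S i j)"
  have symD: "D i j = D j i" if "i < m" "j < m" for i j
    using that R(1) S(1) by (simp add: D_def msym_def)
  \<comment> \<open>\<open>R D + D S = R\<^sup>2 - S\<^sup>2 = 0\<close>; pairing this with \<open>D\<close> gives two nonnegative numbers with sum 0.\<close>
  have RD: "mmult m R D i j = - mmult m D S i j" if "i < m" "j < m" for i j
    using eq[OF that] by (simp add: mmult_def D_def algebra_simps sum_subtractf)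
  have "(\<Sum>j<m. qf m R (\<lambda>i. D i j)) = (\<Sum>j<m. \<Sum>i<m. D i j * mmult m R D i j)"
    by (simp add: qf_dotm dotm_def mapply_def mmult_def)
  also have "\<dots> = (\<Sum>j<m. \<Sum>i<m. - (D i j * mmult m D S i j))" using RD by simp
  also have "\<dots> = (\<Sum>i<m. \<Sum>j<m. - (D i j * mmult m D S i j))" by (rule sum.swap)
  also have "\<dots> = - (\<Sum>i<m. \<Sum>j<m. \<Sum>l<m. D i j * (S j l * D i l))"
    unfolding sum_negf using S(1)
    by (intro arg_cong[where f = uminus] sum.cong refl)
       (auto simp: mmult_def sum_distrib_left msym_def intro!: sum.cong)
  also have "\<dots> = - (\<Sum>i<m. qf m S (\<lambda>j. D i j))"
    by (simp add: qf_dotm dotm_def mapply_def sum_distrib_left)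
  finally have sum0: "(\<Sum>j<m. qf m R (\<lambda>i. D i j)) = - (\<Sum>i<m. qf m S (\<lambda>j. D i j))" .
  have "(\<Sum>j<m. qf m R (\<lambda>i. D i j)) \<ge> 0" "(\<Sum>i<m. qf m S (\<lambda>j. D i j)) \<ge> 0"
    by (intro sum_nonneg qf_nonneg R S)+
  with sum0 have "(\<Sum>j<m. qf m R (\<lambda>i. D i j)) = 0" by linarith
  then have "qf m R (\<lambda>i. D i j) = 0"
    using ij by (subst (asm) sum_nonneg_eq_0_iff) (auto intro: qf_nonneg R)
  then have "D i j = 0"
    using R(2) ij unfolding mpd_qf by (metis less_irrefl)
  then show ?thesis by (simp add: D_def)
qed

section \<open>Powers of a contraction and the binomial series of 1 - E\<close>

fun mpow :: "nat \<Rightarrow> rmat \<Rightarrow> nat \<Rightarrow> rmat" where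
  "mpow m E 0 = mid m"
| "mpow m E (Suc k) = mmult m E (mpow m E k)"

lemma mpow_add:
  assumes "i < m" "j < m"
  shows "mmult m (mpow m E s) (mpow m E t) i j = mpow m E (s + t) i j"
  using assms
proof (induction s arbitrary: i)
  case 0 then show ?case by (simp add: mmult_mid_left)
next
  case (Suc s)
  then show ?case by (simp add: mmult_assoc) (rule mmult_cong, auto)
qed

lemma mpow_sym:
  assumes "msym m E" shows "i < m \<Longrightarrow> j < m \<Longrightarrow> mpow m E k i j = mpow m E k j i"
proof (induction k arbitrary: i j)
  case 0 then show ?case by (auto simp: mid_def)
next
  case (Suc k)
  have 1: "mpow m E 1 a b = E a b" if "a < m" "b < m" for a b
    using that by (simp add: mmult_mid_right)
  have "mpow m E (Suc k) i j = (\<Sum>l<m. E i l * mpow m E k l j)" by (simp add: mmult_def)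
  also have "\<dots> = (\<Sum>l<m. mpow m E k j l * E l i)"
    using Suc assms by (intro sum.cong refl) (auto simp: msym_def)
  also have "\<dots> = mmult m (mpow m E k) (mpow m E 1) j i"
    unfolding mmult_def using Suc.prems 1 by (intro sum.cong refl) auto
  also have "\<dots> = mpow m E (Suc k) j i" using Suc.prems by (subst mpow_add) auto
  finally show ?case .
qed

text \<open>The bounds on the quadratic form express that the eigenvalues of \<open>E\<close> lie in
  [0, r]. They are met by E = 1 - M/c for positive definite M and c large enough.\<close>

context
  fixes m :: nat and E :: rmat and r :: real
  assumes Esym: "msym m E"
    and E_ge: "\<And>x. qf m E x \<ge> 0" and E_le: "\<And>x. qf m E x \<le> r * dotm m x x"
    and r: "0 \<le> r" "r < 1"
begin

text \<open>With y = Ex, Cauchy-Schwarz for the form of E gives |y|^4 = (y'Ex)^2 <= (y'Ey)(x'Ex) <=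
  r|y|^2 * r|x|^2; then |y|^2 is cancelled.\<close>

lemma mapply_contraction: "dotm m (mapply m E x) (mapply m E x) \<le> r\<^sup>2 * dotm m x x"
proof -
  define y where "y = mapply m E x"
  show ?thesis
  proof (cases "dotm m y y = 0")
    case True then show ?thesis using dotm_self_nonneg[of m x] by (simp add: y_def)
  next
    case False
    then have pos: "dotm m y y > 0" using dotm_self_nonneg[of m y] by simp
    have "(dotm m y y)\<^sup>2 = (dotm m y (mapply m E x))\<^sup>2" by (simp add: y_def)
    also have "\<dots> \<le> qf m E y * qf m E x" by (rule psd_cauchy_schwarz[OF Esym E_ge])
    also have "\<dots> \<le> (r * dotm m y y) * (r * dotm m x x)"
      by (intro mult_mono E_le E_ge mult_nonneg_nonneg r dotm_self_nonneg)
    finally have "dotm m y y * dotm m y y \<le> (r\<^sup>2 * dotm m x x) * dotm m y y"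
      by (simp add: power2_eq_square mult_ac)
    then show ?thesis using pos by (simp add: y_def)
  qed
qed

lemma mpow_bound:
  assumes "i < m" "j < m" shows "\<bar>mpow m E k i j\<bar> \<le> r ^ k"
proof -
  have "dotm m (\<lambda>i. mpow m E k i j) (\<lambda>i. mpow m E k i j) \<le> (r ^ k)\<^sup>2"
  proof (induction k)
    case 0
    have "dotm m (\<lambda>i. mid m i j) (\<lambda>i. mid m i j) = mid m j j"
      unfolding dotm_def using assms by (rule_tac mid_sum_right)
    then show ?case using assms by (simp add: mid_def)
  next
    case (Suc k)
    have *: "(\<lambda>i. mpow m E (Suc k) i j) = mapply m E (\<lambda>i. mpow m E k i j)"
      by (simp add: mapply_def mmult_def)
    have "dotm m (\<lambda>i. mpow m E (Suc k) i j) (\<lambda>i. mpow m E (Suc k) i j)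
        \<le> r\<^sup>2 * dotm m (\<lambda>i. mpow m E k i j) (\<lambda>i. mpow m E k i j)"
      unfolding * by (rule mapply_contraction)
    also have "\<dots> \<le> r\<^sup>2 * (r ^ k)\<^sup>2" using Suc by (intro mult_left_mono) auto
    finally show ?case by (simp add: power_mult_distrib)
  qed
  then have "(mpow m E k i j)\<^sup>2 \<le> (r ^ k)\<^sup>2" 
    using dotm_component[OF assms(1), of "\<lambda>i. mpow m E k i j"] by linarith
  then show ?thesis using r by (simp add: abs_le_square_iff[symmetric])
qed

text \<open>\<open>mroot a\<close> is the binomial series of \<open>(1 - E)\<^sup>a\<close>. As the square of \<open>mroot (1/4)\<close>, the root
  \<open>mroot (1/2)\<close> is positive definite.\<close>

definition mroot_term :: "real \<Rightarrow> nat \<Rightarrow> nat \<Rightarrow> nat \<Rightarrow> real" where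
  "mroot_term a i j k = (a gchoose k) * (-1) ^ k * mpow m E k i j"

definition mroot :: "real \<Rightarrow> rmat" where
  "mroot a = (\<lambda>i j. \<Sum>k. mroot_term a i j k)"

lemma mroot_summable:
  assumes "i < m" "j < m" shows "summable (\<lambda>k. norm (mroot_term a i j k))"
proof (rule summable_comparison_test)
  have "summable (\<lambda>k. norm ((a gchoose k) * r ^ k))"
    using r by (intro abs_summable_in_conv_radius) (auto simp: conv_radius_gchoose)
  then show "summable (\<lambda>k. \<bar>a gchoose k\<bar> * r ^ k)" using r by (simp add: abs_mult power_abs)
  show "\<exists>N. \<forall>k\<ge>N. norm (norm (mroot_term a i j k)) \<le> \<bar>a gchoose k\<bar> * r ^ k"
    using mpow_bound[OF assms]
    by (auto simp: mroot_term_def abs_mult power_abs intro!: mult_left_mono)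
qed

text \<open>Powers of \<open>E\<close> multiply like monomials, so the Cauchy product of the two
  series has the coefficients of Vandermonde's identity for generalized binomials: the exponent law
  (1 - E)^a (1 - E)^b = (1 - E)^(a + b).\<close>

lemma mroot_mult:
  assumes "i < m" "j < m"
  shows "mmult m (mroot a) (mroot b) i j = mroot (a + b) i j"
proof -
  have "(\<lambda>k. \<Sum>l<m. \<Sum>t\<le>k. mroot_term a i l t * mroot_term b l j (k - t)) sums
      (\<Sum>l<m. (\<Sum>k. mroot_term a i l k) * (\<Sum>k. mroot_term b l j k))"
    using assms by (intro sums_sum Cauchy_product_sums mroot_summable) auto
  moreover have "(\<Sum>l<m. \<Sum>t\<le>k. mroot_term a i l t * mroot_term b l j (k - t)) = mroot_term (a + b) i j k" for k
  proof -
    have "(\<Sum>l<m. \<Sum>t\<le>k. mroot_term a i l t * mroot_term b l j (k - t))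
       = (\<Sum>t\<le>k. \<Sum>l<m. mroot_term a i l t * mroot_term b l j (k - t))"
      by (rule sum.swap)
    also have "\<dots> = (\<Sum>t\<le>k. (a gchoose t) * (b gchoose (k - t)) * (-1) ^ k * mpow m E k i j)"
    proof (intro sum.cong refl)
      fix t assume t: "t \<in> {..k}"
      have s: "(-1) ^ t * (-1) ^ (k - t) = ((-1) ^ k :: real)" using t by (simp flip: power_add)
      have "(\<Sum>l<m. mroot_term a i l t * mroot_term b l j (k - t))
          = (a gchoose t) * (b gchoose (k - t)) * ((-1) ^ t * (-1) ^ (k - t))
            * mmult m (mpow m E t) (mpow m E (k - t)) i j"
        by (simp add: mroot_term_def mmult_def sum_distrib_left mult_ac)
      then show "(\<Sum>l<m. mroot_term a i l t * mroot_term b l j (k - t))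
          = (a gchoose t) * (b gchoose (k - t)) * (-1) ^ k * mpow m E k i j"
        using t unfolding s mpow_add[OF assms] by simp
    qed
    also have "\<dots> = ((a + b) gchoose k) * (-1) ^ k * mpow m E k i j"
      by (simp add: gbinomial_Vandermonde[symmetric] sum_distrib_right atMost_atLeast0)
    finally show ?thesis by (simp add: mroot_term_def)
  qed
  ultimately show ?thesis by (simp add: mmult_def mroot_def sums_iff)
qed

lemma mroot_1:
  assumes "i < m" "j < m" shows "mroot 1 i j = mid m i j - E i j"
proof -
  have "(1 gchoose k :: real) = 0" if "k \<ge> 2" for k
    using that binomial_gbinomial[of 1 k, where ?'a = real] by (simp add: binomial_eq_0)
  then have "mroot 1 i j = (\<Sum>k\<in>{0,1}. mroot_term 1 i j k)"
    unfolding mroot_def by (intro suminf_finite) (auto simp: mroot_term_def)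
  then show ?thesis using assms by (simp add: mroot_term_def mmult_mid_right)
qed

lemma mroot_sym: "msym m (mroot a)"
  using mpow_sym[OF Esym] by (simp add: msym_def mroot_def mroot_term_def)

end

lemma sqrt_mult_mult: "c \<ge> 0 \<Longrightarrow> (sqrt c * x) * (sqrt c * y) = c * (x * y)"
  by (metis mult.assoc mult.left_commute real_sqrt_mult_self abs_of_nonneg)

lemma mpd_sqrt_exists:
  assumes sym: "msym m M" and pd: "mpd m M"
  obtains R where "msym m R" "mpd m R" "\<And>i j. i < m \<Longrightarrow> j < m \<Longrightarrow> mmult m R R i j = M i j"
proof -
  obtain \<delta> where \<delta>: "\<delta> > 0" "\<And>x. \<delta> * dotm m x x \<le> qf m M x"
    by (rule mpd_coercive[OF sym pd]) blast
  obtain c0 where c0: "c0 > 0" "\<And>x. \<bar>qf m M x\<bar> \<le> c0 * dotm m x x"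
    by (rule qf_bounded[of m M]) blast
  \<comment> \<open>\<open>c0\<close> makes M/c at most 1, so that E >= 0; the extra summand ensures
    \<open>\<delta> \<le> c\<close>, so that r = 1 - \<open>\<delta>\<close>/c is not
    negative.\<close>
  define c where "c = c0 + \<delta>"
  have c: "c > 0" "\<delta> \<le> c" using \<delta> c0 by (auto simp: c_def)
  have cM: "qf m M x \<le> c * dotm m x x" for x
  proof -
    have "0 \<le> \<delta> * dotm m x x" using \<delta> dotm_self_nonneg[of m x] by simp
    then show ?thesis using c0(2)[of x] by (simp add: c_def distrib_right)
  qed
  define E where "E = (\<lambda>i j. mid m i j - M i j / c)"
  have qE: "qf m E x = dotm m x x - qf m M x / c" for x
  proof -
    have "qf m E x = (\<Sum>i<m. x i * (\<Sum>j<m. mid m i j * x j)) - qf m M x / c"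
      by (simp add: qf_def E_def algebra_simps sum_subtractf sum_distrib_left sum_divide_distrib)
    then show ?thesis by (simp add: mid_sum_left dotm_def)
  qed
  define r where "r = 1 - \<delta> / c"
  have Esym: "msym m E" using sym by (auto simp: E_def msym_def mid_def)
  have E_ge: "qf m E x \<ge> 0" for x using cM[of x] c by (simp add: qE field_simps)
  have E_le: "qf m E x \<le> r * dotm m x x" for x
    using \<delta>(2)[of x] c by (simp add: qE r_def field_simps)
  have r: "0 \<le> r" "r < 1" using \<delta>(1) c by (auto simp: r_def)
  note * = Esym E_ge E_le r
  let ?P = "mroot m E"
  have P1: "?P 1 i j = M i j / c" if "i < m" "j < m" for i j
    using mroot_1[OF * that] by (simp add: E_def)
  have "mpd m (\<lambda>i j. M i j / c)"
    using pd c by (simp add: mpd_def sum_divide_distrib[symmetric])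
  then have "mdet m (?P 1) \<noteq> 0" using P1 by (metis (no_types, lifting) mdet_cong mpd_mdet_nonzero)
  \<comment> \<open>The fourth root is invertible because it is a factor of the invertible matrix
    M/c: the exponents 1/4 and 3/4 add up to 1.\<close>
  moreover have "mdet m (?P 1) = mdet m (?P (1/4)) * mdet m (?P (3/4))"
    unfolding mdet_mmult[symmetric] using mroot_mult[OF *, of _ _ "1/4" "3/4"] by (intro mdet_cong) simp
  ultimately have d4: "mdet m (?P (1/4)) \<noteq> 0" by auto
  have "mpd m (?P (1/2))"
    using mroot_mult[OF *, of _ _ "1/4" "1/4"] by (intro mpd_square[OF mroot_sym[OF *] d4]) simp
  then have pd': "mpd m (\<lambda>i j. sqrt c * ?P (1/2) i j)"
    using c by (simp add: mpd_def mult.left_commute[of _ "sqrt c"] mult.assoc sum_distrib_left[symmetric])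
  show ?thesis
  proof (rule that[of "\<lambda>i j. sqrt c * ?P (1/2) i j"])
    show "msym m (\<lambda>i j. sqrt c * ?P (1/2) i j)"
      using mroot_sym[OF *, of "1/2"] by (simp add: msym_def)
    show "mpd m (\<lambda>i j. sqrt c * ?P (1/2) i j)" by (rule pd')
    fix i j assume ij: "i < m" "j < m"
    have "mmult m (\<lambda>i j. sqrt c * ?P (1/2) i j) (\<lambda>i j. sqrt c * ?P (1/2) i j) i j
        = c * mmult m (?P (1/2)) (?P (1/2)) i j"
      unfolding mmult_def sum_distrib_left using c
      by (intro sum.cong refl sqrt_mult_mult) simp
    also have "\<dots> = M i j" using mroot_mult[OF * ij, of "1/2" "1/2"] P1[OF ij] c by simp
    finally show "mmult m (\<lambda>i j. sqrt c * ?P (1/2) i j) (\<lambda>i j. sqrt c * ?P (1/2) i j) i j = M i j" .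
  qed
qed

text \<open>As for \<open>minv\<close>: the candidate is cut off outside the block to meet
  \<open>mat_on\<close>, and \<open>mpd_sqrt_unique\<close> settles the entries inside.\<close>

lemma msqrt_eqI:
  assumes R: "msym m R" "mpd m R" "\<And>i j. i < m \<Longrightarrow> j < m \<Longrightarrow> mmult m R R i j = M i j"
    and "i < m" "j < m"
  shows "msqrt m M i j = R i j"
proof -
  let ?R = "\<lambda>i j. if i < m \<and> j < m then R i j else 0"
  have 1: "mat_on m ?R" by (auto simp: mat_on_def)
  have 2: "msym m ?R" using R(1) by (auto simp: msym_def)
  have 3: "mpd m ?R" using R(2) by (simp add: mpd_def)
  have 4: "mmult m ?R ?R i j = M i j" if "i < m" "j < m" for i j
    using R(3)[OF that] that by (simp add: mmult_def)
  have "msqrt m M = ?R" unfolding msqrt_def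
  proof (rule the_equality)
    fix S assume S: "mat_on m S \<and> msym m S \<and> mpd m S \<and> (\<forall>i<m. \<forall>j<m. mmult m S S i j = M i j)"
    show "S = ?R"
    proof (intro ext)
      fix i j show "S i j = ?R i j"
      proof (cases "i < m \<and> j < m")
        case True
        then show ?thesis using S R by (auto intro!: mpd_sqrt_unique[of m S R])
      next
        case False then show ?thesis using S by (auto simp: mat_on_def)
      qed
    qed
  qed (use 1 2 3 4 in auto)
  then show ?thesis using assms by simp
qed

lemma msqrt_props:
  assumes "msym m M" "mpd m M"
  shows msqrt_sym: "msym m (msqrt m M)" and msqrt_mpd: "mpd m (msqrt m M)"
    and msqrt_square: "\<And>i j. i < m \<Longrightarrow> j < m \<Longrightarrow> mmult m (msqrt m M) (msqrt m M) i j = M i j"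
proof -
  obtain R where R: "msym m R" "mpd m R" "\<And>i j. i < m \<Longrightarrow> j < m \<Longrightarrow> mmult m R R i j = M i j"
    by (rule mpd_sqrt_exists[OF assms]) blast
  have eq: "msqrt m M i j = R i j" if "i < m" "j < m" for i j using msqrt_eqI[OF R that] by simp
  show "msym m (msqrt m M)" using R(1) eq by (simp add: msym_def)
  show "mpd m (msqrt m M)" using R(2) eq mpd_cong[of m "msqrt m M" R] by simp
  fix i j assume "i < m" "j < m"
  then show "mmult m (msqrt m M) (msqrt m M) i j = M i j"
    using R(3)[of i j] eq by (simp add: mmult_def)
qed

section \<open>Block indices\<close>

text \<open>One offset function covers three layouts: the rows (\<open>roff\<close>), the
  coordinates after the first K (\<open>coff\<close>), and, with constant block size K, the stacked
  index i + K * j of a vectorised matrix.\<close>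

definition boff :: "(nat \<Rightarrow> nat) \<Rightarrow> nat \<Rightarrow> nat" where
  "boff s k = (\<Sum>j<k. s j)"

lemma boff_Suc: "boff s (Suc k) = boff s k + s k"
  by (simp add: boff_def)

lemma boff_mono: "k \<le> l \<Longrightarrow> boff s k \<le> boff s l"
  unfolding boff_def by (rule sum_mono2) auto

lemma boff_less: "k < K \<Longrightarrow> i < s k \<Longrightarrow> boff s k + i < boff s K"
  using boff_mono[of "Suc k" K s] by (simp add: boff_Suc)

lemma boff_unique:
  assumes "i < s k" "boff s l \<le> boff s k + i" "boff s k + i < boff s l + s l"
  shows "l = k"
  using assms boff_mono[of "Suc l" k s] boff_mono[of "Suc k" l s]
  by (cases l k rule: linorder_cases) (auto simp: boff_Suc)

lemma sum_lessThan_add: "sum f {..<a + b} = sum f {..<a} + (\<Sum>i<b. f (a + i))"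
  for f :: "nat \<Rightarrow> 'a::comm_monoid_add"
  by (induction b) (auto simp: add.assoc)

lemma sum_boff: "sum f {..<boff s K} = (\<Sum>k<K. \<Sum>i<s k. f (boff s k + i))"
  for f :: "nat \<Rightarrow> 'a::comm_monoid_add"
proof (induction K)
  case 0 then show ?case by (simp add: boff_def)
next
  case (Suc K) then show ?case by (simp add: boff_Suc sum_lessThan_add)
qed

lemma boff_cases:
  assumes "c < boff s K" obtains k i where "k < K" "i < s k" "c = boff s k + i"
proof -
  have "\<exists>k<K. \<exists>i<s k. c = boff s k + i" using assms
  proof (induction K)
    case 0 then show ?case by (simp add: boff_def)
  next
    case (Suc K)
    show ?case
    proof (cases "c < boff s K")
      case True then show ?thesis using Suc.IH less_SucI by blast
    next
      case False
      then have "c - boff s K < s K" "c = boff s K + (c - boff s K)"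
        using Suc.prems by (auto simp: boff_Suc)
      then show ?thesis by blast
    qed
  qed
  then show ?thesis using that by blast
qed

lemma roff_boff: "roff nb = boff nb"
  by (simp add: fun_eq_iff roff_def boff_def)

lemma coff_boff: "coff nb = boff (\<lambda>j. nb j - 1)"
  by (simp add: fun_eq_iff coff_def boff_def)

section \<open>Kronecker squares\<close>

lemma boff_const: "boff (\<lambda>_. K) k = K * k"
  by (simp add: boff_def mult.commute)

lemma sum_vec: "sum f {..<K * K} = (\<Sum>j<K. \<Sum>i<K. f (i + K * j))"
  for f :: "nat \<Rightarrow> 'a::comm_monoid_add"
  using sum_boff[of f "\<lambda>_. K" K] by (simp add: boff_const add.commute)

lemma vec_index_less: "i < K \<Longrightarrow> j < K \<Longrightarrow> i + K * j < K * (K::nat)"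
  using boff_less[of j K i "\<lambda>_. K"] by (simp add: boff_const add.commute)

lemma vec_index_cases:
  fixes p K :: nat
  assumes "p < K * K" obtains i j where "i < K" "j < K" "p = i + K * j"
proof -
  have "p mod K < K" "p div K < K"
    using assms by (metis less_nat_zero_code mod_less_divisor mult_is_0 neq0_conv)
      (simp add: assms less_mult_imp_div_less)
  then show ?thesis using that[of "p mod K" "p div K"] by simp
qed

lemma vec_index_inj:
  fixes K :: nat
  assumes "i < K" "k < K" shows "i + K * j = k + K * l \<longleftrightarrow> i = k \<and> j = l"
proof
  assume eq: "i + K * j = k + K * l"
  then have "(i + K * j) mod K = (k + K * l) mod K" "(i + K * j) div K = (k + K * l) div K" by simp_all
  then show "i = k \<and> j = l" using assms by simp
qed simp

lemma kron_mult:
  assumes "p < K * K" "q < K * K"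
  shows "mmult (K * K) (kron K B C) (kron K B' C') p q = kron K (mmult K B B') (mmult K C C') p q"
proof -
  have "mmult (K * K) (kron K B C) (kron K B' C') p q
     = (\<Sum>j<K. \<Sum>i<K. (B (p div K) j * B' j (q div K)) * (C (p mod K) i * C' i (q mod K)))"
    using assms unfolding mmult_def sum_vec
    by (intro sum.cong refl) (simp add: kron_def vec_index_less)
  then show ?thesis using assms by (simp add: kron_def mmult_def sum_product)
qed

lemma vec_index_bounds: "p < K * K \<Longrightarrow> p mod K < K \<and> p div K < (K::nat)"
  by (erule vec_index_cases) simp

lemma kron_cong:
  assumes "p < K * K" "q < K * K"
    "\<And>i j. i < K \<Longrightarrow> j < K \<Longrightarrow> B i j = B' i j" "\<And>i j. i < K \<Longrightarrow> j < K \<Longrightarrow> C i j = C' i j"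
  shows "kron K B C p q = kron K B' C' p q"
  using assms vec_index_bounds[of p K] vec_index_bounds[of q K] by (simp add: kron_def)

lemma kron_mid: "p < K * K \<Longrightarrow> q < K * K \<Longrightarrow> kron K (mid K) (mid K) p q = mid (K * K) p q"
  using vec_index_bounds[of p K] vec_index_bounds[of q K]
  by (auto simp: kron_def mid_def) (metis div_mult_mod_eq)

lemma kron_inv:
  assumes "is_inv K B N" shows "is_inv (K * K) (kron K B B) (kron K N N)"
  unfolding is_inv_def
proof (intro allI impI)
  fix p q assume pq: "p < K * K" "q < K * K"
  show "mmult (K * K) (kron K B B) (kron K N N) p q = mid (K * K) p q"
    unfolding kron_mult[OF pq] kron_mid[OF pq, symmetric]
    using assms by (intro kron_cong pq) (auto simp: is_inv_def)
qed

lemma kron_sym: "msym K B \<Longrightarrow> msym (K * K) (kron K B B)"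
  using vec_index_bounds[of _ K] by (auto simp: msym_def kron_def)

text \<open>With T the root of R, the Kronecker square of R is the square of the Kronecker square of
  T, which is symmetric and invertible.\<close>

lemma mpd_kron:
  assumes "msym K R" "mpd K R" shows "mpd (K * K) (kron K R R)"
proof (rule mpd_square)
  let ?T = "msqrt K R"
  note T = msqrt_props[OF assms]
  show "msym (K * K) (kron K ?T ?T)" by (rule kron_sym[OF T(1)])
  show "mdet (K * K) (kron K ?T ?T) \<noteq> 0"
    by (rule is_inv_mdet_nonzero[OF kron_inv[OF is_inv_minv[OF mpd_mdet_nonzero[OF T(2)]]]])
  fix p q assume pq: "p < K * K" "q < K * K"
  show "kron K R R p q = mmult (K * K) (kron K ?T ?T) (kron K ?T ?T) p q"
    unfolding kron_mult[OF pq] using T(3) by (intro kron_cong pq) auto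
qed

text \<open>The Kronecker square of the root is symmetric, positive definite and squares to the
  right matrix, so it is the root by uniqueness.\<close>

lemma msqrt_kron:
  assumes "msym K A" "mpd K A" "p < K * K" "q < K * K"
  shows "msqrt (K * K) (kron K A A) p q = kron K (msqrt K A) (msqrt K A) p q"
proof (rule msqrt_eqI[OF _ _ _ assms(3,4)])
  note R = msqrt_props[OF assms(1,2)]
  show "msym (K * K) (kron K (msqrt K A) (msqrt K A))" by (rule kron_sym[OF R(1)])
  show "mpd (K * K) (kron K (msqrt K A) (msqrt K A))" by (rule mpd_kron[OF R(1,2)])
  fix p q assume pq: "p < K * K" "q < K * K"
  show "mmult (K * K) (kron K (msqrt K A) (msqrt K A)) (kron K (msqrt K A) (msqrt K A)) p q
      = kron K A A p q"
    unfolding kron_mult[OF pq] using R(3) by (intro kron_cong pq) auto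
qed

lemma is_inv_cong:
  assumes "\<And>i j. i < m \<Longrightarrow> j < m \<Longrightarrow> M i j = M' i j" "\<And>i j. i < m \<Longrightarrow> j < m \<Longrightarrow> N i j = N' i j"
  shows "is_inv m M N \<longleftrightarrow> is_inv m M' N'"
  using assms by (simp add: is_inv_def mmult_def)

lemma is_inv_msqrt:
  assumes "msym m M" "mpd m M"
  shows "is_inv m (msqrt m M) (minv m (msqrt m M))"
  by (rule is_inv_minv[OF mpd_mdet_nonzero[OF msqrt_mpd[OF assms]]])

lemma minv_msqrt_square:
  assumes "msym m M" "mpd m M" "i < m" "j < m"
  shows "mmult m (minv m (msqrt m M)) (minv m (msqrt m M)) i j = minv m M i j"
proof (rule minv_eqI[symmetric, OF _ assms(3,4)])
  let ?R = "msqrt m M" and ?N = "minv m (msqrt m M)"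
  have RN: "is_inv m ?R ?N" by (rule is_inv_msqrt[OF assms(1,2)])
  have "mmult m (mmult m ?R ?R) (mmult m ?N ?N) i j = mid m i j" if "i < m" "j < m" for i j
  proof -
    have "mmult m (mmult m ?R ?R) (mmult m ?N ?N) i j = mmult m ?R (mmult m (mmult m ?R ?N) ?N) i j"
      by (simp add: mmult_assoc)
    also have "\<dots> = mmult m ?R ?N i j"
      using RN that by (intro mmult_cong refl)
        (simp add: is_inv_def mmult_def[of m "mmult m _ _"] mid_sum_left)
    finally show ?thesis using RN that by (simp add: is_inv_def)
  qed
  then have "is_inv m (mmult m ?R ?R) (mmult m ?N ?N)" by (simp add: is_inv_def)
  then show "is_inv m M (mmult m ?N ?N)"
    using is_inv_cong[of m "mmult m ?R ?R" M] msqrt_square[OF assms(1,2)] by blast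
qed

lemma Aot_invsqrt_kron:
  assumes "msym K A" "mpd K A" "p < K * K" "q < K * K"
  shows "Aot_invsqrt K A p q = kron K (minv K (msqrt K A)) (minv K (msqrt K A)) p q"
  unfolding Aot_invsqrt_def
proof (rule minv_eqI[OF _ assms(3,4)])
  show "is_inv (K * K) (msqrt (K * K) (kron K A A)) (kron K (minv K (msqrt K A)) (minv K (msqrt K A)))"
    using kron_inv[OF is_inv_msqrt[OF assms(1,2)]] msqrt_kron[OF assms(1,2)]
      is_inv_cong[of "K * K" "msqrt (K * K) (kron K A A)" "kron K (msqrt K A) (msqrt K A)"] by blast
qed

lemma Aot_inv_kron:
  assumes "mpd K A" "p < K * K" "q < K * K"
  shows "Aot_inv K A p q = kron K (minv K A) (minv K A) p q"
  unfolding Aot_inv_def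
  by (rule minv_eqI[OF _ assms(2,3)]) (rule kron_inv[OF is_inv_minv[OF mpd_mdet_nonzero[OF assms(1)]]])

lemma vecm_index: "i < K \<Longrightarrow> j < K \<Longrightarrow> vecm K B (i + K * j) = B i j"
  by (simp add: vecm_def vec_index_less)

lemma Ed_index: "i < K \<Longrightarrow> k < K \<Longrightarrow> Ed K k (i + K * j) = (if k = i \<and> k = j then 1 else 0)"
  by (auto simp: Ed_def vec_index_inj)

text \<open>The commutation matrix exchanges k and l, so its sum with the identity adds two
  products. They are the two mixed pairings that reappear in the fourth moments of
  \<open>L0_cov\<close>.\<close>

lemma Aot_inv_HK:
  assumes "mpd K A" "i < K" "j < K" "k < K" "l < K"
  shows "mmult (K * K) (Aot_inv K A) (HK K) (i + K * j) (k + K * l)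
    = minv K A j l * minv K A i k + minv K A j k * minv K A i l"
proof -
  have [simp]: "i + K * j < K * K" "k + K * l < K * K" using assms by (auto intro: vec_index_less)
  have "mmult (K * K) (Aot_inv K A) (HK K) (i + K * j) (k + K * l)
    = (\<Sum>b<K. \<Sum>a<K. minv K A j b * minv K A i a *
        ((if a = k \<and> b = l then 1 else 0) + (if a = l \<and> b = k then 1 else 0)))"
    unfolding mmult_def sum_vec
  proof (intro sum.cong refl)
    fix a b assume ab: "b \<in> {..<K}" "a \<in> {..<K}"
    have 1: "Aot_inv K A (i + K * j) (a + K * b) = minv K A j b * minv K A i a"
      using assms ab by (subst Aot_inv_kron) (auto simp: kron_def vec_index_less)
    have 2: "HK K (a + K * b) (k + K * l) = (if a = k \<and> b = l then 1 else 0) + (if a = l \<and> b = k then 1 else 0)"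
      using ab assms by (auto simp: HK_def mid_def commK_def vec_index_less vec_index_inj)
    show "Aot_inv K A (i + K * j) (a + K * b) * HK K (a + K * b) (k + K * l)
      = minv K A j b * minv K A i a * ((if a = k \<and> b = l then 1 else 0) + (if a = l \<and> b = k then 1 else 0))"
      by (simp only: 1 2)
  qed
  also have "\<dots> = (\<Sum>b<K. (if b = l then minv K A j b * minv K A i k else 0)
       + (if b = k then minv K A j b * minv K A i l else 0))"
  proof (intro sum.cong refl)
    fix b
    have "(\<Sum>a<K. minv K A j b * minv K A i a *
        ((if a = k \<and> b = l then 1 else 0) + (if a = l \<and> b = k then 1 else 0)))
      = (\<Sum>a<K. if a = k then (if b = l then minv K A j b * minv K A i a else 0) else 0)
       + (\<Sum>a<K. if a = l then (if b = k then minv K A j b * minv K A i a else 0) else 0)"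
      unfolding sum.distrib[symmetric] by (intro sum.cong refl) (auto simp: algebra_simps)
    then show "(\<Sum>a<K. minv K A j b * minv K A i a *
        ((if a = k \<and> b = l then 1 else 0) + (if a = l \<and> b = k then 1 else 0)))
      = (if b = l then minv K A j b * minv K A i k else 0) + (if b = k then minv K A j b * minv K A i l else 0)"
      using assms by simp
  qed
  also have "\<dots> = minv K A j l * minv K A i k + minv K A j k * minv K A i l"
    using assms by (simp add: sum.distrib)
  finally show ?thesis .
qed

section \<open>The orthogonal matrix Q and the canonical form of C\<close>

locale block_setting =
  fixes K :: nat and nb :: "nat \<Rightarrow> nat" and U :: "nat \<Rightarrow> rmat"
  assumes K: "K \<ge> 1" and nb: "\<And>k. k < K \<Longrightarrow> nb k \<ge> 2"
    and U: "\<And>k. k < K \<Longrightarrow> is_vperp (nb k) (U k)"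
begin

abbreviation n :: nat where "n \<equiv> ntot K nb"
abbreviation Q :: rmat where "Q \<equiv> Qmat K nb U"
abbreviation col :: "nat \<Rightarrow> nat \<Rightarrow> nat" where "col k i \<equiv> K + coff nb k + i"

lemma n_roff: "n = boff nb K"
  by (simp add: ntot_def boff_def)

lemma n_coff: "n = K + coff nb K"
proof -
  have "n = (\<Sum>k<K. 1 + (nb k - 1))" unfolding ntot_def
    using nb by (intro sum.cong refl) (metis One_nat_def Suc_1 Suc_le_D diff_Suc_1 lessThan_iff plus_1_eq_Suc)
  then show ?thesis by (simp only: sum.distrib coff_def) simp
qed

lemma K_le_n: "K \<le> n" by (simp add: n_coff)

lemma sum_rows: "sum f {..<n} = (\<Sum>k<K. \<Sum>a<nb k. f (roff nb k + a))"
  for f :: "nat \<Rightarrow> 'a::comm_monoid_add"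
  by (simp add: n_roff roff_boff sum_boff)

lemma sum_cols: "sum f {..<n} = (\<Sum>k<K. f k) + (\<Sum>k<K. \<Sum>i<nb k - 1. f (col k i))"
  for f :: "nat \<Rightarrow> 'a::comm_monoid_add"
  by (simp add: n_coff sum_lessThan_add coff_boff sum_boff add.assoc)

lemma row_less: "k < K \<Longrightarrow> a < nb k \<Longrightarrow> roff nb k + a < n"
  by (simp add: n_roff roff_boff boff_less)

lemma col_less: "k < K \<Longrightarrow> i < nb k - 1 \<Longrightarrow> col k i < n"
  by (simp add: n_coff coff_boff boff_less add.assoc)

lemma row_cases: assumes "r < n" obtains k a where "k < K" "a < nb k" "r = roff nb k + a"
  using assms boff_cases[of r nb K] by (metis n_roff roff_boff)

lemma col_cases:
  assumes "c < n"
  obtains "c < K" | k i where "k < K" "i < nb k - 1" "c = col k i"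
proof (cases "c < K")
  case False
  then have "c - K < boff (\<lambda>j. nb j - 1) K" using assms by (simp add: n_coff coff_boff)
  then obtain k i where "k < K" "i < nb k - 1" "c - K = boff (\<lambda>j. nb j - 1) k + i"
    by (rule boff_cases)
  then show ?thesis using False that(2)[of k i] by (simp add: coff_boff)
qed (use that in blast)

lemma inblk_row: "a < nb k \<Longrightarrow> inblk nb l (roff nb k + a) \<longleftrightarrow> l = k"
  using boff_unique[of a nb k l] by (auto simp: inblk_def roff_boff)

lemma in_col:
  "i < nb k - 1 \<Longrightarrow> K + coff nb l \<le> col k i \<and> col k i < K + coff nb l + (nb l - 1) \<longleftrightarrow> l = k"
  using boff_unique[of i "\<lambda>j. nb j - 1" k l] by (auto simp: coff_boff)

lemma Q_low:
  assumes "k < K" "a < nb k" "l < K"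
  shows "Q (roff nb k + a) l = (if l = k then 1 / sqrt (real (nb k)) else 0)"
proof -
  have "l < n" using assms K_le_n by simp
  then have "Q (roff nb k + a) l = (\<Sum>k'<K. if k' = k then
       (if l = k then 1 / sqrt (real (nb k)) else 0) else 0)"
    unfolding Qmat_def using assms by (auto simp: row_less inblk_row intro!: sum.cong)
  then show ?thesis using assms by simp
qed

lemma Q_high:
  assumes "k < K" "a < nb k" "l < K" "i < nb l - 1"
  shows "Q (roff nb k + a) (col l i) = (if l = k then U k a i else 0)"
proof -
  have "Q (roff nb k + a) (col l i) = (\<Sum>k'<K. if k' = k then
       (if K + coff nb k \<le> col l i \<and> col l i < K + coff nb k + (nb k - 1)
                then U k a (col l i - K - coff nb k) else 0) else 0)"
    unfolding Qmat_def using assms by (auto simp: row_less col_less inblk_row intro!: sum.cong)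
  also have "\<dots> = (if l = k then U k a i else 0)"
    using assms in_col[of i l k] by (simp add: eq_commute[of k l])
  finally show ?thesis .
qed

text \<open>Each column of Q is supported on the rows of a single block, so every inner product
  collapses to that block, where it pairs constant vectors and columns of U.\<close>

lemma Q_orth:
  assumes "c < n" "d < n"
  shows "(\<Sum>r<n. Q r c * Q r d) = mid n c d"
proof -
  have Uo: "(\<Sum>a<nb k. U k a i * U k a j) = (if i = j then 1 else 0)"
    "(\<Sum>a<nb k. U k a i) = 0" if "k < K" "i < nb k - 1" "j < nb k - 1" for k i j
    using U[OF that(1)] that by (auto simp: is_vperp_def)
  have sq: "1 / sqrt (real (nb k)) * (1 / sqrt (real (nb k))) = 1 / real (nb k)" for k by simp
  note [simp] = Q_low Q_high
  show ?thesis
  proof (cases rule: col_cases[OF assms(1)])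
    case c: 1
    have e: "(\<Sum>r<n. Q r c * Q r d) = (\<Sum>a<nb c. 1 / sqrt (real (nb c)) * Q (roff nb c + a) d)"
    proof -
      have "(\<Sum>r<n. Q r c * Q r d) = (\<Sum>k<K. if k = c then (\<Sum>a<nb k. 1 / sqrt (real (nb k)) * Q (roff nb k + a) d) else 0)"
        unfolding sum_rows using c by (intro sum.cong refl) auto
      then show ?thesis using c by simp
    qed
    show ?thesis
    proof (cases rule: col_cases[OF assms(2)])
      case d: 1
      show ?thesis
      proof (cases "c = d")
        case True
        have "(\<Sum>r<n. Q r c * Q r d) = (\<Sum>a<nb c. 1 / real (nb c))"
          unfolding e using c d True by (intro sum.cong refl) (simp add: sq)
        then show ?thesis using True nb[OF c] assms by (simp add: mid_def)
      next
        case False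
        then show ?thesis unfolding e using c d assms by (simp add: mid_def)
      qed
    next
      case d: (2 k i)
      have "(\<Sum>r<n. Q r c * Q r d) = (if k = c then (\<Sum>a<nb c. 1 / sqrt (real (nb c)) * U c a i) else 0)"
        unfolding e using c d by simp
      also have "\<dots> = 0" using Uo(2)[of c i i] d c by (auto simp flip: sum_divide_distrib)
      finally show ?thesis using c d by (simp add: mid_def)
    qed
  next
    case c: (2 l j)
    have e: "(\<Sum>r<n. Q r c * Q r d) = (\<Sum>a<nb l. U l a j * Q (roff nb l + a) d)"
    proof -
      have "(\<Sum>r<n. Q r c * Q r d) = (\<Sum>k<K. if k = l then (\<Sum>a<nb k. U k a j * Q (roff nb k + a) d) else 0)"
        unfolding sum_rows using c by (intro sum.cong refl) auto
      then show ?thesis using c by simp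
    qed
    show ?thesis
    proof (cases rule: col_cases[OF assms(2)])
      case d: 1
      have "(\<Sum>r<n. Q r c * Q r d) = 0" unfolding e using c d Uo(2)[of l j j]
        by (simp flip: sum_distrib_right sum_divide_distrib)
      then show ?thesis using c d by (simp add: mid_def)
    next
      case d: (2 k i)
      have "(\<Sum>r<n. Q r c * Q r d) = (if k = l then (\<Sum>a<nb l. U l a j * U l a i) else 0)"
        unfolding e using c d by simp
      also have "\<dots> = (if k = l \<and> i = j then 1 else 0)" using Uo(1)[of l j i] c d by auto
      finally show ?thesis
        using c d assms in_col[of i k l] in_col[of j l k] by (auto simp: mid_def)
    qed
  qed
qed

abbreviation Qt :: rmat where "Qt \<equiv> (\<lambda>i j. Q j i)"

lemma Qt_Q: "is_inv n Qt Q"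
  using Q_orth by (simp add: is_inv_def mmult_def)

lemma Q_Qt: "is_inv n Q Qt"
  by (rule is_inv_commute[OF Qt_Q])

text \<open>The matrix \<open>D = blockdiag(A, \<lambda>\<^sub>1 I, \<dots>, \<lambda>\<^sub>K I)\<close> is \<open>DD A (spread \<lambda>)\<close>.\<close>

definition DD :: "rmat \<Rightarrow> (nat \<Rightarrow> real) \<Rightarrow> rmat" where
  "DD P e = (\<lambda>i j. if i < K \<and> j < K then P i j else if i = j \<and> K \<le> i then e i else 0)"

definition spread :: "(nat \<Rightarrow> real) \<Rightarrow> nat \<Rightarrow> real" where
  "spread l c = (\<Sum>k<K. if K + coff nb k \<le> c \<and> c < K + coff nb k + (nb k - 1) then l k else 0)"

lemma spread_col: "k < K \<Longrightarrow> i < nb k - 1 \<Longrightarrow> spread l (col k i) = l k"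
  using in_col[of i k] by (simp add: spread_def)

lemma sum_K_n: "(\<And>c. K \<le> c \<Longrightarrow> c < n \<Longrightarrow> f c = 0) \<Longrightarrow> sum f {..<n} = sum f {..<K}"
  for f :: "nat \<Rightarrow> real"
  using K_le_n by (intro sum.mono_neutral_right) auto

lemma DD_sum:
  assumes "i < n"
  shows "(\<Sum>l<n. DD P e i l * f l) = (if i < K then (\<Sum>l<K. P i l * f l) else e i * f i)"
proof (cases "i < K")
  case True
  then show ?thesis by (simp add: DD_def sum_K_n)
next
  case False
  then have "(\<Sum>l<n. DD P e i l * f l) = (\<Sum>l<n. if l = i then e i * f i else 0)"
    by (intro sum.cong refl) (auto simp: DD_def)
  then show ?thesis using False assms by simp
qed

lemma DD_mult:
  assumes "i < n" "j < n"
  shows "mmult n (DD P e) (DD P' e') i j = DD (mmult K P P') (\<lambda>c. e c * e' c) i j"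
proof -
  have "mmult n (DD P e) (DD P' e') i j
      = (if i < K then (\<Sum>l<K. P i l * DD P' e' l j) else e i * DD P' e' i j)"
    unfolding mmult_def by (rule DD_sum[OF assms(1)])
  then show ?thesis by (auto simp: DD_def mmult_def)
qed

lemma DD_sym: "msym K P \<Longrightarrow> msym n (DD P e)"
  by (auto simp: msym_def DD_def)

lemma DD_inv:
  assumes "is_inv K P N" "\<And>c. K \<le> c \<Longrightarrow> c < n \<Longrightarrow> e c * e' c = 1"
  shows "is_inv n (DD P e) (DD N e')"
  unfolding is_inv_def
proof (intro allI impI)
  fix i j assume ij: "i < n" "j < n"
  show "mmult n (DD P e) (DD N e') i j = mid n i j"
    unfolding DD_mult[OF ij] using assms ij by (auto simp: DD_def mid_def is_inv_def)
qed

definition Dmat :: "rmat \<Rightarrow> rmat" where "Dmat B = DD B (spread (lam nb B))"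

lemma Cmat_row:
  assumes "k < K" "a < nb k" "l < K" "b < nb l"
  shows "Cmat K nb B (roff nb k + a) (roff nb l + b)
     = (if k = l \<and> a = b then 1 else rho nb B k l)"
proof -
  have eq: "roff nb k + a = roff nb l + b \<longleftrightarrow> k = l \<and> a = b"
    using assms inblk_row[of a k l] inblk_row[of b l k] by (auto simp: inblk_def)
  have "(\<Sum>k'<K. \<Sum>l'<K. if k' = k \<and> l' = l then rho nb B k' l' else 0)
     = (\<Sum>k'<K. if k' = k then (\<Sum>l'<K. if l' = l then rho nb B k' l' else 0) else 0)"
    by (intro sum.cong refl) auto
  also have "\<dots> = rho nb B k l" using assms by simp
  finally show ?thesis unfolding Cmat_def eq using assms by (simp add: row_less inblk_row)
qed

text \<open>The orthogonality relation Q Q' = I, read inside one diagonal block: v v' + U U' = I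
  with v v' constantly 1/n_k.\<close>

lemma U_outer:
  assumes "k < K" "a < nb k" "b < nb k"
  shows "(\<Sum>i<nb k - 1. U k a i * U k b i) = (if a = b then 1 else 0) - 1 / real (nb k)"
proof -
  have sq: "1 / sqrt (real (nb k)) * (1 / sqrt (real (nb k))) = 1 / real (nb k)" by simp
  have "mid n (roff nb k + a) (roff nb k + b) = (\<Sum>c<n. Q (roff nb k + a) c * Q (roff nb k + b) c)"
    using Q_Qt assms row_less by (simp add: is_inv_def mmult_def)
  also have "\<dots> = (\<Sum>l<K. if l = k then 1 / sqrt (real (nb k)) * (1 / sqrt (real (nb k))) else 0)
      + (\<Sum>l<K. if l = k then (\<Sum>i<nb k - 1. U k a i * U k b i) else 0)"
    unfolding sum_cols using assms
    by (intro arg_cong2[where f = plus] sum.cong refl) (auto simp: Q_low Q_high)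
  finally show ?thesis using assms row_less[of k a] unfolding sq by (auto simp: mid_def)
qed

text \<open>Inside block k the right-hand side has entries A_kk/n_k + \<lambda>_k ([a = b] - 1/n_k).
  The formula for \<lambda>_k is the one that makes this 1 on the diagonal, and off the diagonal it
  then equals (A_kk - 1)/(n_k - 1). Between different blocks only the constant columns of Q
  contribute.\<close>

lemma Cmat_canonical:
  assumes "r < n" "s < n"
  shows "Cmat K nb B r s = mmult n (mmult n Q (Dmat B)) Qt r s"
proof -
  obtain k a where r: "k < K" "a < nb k" "r = roff nb k + a" using row_cases[OF assms(1)] .
  obtain l b where s: "l < K" "b < nb l" "s = roff nb l + b" using row_cases[OF assms(2)] .
  let ?w = "1 / sqrt (real (nb k))"
  have inner: "(\<Sum>d<K. B c d * Q s d) = B c l * (1 / sqrt (real (nb l)))" for c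
  proof -
    have "(\<Sum>d<K. B c d * Q s d) = (\<Sum>d<K. if d = l then B c d * (1 / sqrt (real (nb l))) else 0)"
      using s by (intro sum.cong refl) (simp add: Q_low)
    then show ?thesis using s by simp
  qed
  have "mmult n (mmult n Q (Dmat B)) Qt r s = (\<Sum>c<n. Q r c * (\<Sum>d<n. Dmat B c d * Q s d))"
    unfolding mmult_assoc by (simp add: mmult_def)
  also have "\<dots> = (\<Sum>c<n. Q r c * (if c < K then (\<Sum>d<K. B c d * Q s d) else spread (lam nb B) c * Q s c))"
    unfolding Dmat_def by (intro sum.cong refl) (simp add: DD_sum)
  also have "\<dots> = (\<Sum>c<K. if c = k then ?w * (B c l * (1 / sqrt (real (nb l)))) else 0)
     + (\<Sum>k'<K. if k' = k then (if k' = l then lam nb B k * (\<Sum>i<nb k - 1. U k a i * U k b i) else 0) else 0)"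
    unfolding sum_cols using r s inner
    by (intro arg_cong2[where f = plus] sum.cong refl)
       (auto simp: Q_low Q_high spread_col sum_distrib_left mult_ac intro!: sum.cong)
  also have "\<dots> = ?w * (B k l * (1 / sqrt (real (nb l))))
      + (if k = l then lam nb B k * ((if a = b then 1 else 0) - 1 / real (nb k)) else 0)"
    using r s U_outer[of k a b] by (cases "k = l") simp_all
  also have "\<dots> = (if k = l \<and> a = b then 1 else rho nb B k l)"
  proof (cases "k = l")
    case True
    have n1: "real (nb k) > 1" using nb[OF r(1)] by simp
    have w: "?w * (B k k * ?w) = B k k / real (nb k)" by (simp add: field_simps)
    show ?thesis using True n1 unfolding True[symmetric] w
      by (auto simp: lam_def rho_def divide_simps) (auto simp: algebra_simps)
  next
    case False
    then show ?thesis by (simp add: rho_def real_sqrt_mult)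
  qed
  finally show ?thesis using r s Cmat_row[of k a l b B] by simp
qed


section \<open>The root of C and the factor L\<close>

definition admissible :: "rmat \<Rightarrow> bool" where
  "admissible B \<longleftrightarrow> msym K B \<and> mpd K B \<and> (\<forall>k<K. lam nb B k > 0)"

definition Dhalf :: "rmat \<Rightarrow> rmat" where
  "Dhalf B = DD (msqrt K B) (\<lambda>c. sqrt (spread (lam nb B) c))"

definition Dhalf_inv :: "rmat \<Rightarrow> rmat" where
  "Dhalf_inv B = DD (minv K (msqrt K B)) (\<lambda>c. 1 / sqrt (spread (lam nb B) c))"

lemma spread_pos:
  assumes "\<And>k. k < K \<Longrightarrow> l k > 0" "K \<le> c" "c < n" shows "spread l c > 0"
  using assms by (cases rule: col_cases[OF assms(3)]) (auto simp: spread_col)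

lemma conj_Q_mult:
  assumes "r < n" "s < n"
  shows "mmult n (mmult n (mmult n Q M) Qt) (mmult n (mmult n Q N) Qt) r s
    = mmult n (mmult n Q (mmult n M N)) Qt r s"
proof -
  have "mmult n (mmult n (mmult n Q M) Qt) (mmult n (mmult n Q N) Qt) r s
     = mmult n (mmult n Q M) (mmult n (mmult n Qt Q) (mmult n N Qt)) r s"
    by (simp add: mmult_assoc)
  also have "\<dots> = mmult n (mmult n Q M) (mmult n N Qt) r s"
    by (intro mmult_cong[OF refl] mmult_inv_cancel[OF Qt_Q])
  finally show ?thesis by (simp add: mmult_assoc)
qed

lemma conj_Q_sym:
  assumes "msym n M" shows "msym n (mmult n (mmult n Q M) Qt)"
  unfolding msym_def
proof (intro allI impI)
  fix r s assume "r < n" "s < n"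
  have "mmult n (mmult n Q M) Qt r s = (\<Sum>c<n. \<Sum>d<n. Q r c * M c d * Q s d)"
    unfolding mmult_assoc by (simp add: mmult_def sum_distrib_left mult.assoc)
  also have "\<dots> = (\<Sum>d<n. \<Sum>c<n. Q r c * M c d * Q s d)" by (rule sum.swap)
  also have "\<dots> = (\<Sum>d<n. \<Sum>c<n. Q s d * M d c * Q r c)"
    using assms by (intro sum.cong refl) (auto simp: msym_def)
  also have "\<dots> = mmult n (mmult n Q M) Qt s r"
    unfolding mmult_assoc by (simp add: mmult_def sum_distrib_left mult.assoc)
  finally show "mmult n (mmult n Q M) Qt r s = mmult n (mmult n Q M) Qt s r" .
qed

lemma mdet_Qt: "mdet n Qt = mdet n Q"
  by (rule mdet_transpose)

lemma mdet_Q: "(mdet n Q)\<^sup>2 = 1"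
proof -
  have "mdet n (mmult n Qt Q) = 1"
    using Qt_Q mdet_cong[of n "mmult n Qt Q" "mid n"] by (simp add: is_inv_def mdet_mid)
  then show ?thesis by (simp add: mdet_mmult mdet_Qt power2_eq_square)
qed

lemma mdet_Q_nonzero: "mdet n Q \<noteq> 0"
  by (rule is_inv_mdet_nonzero[OF Q_Qt])

lemma mpd_conj_Q:
  assumes "msym n T" "mdet n T \<noteq> 0" "\<And>i j. i < n \<Longrightarrow> j < n \<Longrightarrow> M i j = mmult n T T i j"
  shows "mpd n (mmult n (mmult n Q M) Qt)"
proof (rule mpd_square)
  show "msym n (mmult n (mmult n Q T) Qt)" by (rule conj_Q_sym[OF assms(1)])
  show "mdet n (mmult n (mmult n Q T) Qt) \<noteq> 0"
    using mdet_Q_nonzero assms(2) by (simp add: mdet_mmult mdet_Qt)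
  fix r s assume rs: "r < n" "s < n"
  show "mmult n (mmult n Q M) Qt r s
      = mmult n (mmult n (mmult n Q T) Qt) (mmult n (mmult n Q T) Qt) r s"
    unfolding conj_Q_mult[OF rs] using assms(3) by (intro mmult_cong refl) auto
qed

context
  fixes B :: rmat
  assumes B: "admissible B"
begin

lemma admissible_sym: "msym K B" and admissible_mpd: "mpd K B"
  and admissible_lam: "k < K \<Longrightarrow> lam nb B k > 0"
  using B by (auto simp: admissible_def)

lemma spread_lam_pos: "K \<le> c \<Longrightarrow> c < n \<Longrightarrow> spread (lam nb B) c > 0"
  by (rule spread_pos) (use admissible_lam in auto)

lemma Dhalf_square: "i < n \<Longrightarrow> j < n \<Longrightarrow> mmult n (Dhalf B) (Dhalf B) i j = Dmat B i j"
  unfolding Dhalf_def DD_mult Dmat_def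
  using msqrt_square[OF admissible_sym admissible_mpd] spread_lam_pos[of i]
  by (auto simp: DD_def)

lemma Dhalf_inv: "is_inv n (Dhalf B) (Dhalf_inv B)"
  unfolding Dhalf_def Dhalf_inv_def
proof (intro DD_inv is_inv_msqrt admissible_sym admissible_mpd)
  fix c assume "K \<le> c" "c < n"
  then show "sqrt (spread (lam nb B) c) * (1 / sqrt (spread (lam nb B) c)) = 1"
    using spread_lam_pos[of c] by simp
qed

lemma msqrt_Cmat:
  assumes "r < n" "s < n"
  shows "msqrt n (Cmat K nb B) r s = mmult n (mmult n Q (Dhalf B)) Qt r s"
proof (rule msqrt_eqI[OF _ _ _ assms])
  note R = msqrt_props[OF admissible_sym admissible_mpd]
  note T = msqrt_props[OF R(1,2)]
  show "msym n (mmult n (mmult n Q (Dhalf B)) Qt)"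
    unfolding Dhalf_def by (intro conj_Q_sym DD_sym R)
  \<comment> \<open>Positive definiteness of D^(1/2) is obtained by exhibiting it as the square of
    an invertible symmetric matrix, hence the fourth root of D here.\<close>
  let ?e = "\<lambda>c. sqrt (sqrt (spread (lam nb B) c))"
  let ?T = "DD (msqrt K (msqrt K B)) ?e"
  show "mpd n (mmult n (mmult n Q (Dhalf B)) Qt)"
  proof (rule mpd_conj_Q)
    show "msym n ?T" by (intro DD_sym T)
    have "is_inv n ?T (DD (minv K (msqrt K (msqrt K B))) (\<lambda>c. 1 / ?e c))"
    proof (intro DD_inv is_inv_msqrt R)
      fix c assume "K \<le> c" "c < n"
      then show "?e c * (1 / ?e c) = 1" using spread_lam_pos[of c] by simp
    qed
    then show "mdet n ?T \<noteq> 0" by (rule is_inv_mdet_nonzero)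
    fix i j assume ij: "i < n" "j < n"
    show "Dhalf B i j = mmult n ?T ?T i j"
      unfolding DD_mult[OF ij] Dhalf_def using T(3) spread_lam_pos[of i] ij
      by (auto simp: DD_def)
  qed
  fix r s assume rs: "r < n" "s < n"
  have "mmult n (mmult n (mmult n Q (Dhalf B)) Qt) (mmult n (mmult n Q (Dhalf B)) Qt) r s
     = mmult n (mmult n Q (mmult n (Dhalf B) (Dhalf B))) Qt r s"
    by (rule conj_Q_mult[OF rs])
  also have "\<dots> = mmult n (mmult n Q (Dmat B)) Qt r s"
    unfolding mmult_assoc[of n Q] using Dhalf_square by (simp add: mmult_def)
  also have "\<dots> = Cmat K nb B r s" by (rule Cmat_canonical[OF rs, symmetric])
  finally show "mmult n (mmult n (mmult n Q (Dhalf B)) Qt) (mmult n (mmult n Q (Dhalf B)) Qt) r s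
     = Cmat K nb B r s" .
qed

text \<open>C^(1/2) = Q D^(1/2) Q', and the trailing Q' cancels against the factor Q of L.
  Consequently L^(-1) z consists exactly of the vectors X_0, X_1, ..., X_K.\<close>

lemma Lmat_eq:
  assumes "r < n" "s < n" shows "Lmat K nb U B r s = mmult n Q (Dhalf B) r s"
proof -
  have "Lmat K nb U B r s = mmult n (mmult n (mmult n Q (Dhalf B)) Qt) Q r s"
    unfolding Lmat_def using assms by (intro mmult_cong refl) (simp add: msqrt_Cmat)
  also have "\<dots> = mmult n (mmult n Q (Dhalf B)) (mmult n Qt Q) r s" by (simp only: mmult_assoc)
  also have "\<dots> = mmult n (mmult n Q (Dhalf B)) (mid n) r s"
    using Qt_Q assms by (intro mmult_cong refl) (simp add: is_inv_def)
  finally show ?thesis using assms by (simp add: mmult_mid_right)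
qed

text \<open>Squares are compared because Q is only known to have determinant 1 or -1; the density
  uses the absolute value.\<close>

lemma mdet_Lmat: "(mdet n (Lmat K nb U B))\<^sup>2 = mdet n (Dmat B)"
proof -
  have "mdet n (Lmat K nb U B) = mdet n Q * mdet n (Dhalf B)"
    unfolding mdet_mmult[symmetric] using Lmat_eq by (rule mdet_cong)
  moreover have "mdet n (Dmat B) = mdet n (Dhalf B) * mdet n (Dhalf B)"
    unfolding mdet_mmult[symmetric] using Dhalf_square by (intro mdet_cong) simp
  ultimately show ?thesis using mdet_Q by (simp add: power_mult_distrib) (simp add: power2_eq_square)
qed

lemma mdet_Dmat_pos: "mdet n (Dmat B) > 0"
proof -
  have "mdet n (Dhalf B) \<noteq> 0" by (rule is_inv_mdet_nonzero[OF Dhalf_inv])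
  moreover have "mdet n (Dmat B) = mdet n (Dhalf B) * mdet n (Dhalf B)"
    unfolding mdet_mmult[symmetric] using Dhalf_square by (intro mdet_cong) simp
  ultimately show ?thesis by (metis not_real_square_gt_zero)
qed

lemma minv_Lmat:
  assumes "r < n" "s < n" shows "minv n (Lmat K nb U B) r s = mmult n (Dhalf_inv B) Qt r s"
proof (rule minv_eqI[OF _ assms])
  show "is_inv n (Lmat K nb U B) (mmult n (Dhalf_inv B) Qt)"
    unfolding is_inv_def
  proof (intro allI impI)
    fix i j assume ij: "i < n" "j < n"
    have "mmult n (Lmat K nb U B) (mmult n (Dhalf_inv B) Qt) i j
        = mmult n (mmult n Q (Dhalf B)) (mmult n (Dhalf_inv B) Qt) i j"
      using ij by (intro mmult_cong refl) (simp add: Lmat_eq)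
    also have "\<dots> = mmult n Q (mmult n (mmult n (Dhalf B) (Dhalf_inv B)) Qt) i j"
      by (simp only: mmult_assoc)
    also have "\<dots> = mmult n Q Qt i j"
      by (intro mmult_cong[OF refl] mmult_inv_cancel[OF Dhalf_inv])
    also have "\<dots> = mid n i j" using Q_Qt ij by (simp add: is_inv_def)
    finally show "mmult n (Lmat K nb U B) (mmult n (Dhalf_inv B) Qt) i j = mid n i j" .
  qed
qed

lemma mapply_minv_Lmat:
  assumes "c < n"
  shows "mapply n (minv n (Lmat K nb U B)) z c = mapply n (Dhalf_inv B) (Yv K nb U z) c"
proof -
  have "mapply n (minv n (Lmat K nb U B)) z c = mapply n (mmult n (Dhalf_inv B) Qt) z c"
    using assms by (simp add: mapply_def[of n _ z] minv_Lmat)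
  also have "mapply n Qt z = Yv K nb U z" by (simp add: mapply_def Yv_def)
  then have "mapply n (mmult n (Dhalf_inv B) Qt) z c = mapply n (Dhalf_inv B) (Yv K nb U z) c"
    by (simp add: mapply_mmult)
  finally show ?thesis .
qed

lemma mapply_minv_Lmat_low: "i < K \<Longrightarrow> mapply n (minv n (Lmat K nb U B)) z i = X0 K nb U B z i"
  using K_le_n by (subst mapply_minv_Lmat) (auto simp: mapply_def Dhalf_inv_def DD_sum X0_def)

lemma lam_powr: "k < K \<Longrightarrow> lam nb B k powr - (1/2) = 1 / sqrt (lam nb B k)"
  using admissible_lam[of k] powr_minus_divide[of "lam nb B k" "1/2"] by (simp add: powr_half_sqrt)

lemma mapply_minv_Lmat_high:
  assumes "k < K" "i < nb k - 1"
  shows "mapply n (minv n (Lmat K nb U B)) z (col k i) = Xk K nb U B z k i"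
  using assms by (subst mapply_minv_Lmat)
    (auto simp: mapply_def Dhalf_inv_def DD_sum Xk_def col_less spread_col lam_powr)

lemma Yv_Lmat:
  assumes "c < n"
  shows "Yv K nb U (mapply n (Lmat K nb U B) v) c = mapply n (Dhalf B) v c"
proof -
  have "Yv K nb U (mapply n (Lmat K nb U B) v) c = mapply n Qt (mapply n (mmult n Q (Dhalf B)) v) c"
  proof -
    have "mapply n (Lmat K nb U B) v r = mapply n (mmult n Q (Dhalf B)) v r" if "r < n" for r
      unfolding mapply_def using that by (intro sum.cong refl) (simp add: Lmat_eq)
    then show ?thesis unfolding Yv_def mapply_def[of n Qt] by (intro sum.cong refl) simp
  qed
  also have "\<dots> = mapply n (mmult n Qt Q) (mapply n (Dhalf B) v) c"
    by (simp only: mapply_mmult)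
  also have "\<dots> = mapply n (Dhalf B) v c"
    by (rule mapply_inv_cancel[OF Qt_Q assms])
  finally show ?thesis .
qed

lemma X0_Lmat:
  assumes "i < K" shows "X0 K nb U B (mapply n (Lmat K nb U B) v) i = v i"
proof -
  let ?R = "msqrt K B"
  have "X0 K nb U B (mapply n (Lmat K nb U B) v) i = mapply K (minv K ?R) (mapply K ?R v) i"
    unfolding X0_def mapply_def[of K "minv K ?R"] using K_le_n
    by (intro sum.cong refl arg_cong2[where f = times]) (subst Yv_Lmat, auto simp: mapply_def Dhalf_def DD_sum)
  also have "\<dots> = mapply K (mmult K (minv K ?R) ?R) v i" by (simp add: mapply_mmult)
  also have "\<dots> = v i"
    by (rule mapply_inv_cancel[OF is_inv_commute[OF is_inv_msqrt[OF admissible_sym admissible_mpd]] assms])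
  finally show ?thesis .
qed

lemma Xk_Lmat:
  assumes "k < K" "i < nb k - 1"
  shows "Xk K nb U B (mapply n (Lmat K nb U B) v) k i = v (col k i)"
proof -
  have "Yv K nb U (mapply n (Lmat K nb U B) v) (col k i) = mapply n (Dhalf B) v (col k i)"
    by (rule Yv_Lmat[OF col_less[OF assms]])
  also have "\<dots> = sqrt (lam nb B k) * v (col k i)"
    using assms col_less[OF assms] by (simp add: mapply_def Dhalf_def DD_sum spread_col)
  finally have "Yv K nb U (mapply n (Lmat K nb U B) v) (col k i) = sqrt (lam nb B k) * v (col k i)" .
  then show ?thesis using assms admissible_lam[of k] by (simp add: Xk_def lam_powr)
qed

end

end

section \<open>Continuity and derivatives of determinants and inverses\<close>

lemma tendsto_mdet:
  assumes "\<And>i j. i < m \<Longrightarrow> j < m \<Longrightarrow> ((\<lambda>x. M x i j) \<longlongrightarrow> N i j) F"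
  shows "((\<lambda>x. mdet m (M x)) \<longlongrightarrow> mdet m N) F"
  unfolding mdet_def
proof (intro tendsto_sum tendsto_mult tendsto_const tendsto_prod)
  fix p i assume "p \<in> {p. p permutes {..<m}}" "i \<in> {..<m}"
  then have "i < m" "p i < m" using permutes_in_image[of p "{..<m}" i] by auto
  then show "((\<lambda>x. M x i (p i)) \<longlongrightarrow> N i (p i)) F" by (rule assms)
qed

text \<open>The cofactor formula is continuous wherever the determinant does not vanish, and it
  computes \<open>minv\<close> eventually because the determinants converge to a nonzero
  value.\<close>

lemma tendsto_minv:
  assumes M: "\<And>i j. i < m \<Longrightarrow> j < m \<Longrightarrow> ((\<lambda>x. M x i j) \<longlongrightarrow> N i j) F"
    and N: "mdet m N \<noteq> 0" and ij: "i < m" "j < m"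
  shows "((\<lambda>x. minv m (M x) i j) \<longlongrightarrow> minv m N i j) F"
proof -
  have det: "((\<lambda>x. mdet m (M x)) \<longlongrightarrow> mdet m N) F" by (rule tendsto_mdet[OF M])
  have adj: "((\<lambda>x. madj m (M x) i j) \<longlongrightarrow> madj m N i j) F"
    unfolding madj_def
    by (intro tendsto_mult tendsto_const tendsto_mdet M) auto
  have "((\<lambda>x. madj m (M x) i j / mdet m (M x)) \<longlongrightarrow> madj m N i j / mdet m N) F"
    by (intro tendsto_divide adj det N)
  moreover have "eventually (\<lambda>x. madj m (M x) i j / mdet m (M x) = minv m (M x) i j) F"
    using tendsto_imp_eventually_ne[OF det N] by eventually_elim (simp add: minv_madj ij)
  ultimately have "((\<lambda>x. minv m (M x) i j) \<longlongrightarrow> madj m N i j / mdet m N) F"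
    by (rule Lim_transform_eventually)
  then show ?thesis by (simp add: minv_madj N ij)
qed

lemma DERIV_mdet_at_mid:
  assumes D: "\<And>i j. i < m \<Longrightarrow> j < m \<Longrightarrow> ((\<lambda>s. M s i j) has_real_derivative M' i j) (at t)"
    and mid: "\<And>i j. i < m \<Longrightarrow> j < m \<Longrightarrow> M t i j = mid m i j"
  shows "((\<lambda>s. mdet m (M s)) has_real_derivative (\<Sum>i<m. M' i i)) (at t)"
proof -
  let ?P = "{p. p permutes {..<m}}"
  have "((\<lambda>s. mdet m (M s)) has_real_derivative
     (\<Sum>p\<in>?P. of_int (sign p) * (\<Sum>i<m. M' i (p i) * (\<Prod>j\<in>{..<m}-{i}. M t j (p j))))) (at t)"
    unfolding mdet_def
  proof (intro DERIV_sum DERIV_cmult has_field_derivative_prod)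
    fix p i assume "p \<in> ?P" "i \<in> {..<m}"
    then have "i < m" "p i < m" using permutes_in_image[of p "{..<m}" i] by auto
    then show "((\<lambda>s. M s i (p i)) has_real_derivative M' i (p i)) (at t)" by (rule D)
  qed
  also have "(\<Sum>p\<in>?P. of_int (sign p) * (\<Sum>i<m. M' i (p i) * (\<Prod>j\<in>{..<m}-{i}. M t j (p j))))
     = (\<Sum>p\<in>?P. if p = id then (\<Sum>i<m. M' i i) else 0)"
  proof (intro sum.cong refl)
    fix p assume "p \<in> ?P"
    then have p: "p permutes {..<m}" by simp
    show "of_int (sign p) * (\<Sum>i<m. M' i (p i) * (\<Prod>j\<in>{..<m}-{i}. M t j (p j)))
      = (if p = id then (\<Sum>i<m. M' i i) else 0)"
    proof (cases "p = id")
      case True then show ?thesis by (simp add: mid mid_def)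
    next
      case False
      then obtain a where a: "p a \<noteq> a" by (auto simp: fun_eq_iff)
      \<comment> \<open>a permutation other than the identity moves at least two points\<close>
      have pa: "p (p a) \<noteq> p a" using a permutes_inj[OF p] by (auto dest: injD)
      have am: "a < m" "p a < m"
        using a pa permutes_not_in[OF p, of a] permutes_not_in[OF p, of "p a"] by blast+
      have z: "(\<Prod>j\<in>{..<m}-{i}. M t j (p j)) = 0" for i
      proof (cases "i = a")
        case True
        then show ?thesis using a pa am permutes_in_image[OF p, of "p a"]
          by (intro prod_zero) (auto intro!: bexI[of _ "p a"] simp: mid mid_def)
      next
        case False
        then show ?thesis using a am
          by (intro prod_zero) (auto intro!: bexI[of _ a] simp: mid mid_def)
      qed
      show ?thesis using False by (simp only: z mult_zero_right sum.neutral_const if_False)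
    qed
  qed
  also have "\<dots> = (\<Sum>i<m. M' i i)"
    by (subst sum.delta) (auto simp: finite_permutations permutes_id)
  finally show ?thesis .
qed

text \<open>Jacobi's formula. Multiplying the family by the constant matrix M(t)^(-1) moves the base
  point to the identity, where the derivative of the determinant is the trace.\<close>

lemma DERIV_mdet:
  assumes D: "\<And>i j. i < m \<Longrightarrow> j < m \<Longrightarrow> ((\<lambda>s. M s i j) has_real_derivative M' i j) (at t)"
    and det: "mdet m (M t) \<noteq> 0"
  shows "((\<lambda>s. mdet m (M s)) has_real_derivative
     mdet m (M t) * (\<Sum>i<m. \<Sum>j<m. minv m (M t) i j * M' j i)) (at t)"
proof -
  let ?N = "minv m (M t)"
  have inv: "is_inv m ?N (M t)" by (rule is_inv_commute[OF is_inv_minv[OF det]])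
  have "((\<lambda>s. mdet m (mmult m ?N (M s))) has_real_derivative (\<Sum>i<m. mmult m ?N M' i i)) (at t)"
  proof (rule DERIV_mdet_at_mid[where M = "\<lambda>s. mmult m ?N (M s)" and M' = "mmult m ?N M'"])
    fix i j assume ij: "i < m" "j < m"
    show "((\<lambda>s. mmult m ?N (M s) i j) has_real_derivative mmult m ?N M' i j) (at t)"
      unfolding mmult_def using ij by (intro DERIV_sum DERIV_cmult D) auto
    show "mmult m ?N (M t) i j = mid m i j" using inv ij by (simp add: is_inv_def)
  qed
  then have "((\<lambda>s. mdet m (M t) * (mdet m ?N * mdet m (M s))) has_real_derivative
     mdet m (M t) * (\<Sum>i<m. mmult m ?N M' i i)) (at t)"
    unfolding mdet_mmult by (rule DERIV_cmult)
  moreover have "mdet m (M t) * (mdet m ?N * mdet m (M s)) = mdet m (M s)" for s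
  proof -
    have "mdet m ?N * mdet m (M t) = 1"
      unfolding mdet_mmult[symmetric] using inv mdet_cong[of m "mmult m ?N (M t)" "mid m"]
      by (simp add: is_inv_def mdet_mid)
    then show ?thesis by (metis mult.assoc mult.commute mult_1)
  qed
  ultimately show ?thesis by (simp add: mmult_def)
qed

text \<open>The resolvent identity M^(-1) - N^(-1) = -M^(-1) (M - N) N^(-1).\<close>

lemma minv_diff:
  assumes M: "mdet m M \<noteq> 0" and N: "mdet m N \<noteq> 0" and ij: "i < m" "j < m"
  shows "minv m M i j - minv m N i j
    = - (\<Sum>k<m. \<Sum>l<m. minv m M i k * (M k l - N k l) * minv m N l j)"
proof -
  have M': "is_inv m (minv m M) M" by (rule is_inv_commute[OF is_inv_minv[OF M]])
  have N': "is_inv m N (minv m N)" by (rule is_inv_minv[OF N])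
  have "mmult m (mmult m (minv m M) M) (minv m N) i j = minv m N i j"
    by (rule mmult_inv_cancel[OF M' ij(1)])
  moreover have "mmult m (minv m M) (mmult m N (minv m N)) i j = minv m M i j"
    using N' ij by (subst mmult_cong[of m _ i "minv m M" _ j "mid m"])
      (auto simp: is_inv_def mmult_mid_right)
  ultimately have "minv m M i j - minv m N i j
     = mmult m (minv m M) (mmult m N (minv m N)) i j - mmult m (minv m M) (mmult m M (minv m N)) i j"
    by (simp add: mmult_assoc)
  also have "\<dots> = - (\<Sum>k<m. \<Sum>l<m. minv m M i k * (M k l - N k l) * minv m N l j)"
    by (simp add: mmult_def sum_distrib_left algebra_simps sum_subtractf)
  finally show ?thesis .
qed

text \<open>By the resolvent identity the difference quotient of the inverse is a product of the
  quotient of M with two inverses, so only continuity of the inverse is required.\<close>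

lemma DERIV_minv:
  assumes D: "\<And>i j. i < m \<Longrightarrow> j < m \<Longrightarrow> ((\<lambda>s. M s i j) has_real_derivative M' i j) (at t)"
    and det: "mdet m (M t) \<noteq> 0" and ij: "i < m" "j < m"
  shows "((\<lambda>s. minv m (M s) i j) has_real_derivative
     - (\<Sum>k<m. \<Sum>l<m. minv m (M t) i k * M' k l * minv m (M t) l j)) (at t)"
proof -
  have lim: "((\<lambda>s. M s i j) \<longlongrightarrow> M t i j) (at t)" if "i < m" "j < m" for i j
    using DERIV_isCont[OF D[OF that]] by (simp add: isCont_def)
  have ev: "eventually (\<lambda>s. mdet m (M s) \<noteq> 0) (at t)"
    by (rule tendsto_imp_eventually_ne[OF tendsto_mdet[OF lim] det])
  have q: "((\<lambda>s. (M s k l - M t k l) / (s - t)) \<longlongrightarrow> M' k l) (at t)" if "k < m" "l < m" for k l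
    using D[OF that] by (simp add: has_field_derivative_iff)
  have "((\<lambda>s. - (\<Sum>k<m. \<Sum>l<m. minv m (M s) i k * ((M s k l - M t k l) / (s - t)) * minv m (M t) l j))
     \<longlongrightarrow> - (\<Sum>k<m. \<Sum>l<m. minv m (M t) i k * M' k l * minv m (M t) l j)) (at t)"
    using ij by (intro tendsto_minus tendsto_sum tendsto_mult tendsto_const q tendsto_minv lim det) auto
  moreover have "eventually (\<lambda>s. - (\<Sum>k<m. \<Sum>l<m. minv m (M s) i k * ((M s k l - M t k l) / (s - t)) * minv m (M t) l j)
      = (minv m (M s) i j - minv m (M t) i j) / (s - t)) (at t)"
    using ev by eventually_elim (simp add: minv_diff[OF _ det ij] sum_divide_distrib)
  ultimately show ?thesis unfolding has_field_derivative_iff by (rule Lim_transform_eventually)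
qed

section \<open>Gradients along symmetric matrices\<close>

lemma fro_nonneg: "fro K M \<ge> 0"
  by (auto simp: fro_def intro!: sum_nonneg)

lemma fro_component:
  assumes "i < K" "j < K" shows "\<bar>M i j\<bar> \<le> fro K M"
proof -
  have "(M i j)\<^sup>2 \<le> (\<Sum>j<K. (M i j)\<^sup>2)"
    using assms by (intro member_le_sum[of j "{..<K}" "\<lambda>j. (M i j)\<^sup>2"]) auto
  also have "\<dots> \<le> (\<Sum>i<K. \<Sum>j<K. (M i j)\<^sup>2)"
    using assms by (intro member_le_sum[of i "{..<K}" "\<lambda>i. \<Sum>j<K. (M i j)\<^sup>2"] sum_nonneg) auto
  finally show ?thesis unfolding fro_def by (metis real_sqrt_abs real_sqrt_le_iff)
qed

lemma fro_scale: "fro K (\<lambda>i j. t * M i j) = \<bar>t\<bar> * fro K M"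
  by (simp add: fro_def power_mult_distrib real_sqrt_mult flip: sum_distrib_left)

text \<open>The filter hidden in \<open>has_sym_grad\<close>: Frobenius balls intersected with the
  symmetric matrices, centre included. It ignores all entries outside the K x K block, which a
  topology on the whole function type would not.\<close>

definition symnhds :: "nat \<Rightarrow> rmat \<Rightarrow> rmat filter" where
  "symnhds K A = (INF d\<in>{0<..}. principal {B. msym K B \<and> fro K (\<lambda>i j. B i j - A i j) < d})"

lemma eventually_symnhds:
  "eventually P (symnhds K A) \<longleftrightarrow>
     (\<exists>d>0. \<forall>B. msym K B \<and> fro K (\<lambda>i j. B i j - A i j) < d \<longrightarrow> P B)"
  unfolding symnhds_def
proof (subst eventually_INF_base)
  fix a b :: real assume "a \<in> {0<..}" "b \<in> {0<..}"
  then show "\<exists>x\<in>{0<..}. principal {B. msym K B \<and> fro K (\<lambda>i j. B i j - A i j) < x}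
     \<le> inf (principal {B. msym K B \<and> fro K (\<lambda>i j. B i j - A i j) < a})
        (principal {B. msym K B \<and> fro K (\<lambda>i j. B i j - A i j) < b})"
    by (intro bexI[of _ "min a b"]) auto
qed (auto simp: eventually_principal)

lemma tendsto_symnhds_entry:
  assumes "i < K" "j < K" shows "((\<lambda>B. B i j) \<longlongrightarrow> A i j) (symnhds K A)"
proof (rule tendstoI)
  fix e :: real assume "e > 0"
  then show "eventually (\<lambda>B. dist (B i j) (A i j) < e) (symnhds K A)"
    unfolding eventually_symnhds dist_real_def
    using fro_component[OF assms, of "\<lambda>i j. _ i j - A i j"] by (meson order.strict_trans1)
qed

text \<open>The segment from A to B stays symmetric and inside the ball, so the mean value theorem
  expresses f B - f A through g at an intermediate point, and continuity of g at A replaces that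
  point by A. \<open>P\<close> marks the region where the derivative formula is valid.\<close>

lemma has_sym_gradI:
  assumes A: "msym K A" and ev: "eventually P (symnhds K A)"
    and der: "\<And>B t. msym K B \<Longrightarrow> (\<And>s. 0 \<le> s \<Longrightarrow> s \<le> 1 \<Longrightarrow> P (\<lambda>i j. A i j + s * (B i j - A i j))) \<Longrightarrow>
        0 \<le> t \<Longrightarrow> t \<le> 1 \<Longrightarrow>
        ((\<lambda>t. f (\<lambda>i j. A i j + t * (B i j - A i j))) has_real_derivative
          (\<Sum>p<K*K. g (\<lambda>i j. A i j + t * (B i j - A i j)) p * (vecm K B p - vecm K A p))) (at t within {0..1})"
    and cont: "\<And>p. p < K * K \<Longrightarrow> ((\<lambda>B. g B p) \<longlongrightarrow> g A p) (symnhds K A)"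
  shows "has_sym_grad K f A (g A)"
  unfolding has_sym_grad_def
proof (intro allI impI)
  fix e :: real assume e: "e > 0"
  \<comment> \<open>There are K * K summands, each contributing at most e' times the distance; the
    added 1 keeps the denominator positive also for K = 0.\<close>
  define e' where "e' = e / (real (K * K) + 1)"
  have e': "e' > 0" "real (K * K) * e' \<le> e"
    using e by (simp_all add: e'_def divide_simps add_nonneg_pos del: of_nat_mult)
  have "eventually (\<lambda>B. \<forall>p\<in>{..<K*K}. \<bar>g B p - g A p\<bar> < e') (symnhds K A)"
    using tendstoD[OF cont e'(1)] by (intro eventually_ball_finite) (auto simp: dist_real_def)
  then have "eventually (\<lambda>B. P B \<and> (\<forall>p\<in>{..<K*K}. \<bar>g B p - g A p\<bar> < e')) (symnhds K A)"
    using ev by eventually_elim auto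
  then obtain d where d: "d > 0"
    "\<And>B. msym K B \<Longrightarrow> fro K (\<lambda>i j. B i j - A i j) < d \<Longrightarrow> P B \<and> (\<forall>p\<in>{..<K*K}. \<bar>g B p - g A p\<bar> < e')"
    unfolding eventually_symnhds by blast
  show "\<exists>d>0. \<forall>B. msym K B \<and> fro K (\<lambda>i j. B i j - A i j) < d \<longrightarrow>
        \<bar>f B - f A - (\<Sum>p<K*K. g A p * (vecm K B p - vecm K A p))\<bar> \<le> e * fro K (\<lambda>i j. B i j - A i j)"
  proof (intro exI[of _ d] conjI allI impI d(1))
    fix B assume B: "msym K B \<and> fro K (\<lambda>i j. B i j - A i j) < d"
    let ?r = "fro K (\<lambda>i j. B i j - A i j)"
    let ?A = "\<lambda>t i j. A i j + t * (B i j - A i j)"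
    let ?h = "\<lambda>p. vecm K B p - vecm K A p"
    have near: "P (?A t) \<and> (\<forall>p\<in>{..<K*K}. \<bar>g (?A t) p - g A p\<bar> < e')" if "0 \<le> t" "t \<le> 1" for t
    proof (rule d(2))
      show "msym K (?A t)" using A B by (simp add: msym_def)
      have "t * ?r \<le> 1 * ?r" using that by (intro mult_right_mono fro_nonneg)
      then show "fro K (\<lambda>i j. ?A t i j - A i j) < d"
        using B that fro_scale[of K t "\<lambda>i j. B i j - A i j"] by simp
    qed
    have "\<exists>t\<in>{0<..<1}. f (?A 1) - f (?A 0) = (\<lambda>x. (\<Sum>p<K*K. g (?A t) p * ?h p) * x) (1 - 0)"
    proof (rule mvt_simple)
      fix t :: real assume "0 \<le> t" "t \<le> 1"
      then show "((\<lambda>t. f (?A t)) has_derivative (\<lambda>x. (\<Sum>p<K*K. g (?A t) p * ?h p) * x)) (at t within {0..1})"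
        using near B der[of B t] by (simp add: has_field_derivative_def)
    qed simp
    then obtain t where t: "0 < t" "t < 1" "f B - f A = (\<Sum>p<K*K. g (?A t) p * ?h p)" by auto
    have h: "\<bar>?h p\<bar> \<le> ?r" if "p < K * K" for p
      using vec_index_bounds[OF that] that
        fro_component[of "p mod K" K "p div K" "\<lambda>i j. B i j - A i j"] by (simp add: vecm_def)
    have "\<bar>f B - f A - (\<Sum>p<K*K. g A p * ?h p)\<bar> = \<bar>\<Sum>p<K*K. (g (?A t) p - g A p) * ?h p\<bar>"
      by (simp add: t(3) sum_subtractf left_diff_distrib)
    also have "\<dots> \<le> (\<Sum>p<K*K. \<bar>(g (?A t) p - g A p) * ?h p\<bar>)" by (rule sum_abs)
    also have "\<dots> \<le> (\<Sum>p<K*K. e' * ?r)"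
    proof (rule sum_mono)
      fix p assume p: "p \<in> {..<K*K}"
      have "\<bar>g (?A t) p - g A p\<bar> \<le> e'" 
        using t by (intro less_imp_le bspec[OF conjunct2[OF near] p]) auto
      then show "\<bar>(g (?A t) p - g A p) * ?h p\<bar> \<le> e' * ?r"
        unfolding abs_mult using h p e' by (intro mult_mono) auto
    qed
    also have "\<dots> = (real (K * K) * e') * ?r" by simp
    also have "\<dots> \<le> e * ?r" by (intro mult_right_mono e' fro_nonneg)
    finally show "\<bar>f B - f A - (\<Sum>p<K*K. g A p * ?h p)\<bar> \<le> e * ?r" .
  qed
qed

section \<open>The score\<close>

definition tconst :: "real \<Rightarrow> nat \<Rightarrow> real" where
  "tconst \<nu> m = Gamma ((\<nu> + real m) / 2) / Gamma (\<nu> / 2) * ((\<nu> - 2) * pi) powr (- real m / 2)"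

lemma tconst_pos: "\<nu> > 2 \<Longrightarrow> tconst \<nu> m > 0"
  unfolding tconst_def by (intro mult_pos_pos divide_pos_pos Gamma_real_pos) (auto intro: add_pos_nonneg)

lemma tstd_density_mid:
  "tstd_density \<nu> m (mid m) y
     = tconst \<nu> m * (1 + (\<Sum>i<m. (y i)\<^sup>2) / (\<nu> - 2)) powr (- (\<nu> + real m) / 2)"
proof -
  have "(\<Sum>j<m. y i * minv m (mid m) i j * y j) = (y i)\<^sup>2" if "i < m" for i
  proof -
    have "(\<Sum>j<m. y i * minv m (mid m) i j * y j) = (\<Sum>j<m. mid m i j * (y i * y j))"
      using that by (intro sum.cong refl) (simp add: minv_mid)
    then show ?thesis using that by (simp add: mid_sum_left power2_eq_square)
  qed
  then show ?thesis by (simp add: tstd_density_def tconst_def mdet_mid)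
qed

lemma ln_tconst_mult:
  assumes "\<nu> > 2" "q \<ge> 0"
  shows "ln (tconst \<nu> m * (1 + q / (\<nu> - 2)) powr (- (\<nu> + real m) / 2))
     = ln (tconst \<nu> m) - (\<nu> + real m) / 2 * ln (1 + q / (\<nu> - 2))"
proof -
  have "1 + q / (\<nu> - 2) > 0" using assms by (simp add: add_pos_nonneg)
  then show ?thesis using tconst_pos[OF assms(1), of m] by (simp add: ln_mult_pos ln_powr) (simp add: algebra_simps)
qed

locale t_setting = block_setting +
  fixes \<nu>0 :: real and \<nu> :: "nat \<Rightarrow> real"
  assumes nu0: "\<nu>0 > 2" and nu: "\<And>k. k < K \<Longrightarrow> \<nu> k > 2"
begin

definition Ysq :: "(nat \<Rightarrow> real) \<Rightarrow> nat \<Rightarrow> real" where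
  "Ysq z k = (\<Sum>i<nb k - 1. (Yv K nb U z (col k i))\<^sup>2)"

lemma Ysq_nonneg: "Ysq z k \<ge> 0"
  by (simp add: Ysq_def sum_nonneg)

lemma Xksq_eq:
  assumes "admissible B" "k < K" shows "Xksq K nb U B z k = Ysq z k / lam nb B k"
  using admissible_lam[OF assms]
  by (simp add: Xksq_def Xk_def lam_powr[OF assms] Ysq_def power_mult_distrib power_divide sum_divide_distrib)

text \<open>The symmetric root squares to the inverse, so B^(-1/2) disappears from the density and
  only B^(-1) has to be differentiated.\<close>

lemma X0sq_eq:
  assumes B: "admissible B"
  shows "X0sq K nb U B z = qf K (minv K B) (Yv K nb U z)"
proof -
  let ?N = "minv K (msqrt K B)" and ?y = "Yv K nb U z"
  note s = admissible_sym[OF B] admissible_mpd[OF B]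
  have Nsym: "msym K ?N"
    using minv_sym[OF msqrt_sym[OF s] mpd_mdet_nonzero[OF msqrt_mpd[OF s]]] by (simp add: msym_def)
  have "X0sq K nb U B z = dotm K (mapply K ?N ?y) (mapply K ?N ?y)"
    by (simp add: X0sq_def X0_def dotm_def mapply_def power2_eq_square)
  also have "\<dots> = dotm K ?y (mapply K ?N (mapply K ?N ?y))"
    by (rule dotm_sym_mapply[OF Nsym])
  also have "\<dots> = dotm K ?y (mapply K (mmult K ?N ?N) ?y)" by (simp add: mapply_mmult)
  also have "\<dots> = qf K (minv K B) ?y"
    unfolding qf_dotm using minv_msqrt_square[OF s] by (simp add: dotm_def mapply_def)
  finally show ?thesis .
qed

lemma qf_minv_nonneg: "admissible B \<Longrightarrow> qf K (minv K B) (Yv K nb U z) \<ge> 0"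
  unfolding X0sq_eq[symmetric] by (simp add: X0sq_def sum_nonneg)

text \<open>The closed form of the log-density for admissible \<open>B\<close>: ln |det L| has
  become half of ln det D, and B enters only through its inverse, the \<lambda>_k and det D.\<close>

definition ell :: "(nat \<Rightarrow> real) \<Rightarrow> rmat \<Rightarrow> real" where
  "ell z B = ln (tconst \<nu>0 K) - (\<nu>0 + real K) / 2 * ln (1 + qf K (minv K B) (Yv K nb U z) / (\<nu>0 - 2))
     + (\<Sum>k<K. ln (tconst (\<nu> k) (nb k - 1))
          - (\<nu> k + real (nb k - 1)) / 2 * ln (1 + Ysq z k / lam nb B k / (\<nu> k - 2)))
     - 1 / 2 * ln (mdet n (Dmat B))"

lemma loglik_eq:
  assumes B: "admissible B"
  shows "loglik K nb U \<nu>0 \<nu> B z = ell z B"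
proof -
  let ?v = "mapply n (minv n (Lmat K nb U B)) z"
  let ?g = "tconst \<nu>0 K * (1 + X0sq K nb U B z / (\<nu>0 - 2)) powr (- (\<nu>0 + real K) / 2)"
  let ?f = "\<lambda>k. tconst (\<nu> k) (nb k - 1) * (1 + Xksq K nb U B z k / (\<nu> k - 2)) powr (- (\<nu> k + real (nb k - 1)) / 2)"
  have "(\<Sum>i<K. (if i < K then ?v i else 0)\<^sup>2) = X0sq K nb U B z"
    by (simp add: X0sq_def mapply_minv_Lmat_low[OF B])
  moreover have "(\<Sum>i<nb k - 1. (if i < nb k - 1 then ?v (col k i) else 0)\<^sup>2) = Xksq K nb U B z k"
    if "k < K" for k
    unfolding Xksq_def using that by (intro sum.cong refl) (simp add: mapply_minv_Lmat_high[OF B])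
  ultimately have fV: "fV K nb \<nu>0 \<nu> ?v = ?g * (\<Prod>k<K. ?f k)"
    unfolding fV_def tstd_density_mid by (intro arg_cong2[where f = times] prod.cong) auto
  have sq0: "X0sq K nb U B z \<ge> 0" "Xksq K nb U B z k \<ge> 0" for k
    by (auto simp: X0sq_def Xksq_def sum_nonneg)
  have g0: "?g > 0"
  proof (intro mult_pos_pos tconst_pos nu0)
    have "1 + X0sq K nb U B z / (\<nu>0 - 2) > 0" using sq0 nu0 by (simp add: add_pos_nonneg)
    then show "(1 + X0sq K nb U B z / (\<nu>0 - 2)) powr (- (\<nu>0 + real K) / 2) > 0" by simp
  qed
  have f: "?f k > 0" if "k < K" for k
  proof (intro mult_pos_pos tconst_pos nu[OF that])
    have "1 + Xksq K nb U B z k / (\<nu> k - 2) > 0" using sq0 nu[OF that] by (simp add: add_pos_nonneg)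
    then show "(1 + Xksq K nb U B z k / (\<nu> k - 2)) powr (- (\<nu> k + real (nb k - 1)) / 2) > 0" by simp
  qed
  have prodpos: "(\<Prod>k<K. ?f k) > 0" by (intro prod_pos f) auto
  have det: "\<bar>mdet n (Lmat K nb U B)\<bar> > 0"
    using mdet_Lmat[OF B] mdet_Dmat_pos[OF B] by (metis zero_less_abs_iff power_zero_numeral less_irrefl)
  have lndet: "ln \<bar>mdet n (Lmat K nb U B)\<bar> = 1 / 2 * ln (mdet n (Dmat B))"
    unfolding mdet_Lmat[OF B, symmetric] using det ln_realpow[of "\<bar>mdet n (Lmat K nb U B)\<bar>" 2] by simp
  have "loglik K nb U \<nu>0 \<nu> B z = ln (?g * (\<Prod>k<K. ?f k)) - ln \<bar>mdet n (Lmat K nb U B)\<bar>"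
    unfolding loglik_def fZ_def fV by (rule ln_divide_pos[OF mult_pos_pos[OF g0 prodpos] det])
  also have "ln (?g * (\<Prod>k<K. ?f k)) = ln ?g + ln (\<Prod>k<K. ?f k)"
    by (rule ln_mult_pos[OF g0 prodpos])
  also have "ln (\<Prod>k<K. ?f k) = (\<Sum>k<K. ln (?f k))"
    by (rule ln_prod[OF finite_lessThan]) (metis f lessThan_iff less_irrefl)
  also have "\<dots> = (\<Sum>k<K. ln (tconst (\<nu> k) (nb k - 1))
      - (\<nu> k + real (nb k - 1)) / 2 * ln (1 + Xksq K nb U B z k / (\<nu> k - 2)))"
    using nu sq0 by (intro sum.cong refl ln_tconst_mult) auto
  also have "ln ?g = ln (tconst \<nu>0 K) - (\<nu>0 + real K) / 2 * ln (1 + X0sq K nb U B z / (\<nu>0 - 2))"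
    by (rule ln_tconst_mult[OF nu0 sq0(1)])
  finally show ?thesis unfolding ell_def lndet X0sq_eq[OF B] using Xksq_eq[OF B] by simp
qed

text \<open>Equal to B^(-1/2) X_0: its outer product is what B_\<otimes>^(-1/2) makes of vec(X_0
  X_0') in the score.\<close>

definition Uvec :: "(nat \<Rightarrow> real) \<Rightarrow> rmat \<Rightarrow> nat \<Rightarrow> real" where
  "Uvec z B = mapply K (minv K B) (Yv K nb U z)"

definition Sk :: "(nat \<Rightarrow> real) \<Rightarrow> rmat \<Rightarrow> nat \<Rightarrow> real" where
  "Sk z B k = 1 / lam nb B k - (\<nu> k + real (nb k) - 1) / (\<nu> k - 2 + Ysq z k / lam nb B k)
      * (Ysq z k / lam nb B k) / (lam nb B k * (real (nb k) - 1))"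

text \<open>The score as a K x K matrix, rewritten without square roots so that its continuity in B
  follows from that of \<open>minv\<close> and \<open>lam\<close>.\<close>

definition sgrad :: "(nat \<Rightarrow> real) \<Rightarrow> rmat \<Rightarrow> nat \<Rightarrow> nat \<Rightarrow> real" where
  "sgrad z B i j = 1 / 2 * ((\<nu>0 + real K) / (\<nu>0 - 2 + qf K (minv K B) (Yv K nb U z)) * Uvec z B i * Uvec z B j
      - minv K B i j + (if i = j then Sk z B i else 0))"

text \<open>The unfolded score at a pair of indices, still with the roots. It is the common source
  of the root-free form used for the gradient and of the form in terms of V used for the
  information.\<close>

lemma score_kron:
  assumes B: "admissible B" and ij: "i < K" "j < K"
  shows "score K nb U \<nu>0 \<nu> B z (i + K * j) =
    1 / 2 * (\<Sum>b<K. \<Sum>a<K. minv K (msqrt K B) j b * minv K (msqrt K B) i a *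
       (W0 K nb U \<nu>0 B z * (X0 K nb U B z a * X0 K nb U B z b) - mid K a b))
    + 1 / 2 * (if i = j then Svec K nb U \<nu> B z i else 0)"
proof -
  note s = admissible_sym[OF B] admissible_mpd[OF B]
  have 1: "(\<Sum>k<K. Ed K k (i + K * j) * Svec K nb U \<nu> B z k) = (if i = j then Svec K nb U \<nu> B z i else 0)"
  proof -
    have "(\<Sum>k<K. Ed K k (i + K * j) * Svec K nb U \<nu> B z k)
       = (\<Sum>k<K. if k = i then (if i = j then Svec K nb U \<nu> B z k else 0) else 0)"
      using ij by (intro sum.cong refl) (auto simp: Ed_index)
    then show ?thesis using ij by simp
  qed
  have 2: "(\<Sum>q<K*K. Aot_invsqrt K B (i + K * j) q *
        (W0 K nb U \<nu>0 B z * vecm K (\<lambda>i j. X0 K nb U B z i * X0 K nb U B z j) q - vecm K (mid K) q))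
     = (\<Sum>b<K. \<Sum>a<K. minv K (msqrt K B) j b * minv K (msqrt K B) i a *
       (W0 K nb U \<nu>0 B z * (X0 K nb U B z a * X0 K nb U B z b) - mid K a b))"
    unfolding sum_vec
    by (intro sum.cong refl)
       (use ij in \<open>simp add: Aot_invsqrt_kron[OF s] vec_index_less kron_def vecm_index\<close>)
  show ?thesis unfolding score_def 1 2 ..
qed

lemma score_eq:
  assumes B: "admissible B" and ij: "i < K" "j < K"
  shows "score K nb U \<nu>0 \<nu> B z (i + K * j) = sgrad z B i j"
proof -
  note s = admissible_sym[OF B] admissible_mpd[OF B]
  let ?N = "minv K (msqrt K B)" and ?x = "X0 K nb U B z" and ?w = "W0 K nb U \<nu>0 B z"
  have x: "?x = mapply K ?N (Yv K nb U z)" by (simp add: X0_def mapply_def)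
  have Nx: "mapply K ?N ?x i = Uvec z B i" if "i < K" for i
  proof -
    have "mapply K ?N ?x i = mapply K (mmult K ?N ?N) (Yv K nb U z) i" unfolding x mapply_mmult ..
    then show ?thesis using minv_msqrt_square[OF s that] by (simp add: Uvec_def mapply_def)
  qed
  have Nsym: "?N a b = ?N b a" if "a < K" "b < K" for a b
    using minv_sym[OF msqrt_sym[OF s] mpd_mdet_nonzero[OF msqrt_mpd[OF s]] that] .
  have "(\<Sum>b<K. \<Sum>a<K. ?N j b * ?N i a * (?w * (?x a * ?x b) - mid K a b))
     = (\<Sum>b<K. \<Sum>a<K. ?w * ((?N j b * ?x b) * (?N i a * ?x a))) - (\<Sum>b<K. \<Sum>a<K. ?N j b * (?N i a * mid K a b))"
    unfolding sum_subtractf[symmetric] by (intro sum.cong refl) (simp add: algebra_simps)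
  also have "(\<Sum>b<K. \<Sum>a<K. ?w * ((?N j b * ?x b) * (?N i a * ?x a))) = ?w * (mapply K ?N ?x j * mapply K ?N ?x i)"
    unfolding mapply_def sum_product by (simp add: sum_distrib_left)
  also have "(\<Sum>b<K. \<Sum>a<K. ?N j b * (?N i a * mid K a b)) = (\<Sum>b<K. ?N i b * ?N b j)"
    unfolding sum_distrib_left[symmetric]
    by (intro sum.cong refl) (use ij in \<open>simp add: mid_sum_right Nsym[of j]\<close>)
  also have "\<dots> = minv K B i j" using minv_msqrt_square[OF s ij] by (simp add: mmult_def)
  finally have "(\<Sum>b<K. \<Sum>a<K. ?N j b * ?N i a * (?w * (?x a * ?x b) - mid K a b))
     = ?w * (Uvec z B j * Uvec z B i) - minv K B i j" using Nx ij by simp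
  note eq = this
  have W: "?w = (\<nu>0 + real K) / (\<nu>0 - 2 + qf K (minv K B) (Yv K nb U z))"
    by (simp add: W0_def X0sq_eq[OF B])
  have S: "Svec K nb U \<nu> B z i = Sk z B i"
    using ij by (simp add: Svec_def Sk_def Wk_def Xksq_eq[OF B])
  show ?thesis
    unfolding score_kron[OF B ij] eq unfolding sgrad_def W S by (simp add: algebra_simps)
qed

lemma sgrad_sym:
  assumes B: "admissible B" and ij: "i < K" "j < K" shows "sgrad z B i j = sgrad z B j i"
  using minv_sym[OF admissible_sym[OF B] mpd_mdet_nonzero[OF admissible_mpd[OF B]] ij]
  by (simp add: sgrad_def mult_ac)

lemma tendsto_if_const:
  "(f \<longlongrightarrow> a) F \<Longrightarrow> ((\<lambda>x. if P then f x else c) \<longlongrightarrow> (if P then a else c)) F"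
  by simp

lemma DERIV_if:
  "(f has_real_derivative f') F \<Longrightarrow> (g has_real_derivative g') F \<Longrightarrow>
     ((\<lambda>s. if P then f s else g s) has_real_derivative (if P then f' else g')) F"
  by simp

section \<open>Derivative of the log-density along a line of matrices\<close>

lemma DERIV_lam:
  assumes "k < K"
  shows "((\<lambda>t. lam nb (\<lambda>i j. A i j + t * H i j) k) has_real_derivative - (H k k / (real (nb k) - 1))) (at t)"
  unfolding lam_def using nb[OF assms] by (auto intro!: derivative_eq_intros)

lemma minv_Dmat:
  assumes B: "admissible B" and "i < n" "j < n"
  shows "minv n (Dmat B) i j = DD (minv K B) (\<lambda>c. 1 / spread (lam nb B) c) i j"
proof (rule minv_eqI[OF _ assms(2,3)])
  show "is_inv n (Dmat B) (DD (minv K B) (\<lambda>c. 1 / spread (lam nb B) c))"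
    unfolding Dmat_def
  proof (rule DD_inv)
    show "is_inv K B (minv K B)" by (rule is_inv_minv[OF mpd_mdet_nonzero[OF admissible_mpd[OF B]]])
    fix c assume "K \<le> c" "c < n"
    then show "spread (lam nb B) c * (1 / spread (lam nb B) c) = 1"
      using spread_lam_pos[OF B, of c] by simp
  qed
qed

text \<open>Jacobi's formula gives the trace of D^(-1) D'. Block k contributes n_k - 1 equal terms
  -H_kk/((n_k - 1) \<lambda>_k), so the multiplicity cancels the denominator that comes from
  differentiating \<lambda>_k.\<close>

lemma DERIV_ln_mdet_Dmat:
  assumes B: "admissible (\<lambda>i j. A i j + t * H i j)" (is "admissible ?B")
  shows "((\<lambda>t. ln (mdet n (Dmat (\<lambda>i j. A i j + t * H i j)))) has_real_derivative
     (\<Sum>i<K. \<Sum>j<K. minv K ?B i j * H j i) - (\<Sum>k<K. H k k / lam nb ?B k)) (at t)"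
proof -
  let ?l = "\<lambda>k. - (H k k / (real (nb k) - 1))"
  have pos: "mdet n (Dmat ?B) > 0" by (rule mdet_Dmat_pos[OF B])
  have D: "((\<lambda>s. Dmat (\<lambda>i j. A i j + s * H i j) i j) has_real_derivative DD H (spread ?l) i j) (at t)" for i j
  proof -
    have sp: "((\<lambda>s. spread (lam nb (\<lambda>i j. A i j + s * H i j)) c) has_real_derivative spread ?l c) (at t)" for c
      unfolding spread_def by (intro DERIV_sum) (auto intro!: DERIV_lam)
    have lin: "((\<lambda>s. A i j + s * H i j) has_real_derivative H i j) (at t)"
      by (auto intro!: derivative_eq_intros)
    show ?thesis unfolding Dmat_def DD_def by (intro DERIV_if sp lin DERIV_const)
  qed
  have tr: "(\<Sum>i<n. \<Sum>j<n. minv n (Dmat ?B) i j * DD H (spread ?l) j i)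
     = (\<Sum>i<K. \<Sum>j<K. minv K ?B i j * H j i) - (\<Sum>k<K. H k k / lam nb ?B k)"
  proof -
    have "(\<Sum>i<n. \<Sum>j<n. minv n (Dmat ?B) i j * DD H (spread ?l) j i)
      = (\<Sum>i<n. \<Sum>j<n. DD (minv K ?B) (\<lambda>c. 1 / spread (lam nb ?B) c) i j * DD H (spread ?l) j i)"
      by (intro sum.cong refl) (simp add: minv_Dmat[OF B])
    also have "\<dots> = (\<Sum>i<n. if i < K then (\<Sum>j<K. minv K ?B i j * DD H (spread ?l) j i)
         else 1 / spread (lam nb ?B) i * DD H (spread ?l) i i)"
      by (intro sum.cong refl) (simp add: DD_sum)
    also have "\<dots> = (\<Sum>i<K. \<Sum>j<K. minv K ?B i j * H j i)
        + (\<Sum>k<K. \<Sum>i<nb k - 1. 1 / lam nb ?B k * ?l k)"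
      unfolding sum_cols
      by (intro arg_cong2[where f = plus] sum.cong refl) (auto simp: DD_def spread_col)
    also have "(\<Sum>k<K. \<Sum>i<nb k - 1. 1 / lam nb ?B k * ?l k) = (\<Sum>k<K. - (H k k / lam nb ?B k))"
    proof (intro sum.cong refl)
      fix k assume "k \<in> {..<K}"
      then have "real (nb k - 1) = real (nb k) - 1" "real (nb k) - 1 \<noteq> 0" using nb[of k] by auto
      then show "(\<Sum>i<nb k - 1. 1 / lam nb ?B k * ?l k) = - (H k k / lam nb ?B k)" by simp
    qed
    finally show ?thesis by (simp add: sum_negf)
  qed
  have "((\<lambda>s. mdet n (Dmat (\<lambda>i j. A i j + s * H i j))) has_real_derivative
     mdet n (Dmat ?B) * (\<Sum>i<n. \<Sum>j<n. minv n (Dmat ?B) i j * DD H (spread ?l) j i)) (at t)"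
    using pos by (intro DERIV_mdet[where M = "\<lambda>s. Dmat (\<lambda>i j. A i j + s * H i j)" and M' = "DD H (spread ?l)"] D) auto
  from DERIV_chain2[OF DERIV_ln[OF pos] this] show ?thesis
    by (rule DERIV_cong) (use pos in \<open>simp only: tr mult.assoc[symmetric] left_inverse[OF less_imp_neq[OF pos, symmetric]] mult_1_left\<close>)
qed

lemma DERIV_qf_minv:
  assumes B: "admissible (\<lambda>i j. A i j + t * H i j)" (is "admissible ?B")
  shows "((\<lambda>t. qf K (minv K (\<lambda>i j. A i j + t * H i j)) (Yv K nb U z)) has_real_derivative
     - (\<Sum>k<K. \<Sum>l<K. Uvec z ?B k * H k l * Uvec z ?B l)) (at t)"
proof -
  let ?y = "Yv K nb U z" and ?N = "minv K ?B"
  have det: "mdet K ?B \<noteq> 0" by (rule mpd_mdet_nonzero[OF admissible_mpd[OF B]])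
  have Nsym: "?N a b = ?N b a" if "a < K" "b < K" for a b
    by (rule minv_sym[OF admissible_sym[OF B] det that])
  have "((\<lambda>t. qf K (minv K (\<lambda>i j. A i j + t * H i j)) ?y) has_real_derivative
     (\<Sum>i<K. \<Sum>j<K. ?y i * - (\<Sum>k<K. \<Sum>l<K. ?N i k * H k l * ?N l j) * ?y j)) (at t)"
    unfolding qf_def
    by (intro DERIV_sum DERIV_cmult DERIV_cmult_right DERIV_minv[where M = "\<lambda>s i j. A i j + s * H i j"])
       (use det in \<open>auto intro!: derivative_eq_intros\<close>)
  also have "(\<Sum>i<K. \<Sum>j<K. ?y i * - (\<Sum>k<K. \<Sum>l<K. ?N i k * H k l * ?N l j) * ?y j)
     = - dotm K ?y (mapply K (mmult K ?N (mmult K H ?N)) ?y)"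
    by (simp add: dotm_def mapply_def mmult_def sum_distrib_left sum_distrib_right sum_negf mult_ac)
  also have "dotm K ?y (mapply K (mmult K ?N (mmult K H ?N)) ?y) = dotm K ?y (mapply K ?N (mapply K H (Uvec z ?B)))"
    by (simp add: mapply_mmult Uvec_def)
  also have "\<dots> = dotm K (mapply K H (Uvec z ?B)) (Uvec z ?B)"
    using Nsym dotm_sym_mapply[of K ?N ?y] by (simp add: msym_def Uvec_def)
  also have "\<dots> = (\<Sum>k<K. \<Sum>l<K. Uvec z ?B k * H k l * Uvec z ?B l)"
    by (simp add: dotm_def mapply_def sum_distrib_right sum_distrib_left mult_ac)
  finally show ?thesis .
qed


text \<open>Each \<lambda>_k is affine in the k-th diagonal entry alone, so all terms involving it
  feed only the diagonal; these make up E_d'S. The quadratic form gives the outer product of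
  \<open>Uvec\<close>, and the A-block of the determinant gives -A^(-1).\<close>

lemma DERIV_ell:
  assumes B: "admissible (\<lambda>i j. A i j + t * H i j)" (is "admissible ?B")
  shows "((\<lambda>t. ell z (\<lambda>i j. A i j + t * H i j)) has_real_derivative
     (\<Sum>i<K. \<Sum>j<K. sgrad z ?B i j * H i j)) (at t)"
proof -
  define q where "q = qf K (minv K ?B) (Yv K nb U z)"
  define h where "h = (\<Sum>k<K. \<Sum>l<K. Uvec z ?B k * H k l * Uvec z ?B l)"
  have q0: "q \<ge> 0" unfolding q_def by (rule qf_minv_nonneg[OF B])
  have pos0: "1 + q / (\<nu>0 - 2) > 0" using q0 nu0 by (simp add: add_pos_nonneg)
  have d0: "((\<lambda>t. ln (1 + qf K (minv K (\<lambda>i j. A i j + t * H i j)) (Yv K nb U z) / (\<nu>0 - 2)))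
      has_real_derivative - h / (\<nu>0 - 2 + q)) (at t)"
    using DERIV_qf_minv[OF B, of z, folded h_def] pos0 nu0 q0
    by (auto intro!: derivative_eq_intros simp: q_def[symmetric] divide_simps)
  have dk: "((\<lambda>t. ln (1 + Ysq z k / lam nb (\<lambda>i j. A i j + t * H i j) k / (\<nu> k - 2)))
      has_real_derivative Ysq z k / lam nb ?B k * (H k k / (real (nb k) - 1))
         / (lam nb ?B k * (\<nu> k - 2 + Ysq z k / lam nb ?B k))) (at t)"
    if k: "k < K" for k
  proof -
    define l where "l = lam nb ?B k"
    define c where "c = \<nu> k - 2"
    define y where "y = Ysq z k"
    define m where "m = real (nb k) - 1"
    have l: "l > 0" unfolding l_def by (rule admissible_lam[OF B k])
    have c: "c > 0" using nu[OF k] by (simp add: c_def)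
    have y: "y \<ge> 0" unfolding y_def by (rule Ysq_nonneg)
    have m: "m > 0" using nb[OF k] by (simp add: m_def)
    have pos: "1 + y / l / c > 0" using l c y by (simp add: add_pos_nonneg)
    have "((\<lambda>t. y / lam nb (\<lambda>i j. A i j + t * H i j) k / c) has_real_derivative
        (y * (H k k / m) / (l * l) / c)) (at t)"
      using DERIV_lam[OF k, of A H t] l c
      by (auto intro!: derivative_eq_intros simp: l_def[symmetric] m_def[symmetric])
    then have "((\<lambda>t. ln (1 + y / lam nb (\<lambda>i j. A i j + t * H i j) k / c)) has_real_derivative
        inverse (1 + y / l / c) * (0 + y * (H k k / m) / (l * l) / c)) (at t)"
      using pos unfolding l_def by (intro DERIV_chain2[OF DERIV_ln] DERIV_add DERIV_const)
    then have "((\<lambda>t. ln (1 + y / lam nb (\<lambda>i j. A i j + t * H i j) k / c)) has_real_derivative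
        y / l * (H k k / m) / (l * (c + y / l))) (at t)"
    proof (rule DERIV_cong)
      have "c * l + y > 0" using c l y by (intro add_pos_nonneg mult_pos_pos)
      then show "inverse (1 + y / l / c) * (0 + y * (H k k / m) / (l * l) / c) = y / l * (H k k / m) / (l * (c + y / l))"
        using l c m by (simp add: divide_simps) (simp add: algebra_simps)
    qed
    then show ?thesis by (simp add: l_def c_def y_def m_def)
  qed
  have "((\<lambda>t. ell z (\<lambda>i j. A i j + t * H i j)) has_real_derivative
     0 - (\<nu>0 + real K) / 2 * (- h / (\<nu>0 - 2 + q))
     + (\<Sum>k<K. 0 - (\<nu> k + real (nb k - 1)) / 2 * (Ysq z k / lam nb ?B k * (H k k / (real (nb k) - 1))
         / (lam nb ?B k * (\<nu> k - 2 + Ysq z k / lam nb ?B k))))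
     - 1 / 2 * ((\<Sum>i<K. \<Sum>j<K. minv K ?B i j * H j i) - (\<Sum>k<K. H k k / lam nb ?B k))) (at t)"
    unfolding ell_def
    by (intro DERIV_diff DERIV_add DERIV_cmult DERIV_sum DERIV_const d0 dk DERIV_ln_mdet_Dmat[OF B]) auto
  then show ?thesis
  proof (rule DERIV_cong)
    have W: "(\<nu>0 + real K) / 2 * (h / (\<nu>0 - 2 + q))
       = (\<Sum>i<K. \<Sum>j<K. 1 / 2 * ((\<nu>0 + real K) / (\<nu>0 - 2 + q) * Uvec z ?B i * Uvec z ?B j) * H i j)"
      unfolding h_def by (simp add: sum_distrib_left sum_divide_distrib mult_ac)
    have N: "(\<Sum>i<K. \<Sum>j<K. minv K ?B i j * H j i) = (\<Sum>i<K. \<Sum>j<K. minv K ?B i j * H i j)"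
      by (subst sum.swap, intro sum.cong refl)
         (simp add: minv_sym[OF admissible_sym[OF B] mpd_mdet_nonzero[OF admissible_mpd[OF B]]])
    have S: "(\<Sum>k<K. 0 - (\<nu> k + real (nb k - 1)) / 2 * (Ysq z k / lam nb ?B k * (H k k / (real (nb k) - 1))
         / (lam nb ?B k * (\<nu> k - 2 + Ysq z k / lam nb ?B k)))) + 1 / 2 * (\<Sum>k<K. H k k / lam nb ?B k)
       = (\<Sum>k<K. 1 / 2 * Sk z ?B k * H k k)"
      unfolding sum_distrib_left sum.distrib[symmetric]
    proof (intro sum.cong refl)
      fix k assume "k \<in> {..<K}"
      then have nu_eq: "\<nu> k + real (nb k - 1) = \<nu> k + real (nb k) - 1" using nb[of k] by auto
      have alg: "0 - a / 2 * (y * (h / m) / (l * d)) + 1 / 2 * (h / l) = 1 / 2 * (1 / l - a / d * y / (l * m)) * h"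
        for a y h m l d :: real
        by (cases "l = 0"; cases "m = 0"; cases "d = 0") (simp_all add: field_simps)
      show "0 - (\<nu> k + real (nb k - 1)) / 2 * (Ysq z k / lam nb ?B k * (H k k / (real (nb k) - 1))
         / (lam nb ?B k * (\<nu> k - 2 + Ysq z k / lam nb ?B k))) + 1 / 2 * (H k k / lam nb ?B k)
         = 1 / 2 * Sk z ?B k * H k k"
        unfolding Sk_def nu_eq by (rule alg)
    qed
    have D: "(\<Sum>k<K. 1 / 2 * Sk z ?B k * H k k) = (\<Sum>i<K. \<Sum>j<K. 1 / 2 * (if i = j then Sk z ?B i else 0) * H i j)"
    proof (intro sum.cong refl)
      fix i assume i: "i \<in> {..<K}"
      have "(\<Sum>j<K. 1 / 2 * (if i = j then Sk z ?B i else 0) * H i j) = (\<Sum>j<K. if j = i then 1 / 2 * Sk z ?B i * H i j else 0)"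
        by (intro sum.cong refl) auto
      then show "1 / 2 * Sk z ?B i * H i i = (\<Sum>j<K. 1 / 2 * (if i = j then Sk z ?B i else 0) * H i j)"
        using i by simp
    qed
    have "(\<Sum>i<K. \<Sum>j<K. sgrad z ?B i j * H i j)
      = (\<Sum>i<K. \<Sum>j<K. 1 / 2 * ((\<nu>0 + real K) / (\<nu>0 - 2 + q) * Uvec z ?B i * Uvec z ?B j) * H i j)
       - 1 / 2 * (\<Sum>i<K. \<Sum>j<K. minv K ?B i j * H i j)
       + (\<Sum>i<K. \<Sum>j<K. 1 / 2 * (if i = j then Sk z ?B i else 0) * H i j)"
      unfolding sum_distrib_left sum.distrib[symmetric] sum_subtractf[symmetric]
      by (intro sum.cong refl) (simp add: sgrad_def q_def algebra_simps)
    then show "0 - (\<nu>0 + real K) / 2 * (- h / (\<nu>0 - 2 + q))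
     + (\<Sum>k<K. 0 - (\<nu> k + real (nb k - 1)) / 2 * (Ysq z k / lam nb ?B k * (H k k / (real (nb k) - 1))
         / (lam nb ?B k * (\<nu> k - 2 + Ysq z k / lam nb ?B k))))
     - 1 / 2 * ((\<Sum>i<K. \<Sum>j<K. minv K ?B i j * H j i) - (\<Sum>k<K. H k k / lam nb ?B k))
     = (\<Sum>i<K. \<Sum>j<K. sgrad z ?B i j * H i j)"
      unfolding W[symmetric] D[symmetric] S[symmetric] N by (simp add: algebra_simps)
  qed
qed

text \<open>Admissibility is what makes C positive definite and the closed form valid; it is an open
  condition among symmetric matrices. Coercivity of A leaves room for perturbations whose absolute
  entries sum to less than \<open>\<delta>\<close>, and the \<lambda>_k are continuous.\<close>

lemma eventually_admissible:
  assumes A: "admissible A" shows "eventually admissible (symnhds K A)"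
proof -
  obtain \<delta> where \<delta>: "\<delta> > 0" "\<And>x. \<delta> * dotm K x x \<le> qf K A x"
    by (rule mpd_coercive[OF admissible_sym[OF A] admissible_mpd[OF A]]) blast
  have "((\<lambda>B. \<Sum>i<K. \<Sum>j<K. \<bar>B i j - A i j\<bar>) \<longlongrightarrow> (\<Sum>i<K. \<Sum>j<K. \<bar>A i j - A i j\<bar>)) (symnhds K A)"
    by (intro tendsto_sum tendsto_rabs tendsto_diff tendsto_const tendsto_symnhds_entry) auto
  then have ev1: "eventually (\<lambda>B. (\<Sum>i<K. \<Sum>j<K. \<bar>B i j - A i j\<bar>) < \<delta>) (symnhds K A)"
    using \<delta>(1) by (intro order_tendstoD(2)[where y = 0]) auto
  have "((\<lambda>B. lam nb B k) \<longlongrightarrow> lam nb A k) (symnhds K A)" if "k < K" for k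
    unfolding lam_def using that nb[OF that]
    by (intro tendsto_divide tendsto_diff tendsto_const tendsto_symnhds_entry) auto
  then have ev2: "eventually (\<lambda>B. \<forall>k\<in>{..<K}. lam nb B k > 0) (symnhds K A)"
    using admissible_lam[OF A] by (intro eventually_ball_finite ballI order_tendstoD(1)) auto
  have ev3: "eventually (msym K) (symnhds K A)"
    unfolding eventually_symnhds by (intro exI[of _ 1]) auto
  from ev1 ev2 ev3 show ?thesis
  proof eventually_elim
    case (elim B)
    have "mpd K B" unfolding mpd_qf
    proof (intro allI impI)
      fix x :: "nat \<Rightarrow> real" assume "\<exists>i<K. x i \<noteq> 0"
      then have pos: "dotm K x x > 0"
        using dotm_self_nonneg[of K x] dotm_self_eq_0[of K x] by fastforce
      have "qf K B x = qf K A x + qf K (\<lambda>i j. B i j - A i j) x"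
        by (simp add: qf_def sum.distrib[symmetric] algebra_simps)
      moreover have "\<bar>qf K (\<lambda>i j. B i j - A i j) x\<bar> \<le> (\<Sum>i<K. \<Sum>j<K. \<bar>B i j - A i j\<bar>) * dotm K x x"
        by (rule qf_abs_le)
      moreover have "(\<Sum>i<K. \<Sum>j<K. \<bar>B i j - A i j\<bar>) * dotm K x x < \<delta> * dotm K x x"
        using elim(1) pos by (rule mult_strict_right_mono)
      ultimately show "qf K B x > 0" using \<delta>(2)[of x] by linarith
    qed
    then show "admissible B" using elim by (auto simp: admissible_def)
  qed
qed

lemma tendsto_sgrad:
  assumes A: "admissible A" and ij: "i < K" "j < K"
  shows "((\<lambda>B. sgrad z B i j) \<longlongrightarrow> sgrad z A i j) (symnhds K A)"
proof -
  have N: "((\<lambda>B. minv K B i j) \<longlongrightarrow> minv K A i j) (symnhds K A)" if "i < K" "j < K" for i j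
    using that by (intro tendsto_minv[where M = "\<lambda>B. B"] tendsto_symnhds_entry
        mpd_mdet_nonzero[OF admissible_mpd[OF A]])
  have l: "((\<lambda>B. lam nb B i) \<longlongrightarrow> lam nb A i) (symnhds K A)"
    unfolding lam_def using ij nb[OF ij(1)]
    by (intro tendsto_divide tendsto_diff tendsto_const tendsto_symnhds_entry) auto
  have l0: "lam nb A i > 0" by (rule admissible_lam[OF A ij(1)])
  have 1: "\<nu>0 - 2 + qf K (minv K A) (Yv K nb U z) \<noteq> 0"
    using nu0 qf_minv_nonneg[OF A, of z] by linarith
  have "Ysq z i / lam nb A i \<ge> 0" using l0 Ysq_nonneg[of z i] by simp
  then have 2: "\<nu> i - 2 + Ysq z i / lam nb A i \<noteq> 0" using nu[OF ij(1)] by linarith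
  have 3: "real (nb i) - 1 \<noteq> 0" using nb[OF ij(1)] by simp
  have q: "((\<lambda>B. qf K (minv K B) (Yv K nb U z)) \<longlongrightarrow> qf K (minv K A) (Yv K nb U z)) (symnhds K A)"
    unfolding qf_def by (intro tendsto_sum tendsto_mult tendsto_const N) auto
  have u: "((\<lambda>B. Uvec z B k) \<longlongrightarrow> Uvec z A k) (symnhds K A)" if "k < K" for k
    unfolding Uvec_def mapply_def using that by (intro tendsto_sum tendsto_mult tendsto_const N) auto
  have S: "((\<lambda>B. Sk z B i) \<longlongrightarrow> Sk z A i) (symnhds K A)"
    unfolding Sk_def using l0 2 3 by (intro tendsto_intros l) auto
  have "((\<lambda>B. if i = j then Sk z B i else 0) \<longlongrightarrow> (if i = j then Sk z A i else 0)) (symnhds K A)"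
    using S by (rule tendsto_if_const)
  then show ?thesis unfolding sgrad_def using 1 ij by (intro tendsto_intros q u N)
qed

lemma loglik_has_sym_grad:
  assumes A: "admissible A"
  shows "has_sym_grad K (\<lambda>B. loglik K nb U \<nu>0 \<nu> B z) A (score K nb U \<nu>0 \<nu> A z)"
proof -
  define g where "g B p = sgrad z B (p mod K) (p div K)" for B p
  have "has_sym_grad K (\<lambda>B. loglik K nb U \<nu>0 \<nu> B z) A (g A)"
  proof (rule has_sym_gradI[OF admissible_sym[OF A] eventually_admissible[OF A]])
    fix B and t :: real
    assume adm: "\<And>s. 0 \<le> s \<Longrightarrow> s \<le> 1 \<Longrightarrow> admissible (\<lambda>i j. A i j + s * (B i j - A i j))"
      and t: "0 \<le> t" "t \<le> 1"
    let ?B = "\<lambda>i j. A i j + t * (B i j - A i j)"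
    have "((\<lambda>t. ell z (\<lambda>i j. A i j + t * (B i j - A i j))) has_real_derivative
        (\<Sum>i<K. \<Sum>j<K. sgrad z ?B i j * (B i j - A i j))) (at t within {0..1})"
      by (rule has_field_derivative_at_within[OF DERIV_ell[OF adm[OF t]]])
    \<comment> \<open>\<open>ell\<close> and \<open>loglik\<close> agree at admissible matrices,
      which is assumed along the segment only; hence the derivative within {0..1}.\<close>
    then have "((\<lambda>t. loglik K nb U \<nu>0 \<nu> (\<lambda>i j. A i j + t * (B i j - A i j)) z) has_real_derivative
        (\<Sum>i<K. \<Sum>j<K. sgrad z ?B i j * (B i j - A i j))) (at t within {0..1})"
      by (rule has_field_derivative_transform_within[where d = 1]) (use t adm in \<open>auto simp: loglik_eq\<close>)
    moreover have "(\<Sum>i<K. \<Sum>j<K. sgrad z ?B i j * (B i j - A i j))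
       = (\<Sum>p<K*K. g ?B p * (vecm K B p - vecm K A p))"
      unfolding sum_vec by (subst sum.swap, intro sum.cong refl) (simp add: g_def vecm_index)
    ultimately show "((\<lambda>t. loglik K nb U \<nu>0 \<nu> (\<lambda>i j. A i j + t * (B i j - A i j)) z) has_real_derivative
        (\<Sum>p<K*K. g ?B p * (vecm K B p - vecm K A p))) (at t within {0..1})" by simp
  next
    fix p assume "p < K * K"
    then show "((\<lambda>B. g B p) \<longlongrightarrow> g A p) (symnhds K A)"
      unfolding g_def using vec_index_bounds[of p K] by (intro tendsto_sgrad[OF A]) auto
  qed
  moreover have "g A p = score K nb U \<nu>0 \<nu> A z p" if "p < K * K" for p
  proof -
    obtain i j where ij: "i < K" "j < K" "p = i + K * j" by (rule vec_index_cases[OF \<open>p < K * K\<close>])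
    then show ?thesis using score_eq[OF A ij(1,2), of z] by (simp add: g_def)
  qed
  ultimately show ?thesis by (simp add: has_sym_grad_def)
qed

text \<open>A gradient along symmetric matrices is determined only up to antisymmetric vectors.
  Symmetry of the score singles out the unique symmetric representative.\<close>

lemma score_sym:
  assumes A: "admissible A" and p: "p < K * K"
  shows "score K nb U \<nu>0 \<nu> A z p = score K nb U \<nu>0 \<nu> A z (p div K + K * (p mod K))"
proof -
  obtain i j where ij: "i < K" "j < K" "p = i + K * j" by (rule vec_index_cases[OF p])
  then show ?thesis using score_eq[OF A ij(1,2)] score_eq[OF A ij(2,1)] sgrad_sym[OF A ij(1,2)] by simp
qed

end

section \<open>Moments of the standardized t distribution\<close>

lemma has_bochner_integral_Gamma:
  assumes p: "p > 0" and c: "c > (0::real)"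
  shows "has_bochner_integral lborel (\<lambda>s. indicator {0<..} s * s powr (p - 1) * exp (- s * c)) (Gamma p / c powr p)"
proof -
  let ?f = "\<lambda>t::real. indicator {0..} t * t powr (p - 1) / exp t"
  have "has_bochner_integral lborel ?f (Gamma p)"
  proof (rule has_bochner_integral_nn_integral)
    show "(\<integral>\<^sup>+t. ennreal (?f t) \<partial>lborel) = ennreal (Gamma p)"
      by (rule Gamma_conv_nn_integral_real[OF p, symmetric])
  qed (use Gamma_real_pos[OF p] in \<open>auto simp: less_imp_le\<close>)
  then have "has_bochner_integral lborel (\<lambda>s. ?f (0 + c * s)) (Gamma p /\<^sub>R \<bar>c\<bar>)"
    using lborel_has_bochner_integral_real_affine_iff[of c ?f "Gamma p" 0] c by simp
  then have "has_bochner_integral lborel (\<lambda>s. c powr (1 - p) * ?f (0 + c * s)) (c powr (1 - p) * (Gamma p /\<^sub>R \<bar>c\<bar>))"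
    by (rule has_bochner_integral_mult_right)
  moreover have "c powr (1 - p) * ?f (0 + c * s) = indicator {0<..} s * s powr (p - 1) * exp (- s * c)" for s
  proof (cases "s > 0")
    case True
    have "c powr (1 - p) * (c * s) powr (p - 1) = s powr (p - 1)"
      using True c by (simp add: powr_mult flip: powr_add mult.assoc)
    then show ?thesis using True c by (simp add: indicator_def exp_minus divide_inverse mult_ac)
  next
    case False
    \<comment> \<open>At s = 0 the indicators of {0..} and {0<..} differ, but there the power
      vanishes since 0 \<open>powr\<close> x = 0.\<close>
    then show ?thesis using c by (auto simp: indicator_def zero_le_mult_iff)
  qed
  moreover have "c powr (1 - p) * (Gamma p /\<^sub>R \<bar>c\<bar>) = Gamma p / c powr p"
    using c by (simp add: powr_diff field_simps)
  ultimately show ?thesis by simp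
qed

section \<open>Gaussian moments\<close>

definition gm :: "nat \<Rightarrow> real" where
  "gm k = (if even k then fact k / (2 ^ (k div 2) * fact (k div 2)) else 0)"

text \<open>\<open>gm\<close> lists the moments and \<open>gabs\<close> the absolute moments of the
  standard normal law. The latter serve only to establish the absolute integrability that Fubini's
  theorem asks for.\<close>

definition gabs :: "nat \<Rightarrow> real" where
  "gabs k = (if even k then gm k else 2 ^ (k div 2) * fact (k div 2) * sqrt (2 / pi))"

lemma gm_values: "gm 0 = 1" "gm (Suc 0) = 0" "gm 2 = 1" "gm 3 = 0" "gm 4 = 3"
  by (simp_all add: gm_def fact_numeral)

lemma normal_density_scaled:
  assumes "s > 0"
  shows "normal_density 0 (sqrt (1 / (2 * s))) x * sqrt (pi / s) = exp (- s * x\<^sup>2)"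
proof -
  have "(sqrt (1 / (2 * s)))\<^sup>2 = 1 / (2 * s)" using assms by simp
  then have "normal_density 0 (sqrt (1 / (2 * s))) x = 1 / sqrt (pi / s) * exp (- s * x\<^sup>2)"
    unfolding normal_density_def by (simp add: field_simps)
  then show ?thesis using assms by simp
qed

lemma sqrt_power_powr: "s > 0 \<Longrightarrow> (sqrt (1 / s)) ^ k = s powr (- real k / 2)"
proof -
  assume s: "s > 0"
  have "sqrt (1 / s) = s powr (- 1 / 2)"
    using s by (simp add: powr_minus_divide real_sqrt_divide powr_half_sqrt)
  then show ?thesis using s by (simp add: powr_power)
qed

text \<open>The weight exp(-s x^2) is sqrt(pi/s) times the centred normal density of variance
  1/(2s), and the k-th power of its standard deviation is (2s)^(-k/2).\<close>

lemma gaussian_moment: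
  assumes s: "s > 0"
  shows "has_bochner_integral lborel (\<lambda>x. exp (- s * x\<^sup>2) * x ^ k)
     (sqrt (pi / s) * (gm k * (2 * s) powr (- real k / 2)))"
proof -
  let ?\<sigma> = "sqrt (1 / (2 * s))"
  have \<sigma>: "?\<sigma> > 0" using s by simp
  have \<sigma>k: "?\<sigma> ^ k = (2 * s) powr (- real k / 2)" using s by (intro sqrt_power_powr) simp
  have "has_bochner_integral lborel (\<lambda>x. normal_density 0 ?\<sigma> x * x ^ k) (gm k * ?\<sigma> ^ k)"
  proof (cases "even k")
    case True
    then obtain i where k: "k = 2 * i" by (elim evenE)
    have \<sigma>2: "?\<sigma>\<^sup>2 = 1 / (2 * s)" using s by simp
    have "2 / (1 / (2 * s)) = 2 * (2 * s)" by simp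
    then have four: "(2 / (1 / (2 * s))) ^ i = 2 ^ i * (2 * s) ^ i" by (simp only: power_mult_distrib)
    have "(fact (2 * i) / ((2 / ?\<sigma>\<^sup>2) ^ i * fact i) :: real) = gm k * ?\<sigma> ^ k"
      unfolding k power_mult \<sigma>2 four gm_def by (simp add: power_one_over)
    then show ?thesis using normal_moment_even[OF \<sigma>, of 0 i] by (simp add: k)
  next
    case False
    then obtain i where k: "k = 2 * i + 1" by (elim oddE)
    then show ?thesis using normal_moment_odd[OF \<sigma>, of 0 i] False by (simp add: gm_def)
  qed
  then have "has_bochner_integral lborel (\<lambda>x. sqrt (pi / s) * (normal_density 0 ?\<sigma> x * x ^ k))
      (sqrt (pi / s) * (gm k * ?\<sigma> ^ k))"
    by (rule has_bochner_integral_mult_right)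
  moreover have "sqrt (pi / s) * (normal_density 0 ?\<sigma> x * x ^ k) = exp (- s * x\<^sup>2) * x ^ k" for x
    unfolding normal_density_scaled[OF s, symmetric] by (simp only: mult_ac)
  ultimately show ?thesis unfolding \<sigma>k by simp
qed

lemma gaussian_abs_moment:
  assumes s: "s > 0"
  shows "has_bochner_integral lborel (\<lambda>x. exp (- s * x\<^sup>2) * \<bar>x\<bar> ^ k)
     (sqrt (pi / s) * (gabs k * (2 * s) powr (- real k / 2)))"
proof (cases "even k")
  case True
  then show ?thesis using gaussian_moment[OF s, of k] by (simp add: gabs_def power_even_abs)
next
  case False
  then obtain i where k: "k = 2 * i + 1" by (elim oddE)
  let ?\<sigma> = "sqrt (1 / (2 * s))"
  have \<sigma>: "?\<sigma> > 0" using s by simp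
  have \<sigma>k: "?\<sigma> ^ k = (2 * s) powr (- real k / 2)" using s by (intro sqrt_power_powr) simp
  have gab: "gabs k * ?\<sigma> ^ k = 2 ^ i * ?\<sigma> ^ k * fact i * sqrt (2 / pi)"
    by (simp add: gabs_def k)
  have "has_bochner_integral lborel (\<lambda>x. normal_density 0 ?\<sigma> x * \<bar>x\<bar> ^ k) (gabs k * ?\<sigma> ^ k)"
    using normal_moment_abs_odd[OF \<sigma>, of 0 i] unfolding k[symmetric] gab by simp
  then have "has_bochner_integral lborel (\<lambda>x. sqrt (pi / s) * (normal_density 0 ?\<sigma> x * \<bar>x\<bar> ^ k))
      (sqrt (pi / s) * (gabs k * ?\<sigma> ^ k))"
    by (rule has_bochner_integral_mult_right)
  moreover have "sqrt (pi / s) * (normal_density 0 ?\<sigma> x * \<bar>x\<bar> ^ k) = exp (- s * x\<^sup>2) * \<bar>x\<bar> ^ k" for x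
    unfolding normal_density_scaled[OF s, symmetric] by (simp only: mult_ac)
  ultimately show ?thesis unfolding \<sigma>k by simp
qed

interpretation lborel_prod: product_sigma_finite "\<lambda>_::nat. lborel :: real measure"
  by standard

abbreviation PL :: "nat set \<Rightarrow> (nat \<Rightarrow> real) measure" where
  "PL J \<equiv> Pi\<^sub>M J (\<lambda>_. lborel)"

text \<open>The factors \<open>g\<close> are left general so that one statement covers monomials and
  their absolute values. The even total degree 2r turns the collected power of 2s into
  (2s)^(-r).\<close>

lemma prod_moment:
  fixes g :: "nat \<Rightarrow> real \<Rightarrow> real" and c :: "nat \<Rightarrow> real"
  assumes J: "finite J" and s: "s > 0" and r: "(\<Sum>j\<in>J. \<alpha> j) = 2 * r"
    and g: "\<And>j. j \<in> J \<Longrightarrow> has_bochner_integral lborel (\<lambda>x. exp (- s * x\<^sup>2) * g j x)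
          (sqrt (pi / s) * (c j * (2 * s) powr (- real (\<alpha> j) / 2)))"
  shows "has_bochner_integral (PL J) (\<lambda>v. exp (- s * (\<Sum>j\<in>J. (v j)\<^sup>2)) * (\<Prod>j\<in>J. g j (v j)))
     (pi powr (real (card J) / 2) / 2 ^ r * (\<Prod>j\<in>J. c j) * s powr (- real (card J) / 2 - real r))"
proof -
  have eq: "exp (- s * (\<Sum>j\<in>J. (v j)\<^sup>2)) * (\<Prod>j\<in>J. g j (v j)) = (\<Prod>j\<in>J. exp (- s * (v j)\<^sup>2) * g j (v j))" for v
    using J by (simp add: prod.distrib exp_sum[symmetric] sum_distrib_left sum_negf)
  have "(\<Prod>j\<in>J. sqrt (pi / s) * (c j * (2 * s) powr (- real (\<alpha> j) / 2)))
     = sqrt (pi / s) ^ card J * (\<Prod>j\<in>J. c j) * (\<Prod>j\<in>J. (2 * s) powr (- real (\<alpha> j) / 2))"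
    by (simp add: prod.distrib)
  also have "(\<Prod>j\<in>J. (2 * s) powr (- real (\<alpha> j) / 2)) = (2 * s) powr (\<Sum>j\<in>J. - real (\<alpha> j) / 2)"
    using J s by (simp add: powr_sum)
  also have "(\<Sum>j\<in>J. - real (\<alpha> j) / 2) = - real (\<Sum>j\<in>J. \<alpha> j) / 2"
    by (simp add: sum_negf sum_divide_distrib)
  also have "\<dots> = - real r" by (simp add: r)
  also have "(2 * s) powr (- real r) = s powr (- real r) / 2 ^ r"
    using s by (simp add: powr_minus powr_realpow power_mult_distrib field_simps)
  also have "sqrt (pi / s) ^ card J = pi powr (real (card J) / 2) * s powr (- real (card J) / 2)"
  proof -
    have "sqrt (pi / s) ^ card J = sqrt pi ^ card J * sqrt (1 / s) ^ card J"
      by (simp add: real_sqrt_divide power_divide)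
    also have "sqrt pi ^ card J = pi powr (real (card J) / 2)"
      by (simp add: powr_half_sqrt[symmetric] powr_power)
    finally show ?thesis using sqrt_power_powr[OF s] by simp
  qed
  also have "pi powr (real (card J) / 2) * s powr (- real (card J) / 2) * (\<Prod>j\<in>J. c j) * (s powr (- real r) / 2 ^ r)
    = pi powr (real (card J) / 2) / 2 ^ r * (\<Prod>j\<in>J. c j) * s powr (- real (card J) / 2 - real r)"
  proof -
    have "s powr (- real (card J) / 2 - real r) = s powr (- real (card J) / 2) * s powr (- real r)"
      using powr_add[of s "- real (card J) / 2" "- real r"] by simp
    then show ?thesis by simp
  qed
  finally have val: "(\<Prod>j\<in>J. sqrt (pi / s) * (c j * (2 * s) powr (- real (\<alpha> j) / 2)))
    = pi powr (real (card J) / 2) / 2 ^ r * (\<Prod>j\<in>J. c j) * s powr (- real (card J) / 2 - real r)" .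
  have int: "integrable lborel (\<lambda>x. exp (- s * x\<^sup>2) * g j x)" if "j \<in> J" for j
    using g[OF that] by (rule integrable.intros)
  show ?thesis
    unfolding has_bochner_integral_iff eq val[symmetric]
  proof
    show "integrable (PL J) (\<lambda>v. \<Prod>j\<in>J. exp (- s * (v j)\<^sup>2) * g j (v j))"
      by (rule lborel_prod.product_integrable_prod[OF J int])
    have "(\<integral>v. (\<Prod>j\<in>J. exp (- s * (v j)\<^sup>2) * g j (v j)) \<partial>PL J)
       = (\<Prod>j\<in>J. \<integral>x. exp (- s * x\<^sup>2) * g j x \<partial>lborel)"
      by (rule lborel_prod.product_integral_prod[OF J int])
    also have "\<dots> = (\<Prod>j\<in>J. sqrt (pi / s) * (c j * (2 * s) powr (- real (\<alpha> j) / 2)))"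
      using g by (intro prod.cong refl has_bochner_integral_integral_eq)
    finally show "(\<integral>v. (\<Prod>j\<in>J. exp (- s * (v j)\<^sup>2) * g j (v j)) \<partial>PL J)
       = (\<Prod>j\<in>J. sqrt (pi / s) * (c j * (2 * s) powr (- real (\<alpha> j) / 2)))" .
  qed
qed

text \<open>Writing \<open>(b + q)\<^sup>-\<^sup>p\<close> as a Gamma mixture of the Gaussian weights \<open>exp (- s (b + q))\<close>
  reduces the moments to Gaussian ones.\<close>

lemma power_moment:
  assumes J: "finite J" and b: "b > 0" and a: "a > real (card J) / 2"
    and r: "(\<Sum>j\<in>J. \<alpha> j) = 2 * r"
  shows "has_bochner_integral (PL J)
     (\<lambda>v. (\<Prod>j\<in>J. v j ^ \<alpha> j) * (b + (\<Sum>j\<in>J. (v j)\<^sup>2)) powr (- (a + real r)))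
     (pi powr (real (card J) / 2) / 2 ^ r * (\<Prod>j\<in>J. gm (\<alpha> j)) * Gamma (a - real (card J) / 2)
       / b powr (a - real (card J) / 2) / Gamma (a + real r))"
proof -
  let ?m = "real (card J)"
  let ?q = "\<lambda>v. \<Sum>j\<in>J. (v j)\<^sup>2"
  let ?P = "\<lambda>v::nat\<Rightarrow>real. \<Prod>j\<in>J. v j ^ \<alpha> j"
  let ?H = "\<lambda>s::real. indicator {0<..} s * s powr (a + real r - 1) * exp (- s * b)"
  let ?F = "\<lambda>s v. ?H s * (exp (- s * ?q v) * ?P v)"
  have a0: "a > 0" "a + real r > 0" using a by (auto intro: le_less_trans[of 0 "?m / 2"] add_pos_nonneg)
  interpret P: sigma_finite_measure "PL J" by (rule lborel_prod.sigma_finite[OF J])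
  interpret pair_sigma_finite lborel "PL J" ..
  \<comment> \<open>The r in the Gamma exponent cancels against the s^(-r) of the Gaussian moment;
    the remaining integral over s is the same for every r.\<close>
  have HH: "?H s * (C * s powr (- ?m / 2 - real r))
      = C * (indicator {0<..} s * s powr ((a - ?m / 2) - 1) * exp (- s * b))" for s C
  proof (cases "s > 0")
    case True
    have "s powr (a + real r - 1) * s powr (- ?m / 2 - real r) = s powr ((a - ?m / 2) - 1)"
      using True by (simp flip: powr_add) (simp add: algebra_simps)
    moreover have "?H s * (C * s powr (- ?m / 2 - real r))
       = C * (indicator {0<..} s * (s powr (a + real r - 1) * s powr (- ?m / 2 - real r)) * exp (- s * b))"
      by (simp only: mult_ac)
    ultimately show ?thesis by (simp only:)
  qed (simp add: indicator_def)
  have mom: "has_bochner_integral (PL J) (\<lambda>v. exp (- s * ?q v) * ?P v)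
     (pi powr (?m / 2) / 2 ^ r * (\<Prod>j\<in>J. gm (\<alpha> j)) * s powr (- ?m / 2 - real r))" if "s > 0" for s
    by (rule prod_moment[OF J that r, of "\<lambda>j x. x ^ \<alpha> j" "\<lambda>j. gm (\<alpha> j)"]) (rule gaussian_moment[OF that])
  have absmom: "has_bochner_integral (PL J) (\<lambda>v. exp (- s * ?q v) * (\<Prod>j\<in>J. \<bar>v j\<bar> ^ \<alpha> j))
     (pi powr (?m / 2) / 2 ^ r * (\<Prod>j\<in>J. gabs (\<alpha> j)) * s powr (- ?m / 2 - real r))" if "s > 0" for s
    by (rule prod_moment[OF J that r, of "\<lambda>j x. \<bar>x\<bar> ^ \<alpha> j" "\<lambda>j. gabs (\<alpha> j)"]) (rule gaussian_abs_moment[OF that])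
  have Gam: "has_bochner_integral lborel (\<lambda>s. indicator {0<..} s * s powr ((a - ?m / 2) - 1) * exp (- s * b))
     (Gamma (a - ?m / 2) / b powr (a - ?m / 2))"
    using a b by (intro has_bochner_integral_Gamma) auto
  have inner: "(\<integral>v. ?F s v \<partial>PL J) = pi powr (?m / 2) / 2 ^ r * (\<Prod>j\<in>J. gm (\<alpha> j))
       * (indicator {0<..} s * s powr ((a - ?m / 2) - 1) * exp (- s * b))" for s
  proof (cases "s > 0")
    case True
    have "(\<integral>v. ?F s v \<partial>PL J) = ?H s * (\<integral>v. exp (- s * ?q v) * ?P v \<partial>PL J)" by simp
    also have "(\<integral>v. exp (- s * ?q v) * ?P v \<partial>PL J)
        = pi powr (?m / 2) / 2 ^ r * (\<Prod>j\<in>J. gm (\<alpha> j)) * s powr (- ?m / 2 - real r)"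
      by (rule has_bochner_integral_integral_eq[OF mom[OF True]])
    finally show ?thesis unfolding HH .
  qed simp
  have innernorm: "(\<integral>v. norm (?F s v) \<partial>PL J) = pi powr (?m / 2) / 2 ^ r * (\<Prod>j\<in>J. gabs (\<alpha> j))
       * (indicator {0<..} s * s powr ((a - ?m / 2) - 1) * exp (- s * b))" for s
  proof (cases "s > 0")
    case True
    have "(\<integral>v. norm (?F s v) \<partial>PL J) = (\<integral>v. ?H s * (exp (- s * ?q v) * (\<Prod>j\<in>J. \<bar>v j\<bar> ^ \<alpha> j)) \<partial>PL J)"
      by (intro Bochner_Integration.integral_cong refl) (simp add: abs_mult abs_prod power_abs)
    also have "\<dots> = ?H s * (\<integral>v. exp (- s * ?q v) * (\<Prod>j\<in>J. \<bar>v j\<bar> ^ \<alpha> j) \<partial>PL J)" by simp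
    also have "(\<integral>v. exp (- s * ?q v) * (\<Prod>j\<in>J. \<bar>v j\<bar> ^ \<alpha> j) \<partial>PL J)
        = pi powr (?m / 2) / 2 ^ r * (\<Prod>j\<in>J. gabs (\<alpha> j)) * s powr (- ?m / 2 - real r)"
      by (rule has_bochner_integral_integral_eq[OF absmom[OF True]])
    finally show ?thesis unfolding HH .
  qed simp
  \<comment> \<open>Integrating |F| first over v yields the same function of s with
    \<open>gabs\<close> in place of \<open>gm\<close>, a multiple of an integrable Gamma
    integrand.\<close>
  have int: "integrable (lborel \<Otimes>\<^sub>M PL J) (case_prod ?F)"
  proof (rule Fubini_integrable)
    show "case_prod ?F \<in> borel_measurable (lborel \<Otimes>\<^sub>M PL J)"
      by measurable
    show "integrable lborel (\<lambda>s. \<integral>v. norm (case_prod ?F (s, v)) \<partial>PL J)"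
      unfolding prod.case innernorm using integrable.intros[OF Gam] by (rule integrable_mult_right)
    show "AE s in lborel. integrable (PL J) (\<lambda>v. case_prod ?F (s, v))"
    proof (rule AE_I2)
      fix s :: real
      show "integrable (PL J) (\<lambda>v. case_prod ?F (s, v))"
      proof (cases "s > 0")
        case True
        show ?thesis unfolding prod.case
          by (intro integrable_mult_right integrable.intros[OF mom[OF True]])
      qed simp
    qed
  qed
  have outer: "(\<integral>s. ?F s v \<partial>lborel) = Gamma (a + real r) * (?P v * (b + ?q v) powr (- (a + real r)))" for v
  proof -
    have q: "b + ?q v > 0" using b by (intro add_pos_nonneg sum_nonneg) auto
    have e: "exp (- s * (b + ?q v)) = exp (- s * b) * exp (- s * ?q v)" for s
      unfolding distrib_left exp_add ..
    have "(\<integral>s. ?F s v \<partial>lborel) = (\<integral>s. ?P v * (indicator {0<..} s * s powr ((a + real r) - 1) * exp (- s * (b + ?q v))) \<partial>lborel)"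
      by (intro Bochner_Integration.integral_cong refl) (simp only: e mult_ac)
    also have "\<dots> = ?P v * (Gamma (a + real r) / (b + ?q v) powr (a + real r))"
      using has_bochner_integral_integral_eq[OF has_bochner_integral_Gamma[OF a0(2) q]] by simp
    also have "\<dots> = Gamma (a + real r) * (?P v * (b + ?q v) powr (- (a + real r)))"
      unfolding powr_minus divide_inverse by (simp only: mult_ac)
    finally show ?thesis .
  qed
  have G: "Gamma (a + real r) > 0" by (rule Gamma_real_pos[OF a0(2)])
  have "integrable (PL J) (\<lambda>v. \<integral>s. ?F s v \<partial>lborel)"
    by (rule integrable_snd[OF int])
  then have int2: "integrable (PL J) (\<lambda>v. ?P v * (b + ?q v) powr (- (a + real r)))"
    unfolding outer using G by simp
  have "(\<integral>v. (\<integral>s. ?F s v \<partial>lborel) \<partial>PL J) = (\<integral>s. (\<integral>v. ?F s v \<partial>PL J) \<partial>lborel)"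
    by (rule Fubini_integral[OF int])
  then have "Gamma (a + real r) * (\<integral>v. ?P v * (b + ?q v) powr (- (a + real r)) \<partial>PL J)
      = pi powr (?m / 2) / 2 ^ r * (\<Prod>j\<in>J. gm (\<alpha> j)) * (Gamma (a - ?m / 2) / b powr (a - ?m / 2))"
    unfolding outer inner using has_bochner_integral_integral_eq[OF Gam] by simp
  note Geq = this
  have gen: "x = y / g" if "g * x = y" "g > 0" for g x y :: real using that by auto
  have "(\<integral>v. ?P v * (b + ?q v) powr (- (a + real r)) \<partial>PL J)
      = pi powr (?m / 2) / 2 ^ r * (\<Prod>j\<in>J. gm (\<alpha> j)) * (Gamma (a - ?m / 2) / b powr (a - ?m / 2)) / Gamma (a + real r)"
    by (rule gen[OF Geq G])
  then show ?thesis unfolding has_bochner_integral_iff using int2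
    by (simp only: times_divide_eq_right simp_thms)
qed


section \<open>Weighted moments of the standardized t density\<close>

definition tdens :: "nat set \<Rightarrow> real \<Rightarrow> (nat \<Rightarrow> real) \<Rightarrow> real" where
  "tdens J \<nu> v = tconst \<nu> (card J) * (1 + (\<Sum>j\<in>J. (v j)\<^sup>2) / (\<nu> - 2)) powr (- (\<nu> + real (card J)) / 2)"

definition tw :: "nat set \<Rightarrow> real \<Rightarrow> (nat \<Rightarrow> real) \<Rightarrow> real" where
  "tw J \<nu> v = (\<nu> + real (card J)) / (\<nu> - 2 + (\<Sum>j\<in>J. (v j)\<^sup>2))"

text \<open>With b = \<nu> - 2, q = |v|^2 and a = (\<nu> + m)/2, the density is proportional to (b +
  q)^(-a) and W = 2a/(b + q), so W^r merely raises the exponent to a + r. The normalising constant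
  cancels everything except the Gamma ratio, and the 2^r in (2a)^r cancels the one of the Gaussian
  moment.\<close>

lemma t_expect:
  assumes J: "finite J" and \<nu>: "\<nu> > 2" and r: "(\<Sum>j\<in>J. \<alpha> j) = 2 * r"
  defines "a \<equiv> (\<nu> + real (card J)) / 2"
  shows "has_bochner_integral (PL J) (\<lambda>v. tw J \<nu> v ^ r * (\<Prod>j\<in>J. v j ^ \<alpha> j) * tdens J \<nu> v)
     (a ^ r * Gamma a / Gamma (a + real r) * (\<Prod>j\<in>J. gm (\<alpha> j)))"
proof -
  let ?m = "real (card J)"
  let ?q = "\<lambda>v. \<Sum>j\<in>J. (v j)\<^sup>2"
  define b where "b = \<nu> - 2"
  have b: "b > 0" using \<nu> by (simp add: b_def)
  have a: "a > ?m / 2" "a > 0" "a - ?m / 2 = \<nu> / 2" using \<nu> by (auto simp: a_def field_simps add_pos_nonneg)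
  \<comment> \<open>The factor b^a arises from rewriting 1 + q/b as (b + q)/b, and (2a)^r from the
    numerators of W^r.\<close>
  let ?C = "tconst \<nu> (card J) * b powr a * (2 * a) ^ r"
  have eq: "tw J \<nu> v ^ r * (\<Prod>j\<in>J. v j ^ \<alpha> j) * tdens J \<nu> v
     = ?C * ((\<Prod>j\<in>J. v j ^ \<alpha> j) * (b + ?q v) powr (- (a + real r)))" for v
  proof -
    have q: "b + ?q v > 0" using b by (intro add_pos_nonneg sum_nonneg) auto
    have e1: "(1 + ?q v / b) powr (- a) = b powr a * (b + ?q v) powr (- a)"
    proof -
      have "1 + ?q v / b = (b + ?q v) / b" using b by (simp add: field_simps)
      then have "(1 + ?q v / b) powr (- a) = (b + ?q v) powr (- a) / b powr (- a)"
        using b q by (simp add: powr_divide)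
      then show ?thesis by (simp add: powr_minus_divide)
    qed
    have e2: "(b + ?q v) powr (- (a + real r)) = (b + ?q v) powr (- a) / (b + ?q v) ^ r"
      using q powr_add[of "b + ?q v" "- a" "- real r"] by (simp add: powr_minus powr_realpow divide_inverse)
    have e3: "- (\<nu> + ?m) / 2 = - a" "\<nu> + ?m = 2 * a" by (simp_all add: a_def field_simps)
    show ?thesis unfolding tdens_def tw_def b_def[symmetric] e3 e2 by (simp add: power_divide e1)
  qed
  have "has_bochner_integral (PL J) (\<lambda>v. ?C * ((\<Prod>j\<in>J. v j ^ \<alpha> j) * (b + ?q v) powr (- (a + real r))))
     (?C * (pi powr (?m / 2) / 2 ^ r * (\<Prod>j\<in>J. gm (\<alpha> j)) * Gamma (a - ?m / 2)
       / b powr (a - ?m / 2) / Gamma (a + real r)))"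
    by (intro has_bochner_integral_mult_right power_moment[OF J b a(1) r])
  moreover have "?C * (pi powr (?m / 2) / 2 ^ r * (\<Prod>j\<in>J. gm (\<alpha> j)) * Gamma (a - ?m / 2)
       / b powr (a - ?m / 2) / Gamma (a + real r)) = a ^ r * Gamma a / Gamma (a + real r) * (\<Prod>j\<in>J. gm (\<alpha> j))"
  proof -
    have g: "Gamma (\<nu> / 2) \<noteq> 0" "Gamma (a + real r) \<noteq> 0"
      using \<nu> a by (simp_all add: Gamma_real_pos[THEN less_imp_neq, symmetric] add_pos_nonneg)
    have t: "tconst \<nu> (card J) = Gamma a / Gamma (\<nu> / 2) / (b powr (?m / 2) * pi powr (?m / 2))"
      unfolding tconst_def b_def[symmetric] a_def[symmetric] using b by (simp add: powr_mult powr_minus_divide)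
    have p: "b powr a = b powr (?m / 2) * b powr (\<nu> / 2)"
      unfolding powr_add[symmetric] by (simp add: a_def add_divide_distrib add.commute)
    have nz: "b powr (?m / 2) \<noteq> 0" "b powr (\<nu> / 2) \<noteq> 0" "pi powr (?m / 2) \<noteq> 0" using b by auto
    have alg: "G / g / (x * p) * (x * y) * (2 * a) ^ r * (p / 2 ^ r * P * g / y / h) = a ^ r * G / h * P"
      if "g \<noteq> 0" "x \<noteq> 0" "y \<noteq> 0" "p \<noteq> 0" for G g x y p P h :: real
      using that by (simp add: power_mult_distrib)
    show ?thesis unfolding a(3) t p by (rule alg) (use g nz in auto)
  qed
  ultimately show ?thesis unfolding eq by simp
qed

lemma t_density:
  assumes "finite J" "\<nu> > 2" shows "has_bochner_integral (PL J) (tdens J \<nu>) 1"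
proof -
  have "Gamma ((\<nu> + real (card J)) / 2) > 0" using assms by (intro Gamma_real_pos) (simp add: add_pos_nonneg)
  then show ?thesis using t_expect[OF assms, of "\<lambda>_. 0" 0] by (simp add: gm_values)
qed

lemma prod_power_indicator:
  fixes v :: "nat \<Rightarrow> real"
  assumes "finite J" "i \<in> J" shows "(\<Prod>x\<in>J. v x ^ (if x = i then 1 else 0)) = v i"
proof -
  have "(\<Prod>x\<in>J. v x ^ (if x = i then 1 else 0)) = (\<Prod>x\<in>J. if x = i then v x else 1)"
    by (intro prod.cong refl) auto
  then show ?thesis using assms by simp
qed

definition kd :: "nat \<Rightarrow> nat \<Rightarrow> real" where "kd i j = (if i = j then 1 else 0)"

text \<open>The case r = 1, where a Gamma(a)/Gamma(a + 1) = 1. The exponent of a coordinate counts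
  how often it occurs among i and j.\<close>

lemma t_second_moment:
  assumes J: "finite J" and \<nu>: "\<nu> > 2" and i: "i \<in> J" and j: "j \<in> J"
  shows "has_bochner_integral (PL J) (\<lambda>v. tw J \<nu> v * (v i * v j) * tdens J \<nu> v) (kd i j)"
proof -
  let ?e = "\<lambda>i x. (if x = i then 1 else 0 :: nat)"
  let ?\<alpha> = "\<lambda>x. ?e i x + ?e j x"
  define a where "a = (\<nu> + real (card J)) / 2"
  have a: "a > 0" using \<nu> by (simp add: a_def add_pos_nonneg)
  have sum: "(\<Sum>x\<in>J. ?\<alpha> x) = 2 * 1" using J i j by (simp add: sum.distrib)
  have prod: "(\<Prod>x\<in>J. v x ^ ?\<alpha> x) = v i * v j" for v :: "nat \<Rightarrow> real"
    unfolding power_add prod.distrib using J i j by (simp only: prod_power_indicator)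
  have gm: "(\<Prod>x\<in>J. gm (?\<alpha> x)) = kd i j"
  proof (cases "i = j")
    case True
    then have "(\<Prod>x\<in>J. gm (?\<alpha> x)) = (\<Prod>x\<in>J. 1)"
      by (intro prod.cong refl) (auto simp: gm_values numeral_2_eq_2[symmetric])
    then show ?thesis using True by (simp add: kd_def)
  next
    case False
    then have "(\<Prod>x\<in>J. gm (?\<alpha> x)) = 0" using J i by (intro prod_zero bexI[of _ i]) (auto simp: gm_values)
    then show ?thesis using False by (simp add: kd_def)
  qed
  have "Gamma (a + 1) = a * Gamma a" using a by (intro Gamma_plus1) (auto elim!: nonpos_Ints_cases)
  moreover have "Gamma a \<noteq> 0" using Gamma_real_pos[OF a] by linarith
  ultimately have "a ^ 1 * Gamma a / Gamma (a + real 1) * kd i j = kd i j" using a by simp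
  then show ?thesis using t_expect[OF J \<nu> sum] unfolding prod gm a_def[symmetric] by simp
qed

text \<open>The case r = 2: the Gamma ratio is a/(a + 1) = \<phi>, and the remaining factor is
  Isserlis' formula for a standard normal vector.\<close>

lemma t_fourth_moment:
  assumes J: "finite J" and \<nu>: "\<nu> > 2" and i: "i \<in> J" and j: "j \<in> J" and k: "k \<in> J" and l: "l \<in> J"
  shows "has_bochner_integral (PL J) (\<lambda>v. tw J \<nu> v ^ 2 * (v i * v j * v k * v l) * tdens J \<nu> v)
     ((\<nu> + real (card J)) / (\<nu> + real (card J) + 2) * (kd i j * kd k l + kd i k * kd j l + kd i l * kd j k))"
proof -
  let ?e = "\<lambda>i x. (if x = i then 1 else 0 :: nat)"
  let ?\<alpha> = "\<lambda>x. ?e i x + ?e j x + ?e k x + ?e l x"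
  define a where "a = (\<nu> + real (card J)) / 2"
  have a: "a > 0" using \<nu> by (simp add: a_def add_pos_nonneg)
  have sum: "(\<Sum>x\<in>J. ?\<alpha> x) = 2 * 2" using J i j k l by (simp add: sum.distrib)
  have prod: "(\<Prod>x\<in>J. v x ^ ?\<alpha> x) = v i * v j * v k * v l" for v :: "nat \<Rightarrow> real"
    unfolding power_add prod.distrib using J i j k l by (simp only: prod_power_indicator)
  \<comment> \<open>The product is 3 if all four indices coincide, 1 if they form two distinct
    pairs, and 0 as soon as an index occurs an odd number of times; the cases run through the
    coincidence patterns.\<close>
  have gm: "(\<Prod>x\<in>J. gm (?\<alpha> x)) = kd i j * kd k l + kd i k * kd j l + kd i l * kd j k"
  proof -
    have vals: "gm (Suc (Suc 0)) = 1" "gm (Suc (Suc (Suc 0))) = 0" "gm (Suc (Suc (Suc (Suc 0)))) = 3"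
      using gm_values by (simp_all add: eval_nat_numeral)
    have zero: "(\<Prod>x\<in>J. gm (?\<alpha> x)) = 0" if "x \<in> J" "gm (?\<alpha> x) = 0" for x
      by (rule prod_zero[OF J]) (rule bexI[of _ x], rule that(2), rule that(1))
    have one: "(\<Prod>x\<in>J. gm (?\<alpha> x)) = 1" if "\<And>x. gm (?\<alpha> x) = 1"
      by (simp only: that prod.neutral_const)
    show ?thesis
    proof (cases "i = j")
      case ij: True
      show ?thesis
      proof (cases "k = l")
        case kl: True
        show ?thesis
        proof (cases "i = k")
          case True
          then have "(\<Prod>x\<in>J. gm (?\<alpha> x)) = (\<Prod>x\<in>J. if x = i then 3 else 1)"
            using ij kl by (intro prod.cong refl) (auto simp: gm_values vals)
          also have "\<dots> = 3" using J i by simp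
          finally show ?thesis using True ij kl by (simp only: kd_def) simp
        next
          case False
          then have "(\<Prod>x\<in>J. gm (?\<alpha> x)) = 1" using ij kl by (intro one) (auto simp: gm_values vals)
          show ?thesis unfolding \<open>(\<Prod>x\<in>J. gm (?\<alpha> x)) = 1\<close> using False ij kl by (simp add: kd_def)
        qed
      next
        case kl: False
        show ?thesis
        proof (cases "k = i")
          case True
          then have "gm (?\<alpha> l) = 0" using kl ij by (simp add: gm_values)
          show ?thesis unfolding zero[OF l \<open>gm (?\<alpha> l) = 0\<close>] using True kl ij by (simp add: kd_def)
        next
          case False
          then have "gm (?\<alpha> k) = 0" using kl ij by (simp add: gm_values)
          show ?thesis unfolding zero[OF k \<open>gm (?\<alpha> k) = 0\<close>] using False kl ij by (simp add: kd_def)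
        qed
      qed
    next
      case ij: False
      show ?thesis
      proof (cases "i = k")
        case ik: True
        show ?thesis
        proof (cases "j = l")
          case True
          then have "(\<Prod>x\<in>J. gm (?\<alpha> x)) = 1" using ij ik by (intro one) (auto simp: gm_values vals)
          show ?thesis unfolding \<open>(\<Prod>x\<in>J. gm (?\<alpha> x)) = 1\<close> using True ij ik by (simp add: kd_def)
        next
          case False
          then have "gm (?\<alpha> j) = 0" using ij ik by (simp add: gm_values)
          show ?thesis unfolding zero[OF j \<open>gm (?\<alpha> j) = 0\<close>] using False ij ik by (simp add: kd_def)
        qed
      next
        case ik: False
        show ?thesis
        proof (cases "i = l")
          case il: True
          show ?thesis
          proof (cases "j = k")
            case True
            then have "(\<Prod>x\<in>J. gm (?\<alpha> x)) = 1" using ij il by (intro one) (auto simp: gm_values vals)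
            show ?thesis unfolding \<open>(\<Prod>x\<in>J. gm (?\<alpha> x)) = 1\<close> using True ij il by (simp add: kd_def)
          next
            case False
            then have "gm (?\<alpha> j) = 0" using ij il by (simp add: gm_values)
            show ?thesis unfolding zero[OF j \<open>gm (?\<alpha> j) = 0\<close>] using False ij il by (simp add: kd_def)
          qed
        next
          case False
          then have "gm (?\<alpha> i) = 0" using ij ik by (simp add: gm_values)
          show ?thesis unfolding zero[OF i \<open>gm (?\<alpha> i) = 0\<close>] using False ij ik by (simp add: kd_def)
        qed
      qed
    qed
  qed
  have "Gamma (a + 1) = a * Gamma a" using a by (intro Gamma_plus1) (auto elim!: nonpos_Ints_cases)
  moreover have "Gamma (a + 1 + 1) = (a + 1) * Gamma (a + 1)"
    using a by (intro Gamma_plus1) (auto elim!: nonpos_Ints_cases)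
  ultimately have G: "Gamma (a + real 2) = (a + 1) * (a * Gamma a)" by (simp add: add.assoc)
  have "Gamma a \<noteq> 0" using Gamma_real_pos[OF a] by linarith
  then have "a ^ 2 * Gamma a / Gamma (a + real 2) = a / (a + 1)"
    unfolding G using a by (simp add: power2_eq_square)
  also have "\<dots> = (\<nu> + real (card J)) / (\<nu> + real (card J) + 2)"
    using \<nu> by (simp add: a_def field_simps)
  finally show ?thesis using t_expect[OF J \<nu> sum] unfolding prod gm a_def[symmetric] by simp
qed

section \<open>Integrals over disjoint blocks of coordinates\<close>

text \<open>Independence as Fubini's theorem. The invariance under \<open>restrict\<close> says that
  f and g depend only on their own coordinates, so both can be read off a merged point.\<close>

lemma PL_product:
  fixes f g :: "(nat \<Rightarrow> real) \<Rightarrow> real"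
  assumes I: "finite I" and J: "finite J" and IJ: "I \<inter> J = {}"
    and f: "has_bochner_integral (PL I) f x" and g: "has_bochner_integral (PL J) g y"
    and fI: "\<And>v. f (restrict v I) = f v" and gJ: "\<And>v. g (restrict v J) = g v"
  shows "has_bochner_integral (PL (I \<union> J)) (\<lambda>v. f v * g v) (x * y)"
proof -
  interpret P: sigma_finite_measure "PL I" by (rule lborel_prod.sigma_finite[OF I])
  interpret P': sigma_finite_measure "PL J" by (rule lborel_prod.sigma_finite[OF J])
  interpret pair_sigma_finite "PL I" "PL J" ..
  have fi: "integrable (PL I) f" "integral\<^sup>L (PL I) f = x" using f by (auto simp: has_bochner_integral_iff)
  have gi: "integrable (PL J) g" "integral\<^sup>L (PL J) g = y" using g by (auto simp: has_bochner_integral_iff)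
  have [measurable]: "f \<in> borel_measurable (PL I)" "g \<in> borel_measurable (PL J)"
    using fi gi by auto
  have meas: "(\<lambda>v. f v * g v) \<in> borel_measurable (PL (I \<union> J))"
  proof -
    have "(\<lambda>v. f (restrict v I) * g (restrict v J)) \<in> borel_measurable (PL (I \<union> J))"
      by measurable
    then show ?thesis by (simp add: fI gJ)
  qed
  have mer: "f (merge I J (u, w)) * g (merge I J (u, w)) = f u * g w" for u w
  proof -
    have "restrict (merge I J (u, w)) I = restrict u I" "restrict (merge I J (u, w)) J = restrict w J"
      using IJ by (auto simp: restrict_def merge_def fun_eq_iff)
    then show ?thesis using fI[of "merge I J (u, w)"] gJ[of "merge I J (u, w)"] fI[of u] gJ[of w] by simp
  qed
  have "integrable (PL I \<Otimes>\<^sub>M PL J) (\<lambda>(u, w). f u * g w)"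
  proof (rule Fubini_integrable)
    show "(\<lambda>(u, w). f u * g w) \<in> borel_measurable (PL I \<Otimes>\<^sub>M PL J)" by measurable
    show "integrable (PL I) (\<lambda>u. \<integral>w. norm (case (u, w) of (u, w) \<Rightarrow> f u * g w) \<partial>PL J)"
      using fi(1) by (simp add: abs_mult)
    show "AE u in PL I. integrable (PL J) (\<lambda>w. case (u, w) of (u, w) \<Rightarrow> f u * g w)"
      using gi(1) by simp
  qed
  then have "integrable (PL I \<Otimes>\<^sub>M PL J) (\<lambda>p. f (merge I J p) * g (merge I J p))"
    by (rule Bochner_Integration.integrable_cong[THEN iffD1, rotated 2]) (auto simp: mer)
  then have "integrable (distr (PL I \<Otimes>\<^sub>M PL J) (PL (I \<union> J)) (merge I J)) (\<lambda>v. f v * g v)"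
    by (subst integrable_distr_eq[OF measurable_merge meas])
  then have int: "integrable (PL (I \<union> J)) (\<lambda>v. f v * g v)"
    unfolding lborel_prod.distr_merge[OF IJ I J] .
  have "(\<integral>v. f v * g v \<partial>PL (I \<union> J)) = (\<integral>u. (\<integral>w. f (merge I J (u, w)) * g (merge I J (u, w)) \<partial>PL J) \<partial>PL I)"
    by (rule lborel_prod.product_integral_fold[OF IJ I J int])
  also have "\<dots> = x * y" unfolding mer by (simp add: fi(2) gi(2))
  finally show ?thesis using int by (simp add: has_bochner_integral_iff)
qed

lemma PL_blocks:
  fixes h :: "nat \<Rightarrow> (nat \<Rightarrow> real) \<Rightarrow> real"
  assumes fin: "\<And>b. b < N \<Longrightarrow> finite (J b)"
    and disj: "\<And>b c. b < N \<Longrightarrow> c < N \<Longrightarrow> b \<noteq> c \<Longrightarrow> J b \<inter> J c = {}"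
    and h: "\<And>b. b < N \<Longrightarrow> has_bochner_integral (PL (J b)) (h b) (x b)"
    and dep: "\<And>b v. b < N \<Longrightarrow> h b (restrict v (J b)) = h b v"
  shows "has_bochner_integral (PL (\<Union>b<N. J b)) (\<lambda>v. \<Prod>b<N. h b v) (\<Prod>b<N. x b)"
  using assms
proof (induction N)
  case 0
  \<comment> \<open>The empty product measure is a point mass of total mass 1, matching the empty
    product of values.\<close>
  interpret finite_measure "PL {}" by rule (simp add: space_PiM)
  show ?case by (simp add: has_bochner_integral_iff space_PiM measure_def)
next
  case (Suc N)
  have "has_bochner_integral (PL ((\<Union>b<N. J b) \<union> J N)) (\<lambda>v. (\<Prod>b<N. h b v) * h N v) ((\<Prod>b<N. x b) * x N)"
  proof (rule PL_product)
    show "has_bochner_integral (PL (\<Union>b<N. J b)) (\<lambda>v. \<Prod>b<N. h b v) (\<Prod>b<N. x b)"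
      using Suc.prems by (intro Suc.IH) auto
    show "h N (restrict v (J N)) = h N v" for v by (rule Suc.prems(4)) simp
    show "(\<Union>b<N. J b) \<inter> J N = {}"
    proof (rule equals0I)
      fix x assume "x \<in> (\<Union>b<N. J b) \<inter> J N"
      then obtain b where "b < N" "x \<in> J b \<inter> J N" by auto
      then show False using Suc.prems(2)[of b N] by auto
    qed
    fix v
    show "(\<Prod>b<N. h b (restrict v (\<Union>b<N. J b))) = (\<Prod>b<N. h b v)"
    proof (intro prod.cong refl)
      fix b assume b: "b \<in> {..<N}"
      have "restrict (restrict v (\<Union>b<N. J b)) (J b) = restrict v (J b)"
        using b by (auto simp: restrict_def fun_eq_iff)
      then show "h b (restrict v (\<Union>b<N. J b)) = h b v"
        using Suc.prems(4)[of b "restrict v (\<Union>b<N. J b)"] Suc.prems(4)[of b v] b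
        by (metis lessThan_iff less_SucI)
    qed
  qed (use Suc.prems in auto)
  moreover have "(\<Union>b<Suc N. J b) = (\<Union>b<N. J b) \<union> J N" by (auto simp: less_Suc_eq)
  ultimately show ?case by simp
qed

section \<open>The information matrix\<close>

definition tE :: "nat set \<Rightarrow> real \<Rightarrow> nat \<Rightarrow> nat \<Rightarrow> (nat \<Rightarrow> real) \<Rightarrow> real" where
  "tE J \<nu> a b v = tw J \<nu> v * (v a * v b) - kd a b"

text \<open>Arbitrary weights allow one covariance formula for both kinds of block: rank one weights
  built from A^(-1/2) for V_0, multiples of the identity for V_k.\<close>

definition tL :: "nat set \<Rightarrow> real \<Rightarrow> rmat \<Rightarrow> (nat \<Rightarrow> real) \<Rightarrow> real" where
  "tL J \<nu> w v = (\<Sum>a\<in>J. \<Sum>b\<in>J. w a b * tE J \<nu> a b v)"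

lemma tw_restrict: "tw J \<nu> (restrict v J) = tw J \<nu> v"
  by (simp add: tw_def)

lemma tdens_restrict: "tdens J \<nu> (restrict v J) = tdens J \<nu> v"
  by (simp add: tdens_def)

lemma tL_restrict: "tL J \<nu> w (restrict v J) = tL J \<nu> w v"
  by (simp add: tL_def tE_def tw_restrict)

lemma tE_mean:
  assumes "finite J" "\<nu> > 2" "a \<in> J" "b \<in> J"
  shows "has_bochner_integral (PL J) (\<lambda>v. tE J \<nu> a b v * tdens J \<nu> v) 0"
proof -
  have "has_bochner_integral (PL J) (\<lambda>v. tw J \<nu> v * (v a * v b) * tdens J \<nu> v - kd a b * tdens J \<nu> v)
      (kd a b - kd a b * 1)"
    by (intro has_bochner_integral_diff has_bochner_integral_mult_right t_second_moment t_density assms)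
  then show ?thesis by (simp add: tE_def left_diff_distrib)
qed

lemma tE_cov:
  assumes J: "finite J" "\<nu> > 2" and abcd: "a \<in> J" "b \<in> J" "c \<in> J" "d \<in> J"
  defines "\<phi> \<equiv> (\<nu> + real (card J)) / (\<nu> + real (card J) + 2)"
  shows "has_bochner_integral (PL J) (\<lambda>v. tE J \<nu> a b v * tE J \<nu> c d v * tdens J \<nu> v)
     (\<phi> * (kd a b * kd c d + kd a c * kd b d + kd a d * kd b c) - kd a b * kd c d)"
proof -
  have "has_bochner_integral (PL J) (\<lambda>v. tw J \<nu> v ^ 2 * (v a * v b * v c * v d) * tdens J \<nu> v
        - kd c d * (tw J \<nu> v * (v a * v b) * tdens J \<nu> v)
        - kd a b * (tw J \<nu> v * (v c * v d) * tdens J \<nu> v) + kd a b * kd c d * tdens J \<nu> v)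
      (\<phi> * (kd a b * kd c d + kd a c * kd b d + kd a d * kd b c) - kd c d * kd a b - kd a b * kd c d + kd a b * kd c d * 1)"
    unfolding \<phi>_def
    by (intro has_bochner_integral_add has_bochner_integral_diff has_bochner_integral_mult_right
        t_second_moment t_fourth_moment t_density J abcd)
  moreover have "tw J \<nu> v ^ 2 * (v a * v b * v c * v d) * tdens J \<nu> v
        - kd c d * (tw J \<nu> v * (v a * v b) * tdens J \<nu> v)
        - kd a b * (tw J \<nu> v * (v c * v d) * tdens J \<nu> v) + kd a b * kd c d * tdens J \<nu> v
     = tE J \<nu> a b v * tE J \<nu> c d v * tdens J \<nu> v" for v
    by (simp add: tE_def algebra_simps power2_eq_square)
  ultimately show ?thesis by (simp add: algebra_simps)
qed

lemma tL_mean: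
  assumes "finite J" "\<nu> > 2"
  shows "has_bochner_integral (PL J) (\<lambda>v. tL J \<nu> w v * tdens J \<nu> v) 0"
proof -
  have "has_bochner_integral (PL J) (\<lambda>v. \<Sum>a\<in>J. \<Sum>b\<in>J. w a b * (tE J \<nu> a b v * tdens J \<nu> v)) (\<Sum>a\<in>J. \<Sum>b\<in>J. w a b * 0)"
    by (intro has_bochner_integral_sum has_bochner_integral_mult_right tE_mean assms)
  then show ?thesis by (simp add: tL_def sum_distrib_right mult.assoc)
qed

lemma kd_sum: "finite J \<Longrightarrow> a \<in> J \<Longrightarrow> (\<Sum>b\<in>J. f b * kd a b) = f a"
  by (simp add: kd_def if_distrib[of "\<lambda>x. _ * x"] cong: if_cong)

text \<open>The three pairings contribute tr(w) tr(u), tr(w u') and tr(w u), each times \<phi>; the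
  subtracted tr(w) tr(u) is due to the centring.\<close>

lemma tL_cov:
  assumes J: "finite J" "\<nu> > 2"
  defines "\<phi> \<equiv> (\<nu> + real (card J)) / (\<nu> + real (card J) + 2)"
  shows "has_bochner_integral (PL J) (\<lambda>v. tL J \<nu> w v * tL J \<nu> u v * tdens J \<nu> v)
     (\<phi> * ((\<Sum>a\<in>J. w a a) * (\<Sum>c\<in>J. u c c) + (\<Sum>a\<in>J. \<Sum>b\<in>J. w a b * u a b) + (\<Sum>a\<in>J. \<Sum>b\<in>J. w a b * u b a))
       - (\<Sum>a\<in>J. w a a) * (\<Sum>c\<in>J. u c c))"
proof -
  let ?S = "\<lambda>f. \<Sum>a\<in>J. \<Sum>b\<in>J. \<Sum>c\<in>J. \<Sum>d\<in>J. w a b * u c d * f a b c d"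
  have "has_bochner_integral (PL J) (\<lambda>v. ?S (\<lambda>a b c d. tE J \<nu> a b v * tE J \<nu> c d v * tdens J \<nu> v))
     (?S (\<lambda>a b c d. \<phi> * (kd a b * kd c d + kd a c * kd b d + kd a d * kd b c) - kd a b * kd c d))"
    unfolding \<phi>_def by (intro has_bochner_integral_sum has_bochner_integral_mult_right tE_cov J)
  moreover have "?S (\<lambda>a b c d. tE J \<nu> a b v * tE J \<nu> c d v * tdens J \<nu> v) = tL J \<nu> w v * tL J \<nu> u v * tdens J \<nu> v" for v
  proof -
    have "tL J \<nu> w v * tL J \<nu> u v * tdens J \<nu> v
       = (\<Sum>a\<in>J. \<Sum>b\<in>J. w a b * tE J \<nu> a b v * (tL J \<nu> u v * tdens J \<nu> v))"
      by (simp add: tL_def[of J \<nu> w] sum_distrib_right mult.assoc)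
    also have "\<dots> = ?S (\<lambda>a b c d. tE J \<nu> a b v * tE J \<nu> c d v * tdens J \<nu> v)"
      unfolding tL_def[of J \<nu> u] sum_distrib_left sum_distrib_right
      by (intro sum.cong refl) (simp only: mult_ac)
    finally show ?thesis by (rule sym)
  qed
  moreover have "?S (\<lambda>a b c d. \<phi> * (kd a b * kd c d + kd a c * kd b d + kd a d * kd b c) - kd a b * kd c d)
     = \<phi> * (?S (\<lambda>a b c d. kd a b * kd c d) + ?S (\<lambda>a b c d. kd a c * kd b d) + ?S (\<lambda>a b c d. kd a d * kd b c))
       - ?S (\<lambda>a b c d. kd a b * kd c d)"
    unfolding sum_distrib_left sum.distrib[symmetric] sum_subtractf[symmetric]
    by (intro sum.cong refl) (simp add: algebra_simps)
  moreover have "?S (\<lambda>a b c d. kd a b * kd c d) = (\<Sum>a\<in>J. w a a) * (\<Sum>c\<in>J. u c c)"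
  proof -
    have "?S (\<lambda>a b c d. kd a b * kd c d) = (\<Sum>a\<in>J. \<Sum>b\<in>J. (w a b * (\<Sum>c\<in>J. \<Sum>d\<in>J. u c d * kd c d)) * kd a b)"
      unfolding sum_distrib_left sum_distrib_right by (intro sum.cong refl) (simp only: mult_ac)
    also have "\<dots> = (\<Sum>a\<in>J. w a a * (\<Sum>c\<in>J. u c c))" using J by (simp add: kd_sum)
    finally show ?thesis by (simp add: sum_distrib_right)
  qed
  moreover have "?S (\<lambda>a b c d. kd a c * kd b d) = (\<Sum>a\<in>J. \<Sum>b\<in>J. w a b * u a b)"
  proof (intro sum.cong refl)
    fix a b assume ab: "a \<in> J" "b \<in> J"
    have "(\<Sum>c\<in>J. \<Sum>d\<in>J. w a b * u c d * (kd a c * kd b d)) = (\<Sum>c\<in>J. (\<Sum>d\<in>J. (w a b * u c d) * kd b d) * kd a c)"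
      unfolding sum_distrib_right by (intro sum.cong refl) (simp only: mult_ac)
    then show "(\<Sum>c\<in>J. \<Sum>d\<in>J. w a b * u c d * (kd a c * kd b d)) = w a b * u a b"
      using J ab by (simp add: kd_sum)
  qed
  moreover have "?S (\<lambda>a b c d. kd a d * kd b c) = (\<Sum>a\<in>J. \<Sum>b\<in>J. w a b * u b a)"
  proof (intro sum.cong refl)
    fix a b assume ab: "a \<in> J" "b \<in> J"
    have "(\<Sum>c\<in>J. \<Sum>d\<in>J. w a b * u c d * (kd a d * kd b c)) = (\<Sum>c\<in>J. (\<Sum>d\<in>J. (w a b * u c d) * kd a d) * kd b c)"
      unfolding sum_distrib_right by (intro sum.cong refl) (simp only: mult_ac)
    then show "(\<Sum>c\<in>J. \<Sum>d\<in>J. w a b * u c d * (kd a d * kd b c)) = w a b * u b a"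
      using J ab by (simp add: kd_sum)
  qed
  ultimately show ?thesis by simp
qed

context t_setting
begin

text \<open>Block 0 carries the coordinates of \<open>V\<^sub>0\<close>, block \<open>Suc k\<close> those of \<open>V\<^sub>k\<close>.\<close>

definition Jb :: "nat \<Rightarrow> nat set" where
  "Jb b = (case b of 0 \<Rightarrow> {..<K} | Suc k \<Rightarrow> (\<lambda>i. col k i) ` {..<nb k - 1})"

definition nub :: "nat \<Rightarrow> real" where
  "nub b = (case b of 0 \<Rightarrow> \<nu>0 | Suc k \<Rightarrow> \<nu> k)"

lemma Jb_finite: "finite (Jb b)"
  by (cases b) (auto simp: Jb_def)

lemma Jb_card: "card (Jb 0) = K" "card (Jb (Suc k)) = nb k - 1"
  by (auto simp: Jb_def card_image inj_on_def)

lemma sum_Jb: "sum f (Jb 0) = sum f {..<K}" "sum f (Jb (Suc k)) = (\<Sum>i<nb k - 1. f (col k i))"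
  by (auto simp: Jb_def sum.reindex inj_on_def)

lemma nub_gt: "b < Suc K \<Longrightarrow> nub b > 2"
  using nu0 nu by (cases b) (auto simp: nub_def)

lemma Jb_disjoint: "b \<noteq> c \<Longrightarrow> Jb b \<inter> Jb c = {}"
proof -
  have 1: "Jb 0 \<inter> Jb (Suc k) = {}" for k by (auto simp: Jb_def)
  have 2: "Jb (Suc k) \<inter> Jb (Suc l) = {}" if "k \<noteq> l" for k l
    using that in_col[of _ k l] in_col[of _ l l] unfolding Jb_def by fastforce
  assume "b \<noteq> c"
  then show ?thesis using 1 2 by (cases b; cases c) (auto simp: Int_commute)
qed

lemma Jb_union: "(\<Union>b<Suc K. Jb b) = {..<n}"
proof
  show "(\<Union>b<Suc K. Jb b) \<subseteq> {..<n}"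
  proof
    fix c assume "c \<in> (\<Union>b<Suc K. Jb b)"
    then obtain b where b: "b < Suc K" "c \<in> Jb b" by auto
    then show "c \<in> {..<n}" using K_le_n col_less by (cases b) (auto simp: Jb_def)
  qed
  show "{..<n} \<subseteq> (\<Union>b<Suc K. Jb b)"
  proof
    fix c assume "c \<in> {..<n}"
    then have "c < n" by simp
    then show "c \<in> (\<Union>b<Suc K. Jb b)"
    proof (cases rule: col_cases)
      case 1 then show ?thesis by (intro UN_I[of 0]) (auto simp: Jb_def)
    next
      case (2 k i) then show ?thesis by (intro UN_I[of "Suc k"]) (auto simp: Jb_def)
    qed
  qed
qed

lemma fV_blocks: "fV K nb \<nu>0 \<nu> v = (\<Prod>b<Suc K. tdens (Jb b) (nub b) v)"
  unfolding prod.lessThan_Suc_shift fV_def tstd_density_mid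
  by (simp add: tdens_def sum_Jb Jb_card nub_def del: of_nat_diff)

section \<open>Expectations under the density of V\<close>

lemma fV_expect:
  assumes f: "\<And>b. b < Suc K \<Longrightarrow> has_bochner_integral (PL (Jb b)) (\<lambda>v. f b v * tdens (Jb b) (nub b) v) (x b)"
    and dep: "\<And>b v. b < Suc K \<Longrightarrow> f b (restrict v (Jb b)) = f b v"
  shows "has_bochner_integral (PL {..<n}) (\<lambda>v. (\<Prod>b<Suc K. f b v) * fV K nb \<nu>0 \<nu> v) (\<Prod>b<Suc K. x b)"
  unfolding fV_blocks prod.distrib[symmetric] Jb_union[symmetric]
  by (rule PL_blocks) (auto simp: Jb_finite Jb_disjoint f dep tdens_restrict)

text \<open>All other blocks carry the constant factor 1, and their densities integrate to
  1.\<close>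

lemma fV_expect_one:
  assumes b: "b < Suc K" and f: "has_bochner_integral (PL (Jb b)) (\<lambda>v. f v * tdens (Jb b) (nub b) v) x"
    and dep: "\<And>v. f (restrict v (Jb b)) = f v"
  shows "has_bochner_integral (PL {..<n}) (\<lambda>v. f v * fV K nb \<nu>0 \<nu> v) x"
proof -
  have "has_bochner_integral (PL {..<n}) (\<lambda>v. (\<Prod>c<Suc K. if c = b then f v else 1) * fV K nb \<nu>0 \<nu> v)
      (\<Prod>c<Suc K. if c = b then x else 1)"
    by (rule fV_expect) (use f dep in \<open>auto simp: t_density[OF Jb_finite nub_gt]\<close>)
  then show ?thesis using b by (simp only: prod.delta finite_lessThan lessThan_iff if_True)
qed

lemma fV_expect_two:
  assumes bc: "b < Suc K" "c < Suc K" "b \<noteq> c"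
    and f: "has_bochner_integral (PL (Jb b)) (\<lambda>v. f v * tdens (Jb b) (nub b) v) x"
    and g: "has_bochner_integral (PL (Jb c)) (\<lambda>v. g v * tdens (Jb c) (nub c) v) y"
    and dep: "\<And>v. f (restrict v (Jb b)) = f v" "\<And>v. g (restrict v (Jb c)) = g v"
  shows "has_bochner_integral (PL {..<n}) (\<lambda>v. f v * g v * fV K nb \<nu>0 \<nu> v) (x * y)"
proof -
  have "has_bochner_integral (PL {..<n})
      (\<lambda>v. (\<Prod>d<Suc K. (if d = b then f v else 1) * (if d = c then g v else 1)) * fV K nb \<nu>0 \<nu> v)
      (\<Prod>d<Suc K. (if d = b then x else 1) * (if d = c then y else 1))"
    by (rule fV_expect) (use f g dep bc in \<open>auto simp: t_density[OF Jb_finite nub_gt]\<close>)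
  then show ?thesis using bc by (simp only: prod.distrib prod.delta finite_lessThan lessThan_iff if_True)
qed

context
  fixes A :: rmat
  assumes A: "admissible A"
begin

text \<open>The weights that produce entry (i, j) of A^(-1/2) (W_0 V_0 V_0' - I) A^(-1/2).\<close>

definition w0 :: "nat \<Rightarrow> nat \<Rightarrow> rmat" where
  "w0 i j = (\<lambda>a b. minv K (msqrt K A) i a * minv K (msqrt K A) j b)"

text \<open>Chosen because S_k = -(W_k |V_k|^2 - (n_k - 1)) / (\<lambda>_k (n_k - 1)): the leading
  term 1/\<lambda>_k of S_k is exactly the centring of the n_k - 1 squares.\<close>

definition wk :: "nat \<Rightarrow> rmat" where
  "wk k = (\<lambda>a b. - kd a b / (lam nb A k * (real (nb k) - 1)))"

abbreviation "L0 i j \<equiv> tL (Jb 0) \<nu>0 (w0 i j)"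
abbreviation "Lk k \<equiv> tL (Jb (Suc k)) (\<nu> k) (wk k)"

lemma score_Lmat:
  assumes ij: "i < K" "j < K"
  shows "score K nb U \<nu>0 \<nu> A (mapply n (Lmat K nb U A) v) (i + K * j)
    = 1 / 2 * L0 i j v + 1 / 2 * (if i = j then Lk i v else 0)"
proof -
  let ?z = "mapply n (Lmat K nb U A) v"
  have X0sq: "X0sq K nb U A ?z = (\<Sum>x\<in>Jb 0. (v x)\<^sup>2)"
    by (simp add: X0sq_def X0_Lmat[OF A] sum_Jb)
  have Xksq: "Xksq K nb U A ?z i = (\<Sum>x\<in>Jb (Suc i). (v x)\<^sup>2)"
    unfolding Xksq_def sum_Jb using ij by (intro sum.cong refl) (simp add: Xk_Lmat[OF A])
  have W0: "W0 K nb U \<nu>0 A ?z = tw (Jb 0) \<nu>0 v"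
    by (simp add: W0_def tw_def X0sq Jb_card)
  have m: "real (nb i - 1) = real (nb i) - 1" "real (nb i) - 1 > 0" using nb[OF ij(1)] by auto
  have Wk: "Wk K nb U \<nu> A ?z i = tw (Jb (Suc i)) (\<nu> i) v"
    unfolding Wk_def tw_def Xksq Jb_card m(1) by (simp add: add_diff_eq)
  have l: "lam nb A i > 0" by (rule admissible_lam[OF A ij(1)])
  have "L0 i j v = (\<Sum>a<K. \<Sum>b<K. minv K (msqrt K A) i a * minv K (msqrt K A) j b *
      (tw (Jb 0) \<nu>0 v * (v a * v b) - kd a b))"
    by (simp add: tL_def sum_Jb w0_def tE_def)
  also have "\<dots> = (\<Sum>b<K. \<Sum>a<K. minv K (msqrt K A) j b * minv K (msqrt K A) i a *
       (W0 K nb U \<nu>0 A ?z * (X0 K nb U A ?z a * X0 K nb U A ?z b) - mid K a b))"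
    by (subst sum.swap, intro sum.cong refl) (simp add: W0 X0_Lmat[OF A] kd_def mid_def)
  finally have L0: "L0 i j v = \<dots>" .
  have "Lk i v = (\<Sum>a\<in>Jb (Suc i). \<Sum>b\<in>Jb (Suc i). - tE (Jb (Suc i)) (\<nu> i) a b v / (lam nb A i * (real (nb i) - 1)) * kd a b)"
    unfolding tL_def wk_def by (intro sum.cong refl) simp
  also have "\<dots> = (\<Sum>a\<in>Jb (Suc i). - tE (Jb (Suc i)) (\<nu> i) a a v / (lam nb A i * (real (nb i) - 1)))"
    by (intro sum.cong refl kd_sum Jb_finite)
  also have "\<dots> = - (tw (Jb (Suc i)) (\<nu> i) v * (\<Sum>a\<in>Jb (Suc i). (v a)\<^sup>2) - real (card (Jb (Suc i)))) / (lam nb A i * (real (nb i) - 1))"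
    by (simp add: tE_def kd_def sum_subtractf sum_negf sum_distrib_left power2_eq_square flip: sum_divide_distrib)
  also have "\<dots> = Svec K nb U \<nu> A ?z i"
    unfolding Svec_def Wk Xksq Jb_card m(1) using l m(2) by (simp add: field_simps)
  finally have Lk: "Lk i v = Svec K nb U \<nu> A ?z i" .
  show ?thesis unfolding score_kron[OF A ij] L0 Lk ..
qed

text \<open>With rank one weights every trace in \<open>tL_cov\<close> factors into entries of
  A^(-1/2) A^(-1/2) = A^(-1). The pairing within each factor occurs once with \<phi>_0 and once
  subtracted, hence \<phi>_0 - 1.\<close>

lemma L0_cov:
  assumes "i < K" "j < K" "k < K" "l < K"
  shows "has_bochner_integral (PL {..<n}) (\<lambda>v. L0 i j v * L0 k l v * fV K nb \<nu>0 \<nu> v)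
     (phi0 K \<nu>0 * (minv K A j l * minv K A i k + minv K A j k * minv K A i l)
       + (phi0 K \<nu>0 - 1) * minv K A i j * minv K A k l)"
proof -
  let ?N = "minv K (msqrt K A)"
  note s = admissible_sym[OF A] admissible_mpd[OF A]
  have Nsym: "?N a b = ?N b a" if "a < K" "b < K" for a b
    using minv_sym[OF msqrt_sym[OF s] mpd_mdet_nonzero[OF msqrt_mpd[OF s]] that] .
  have NN: "(\<Sum>a<K. ?N i a * ?N k a) = minv K A i k" if "i < K" "k < K" for i k
  proof -
    have "(\<Sum>a<K. ?N i a * ?N k a) = mmult K ?N ?N i k"
      unfolding mmult_def using that Nsym by (intro sum.cong refl) simp
    then show ?thesis using minv_msqrt_square[OF s that] by simp
  qed
  have 1: "(\<Sum>a\<in>Jb 0. w0 i j a a) = minv K A i j" "(\<Sum>a\<in>Jb 0. w0 k l a a) = minv K A k l"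
    using NN assms by (simp_all add: sum_Jb w0_def)
  have 2: "(\<Sum>a\<in>Jb 0. \<Sum>b\<in>Jb 0. w0 i j a b * w0 k l a b) = minv K A i k * minv K A j l"
  proof -
    have "(\<Sum>a\<in>Jb 0. \<Sum>b\<in>Jb 0. w0 i j a b * w0 k l a b) = (\<Sum>a<K. ?N i a * ?N k a) * (\<Sum>b<K. ?N j b * ?N l b)"
      unfolding sum_Jb w0_def sum_product by (intro sum.cong refl) (simp only: mult_ac)
    then show ?thesis using NN assms by simp
  qed
  have 3: "(\<Sum>a\<in>Jb 0. \<Sum>b\<in>Jb 0. w0 i j a b * w0 k l b a) = minv K A i l * minv K A j k"
  proof -
    have "(\<Sum>a\<in>Jb 0. \<Sum>b\<in>Jb 0. w0 i j a b * w0 k l b a) = (\<Sum>a<K. ?N i a * ?N l a) * (\<Sum>b<K. ?N j b * ?N k b)"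
      unfolding sum_Jb w0_def sum_product by (intro sum.cong refl) (simp only: mult_ac)
    then show ?thesis using NN assms by simp
  qed
  have "has_bochner_integral (PL {..<n}) (\<lambda>v. L0 i j v * L0 k l v * fV K nb \<nu>0 \<nu> v)
     (phi0 K \<nu>0 * (minv K A i j * minv K A k l + minv K A i k * minv K A j l + minv K A i l * minv K A j k)
       - minv K A i j * minv K A k l)"
  proof (rule fV_expect_one[of 0])
    show "has_bochner_integral (PL (Jb 0)) (\<lambda>v. L0 i j v * L0 k l v * tdens (Jb 0) (nub 0) v)
     (phi0 K \<nu>0 * (minv K A i j * minv K A k l + minv K A i k * minv K A j l + minv K A i l * minv K A j k)
       - minv K A i j * minv K A k l)"
      using tL_cov[OF Jb_finite nu0, of 0 "w0 i j" "w0 k l"]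
      unfolding 1 2 3 Jb_card by (simp add: nub_def phi0_def)
  qed (auto simp: tL_restrict)
  then show ?thesis by (simp add: algebra_simps)
qed

text \<open>The weights have trace -1/\<lambda>_k and sum of squares 1/(\<lambda>_k^2 (n_k - 1)), so
  \<open>tL_cov\<close> gives \<phi>_k (1/\<lambda>_k^2 + 2/(\<lambda>_k^2 (n_k - 1))) -
  1/\<lambda>_k^2.\<close>

lemma Lk_cov:
  assumes "k < K"
  shows "has_bochner_integral (PL {..<n}) (\<lambda>v. Lk k v * Lk k v * fV K nb \<nu>0 \<nu> v) (Xi nb \<nu> A k k)"
proof (rule fV_expect_one[of "Suc k"])
  let ?m = "real (nb k) - 1" and ?l = "lam nb A k"
  have m: "real (nb k - 1) = ?m" "?m > 0" using nb[OF assms] by auto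
  have l: "?l > 0" by (rule admissible_lam[OF A assms])
  have 1: "(\<Sum>a\<in>Jb (Suc k). wk k a a) = - 1 / ?l"
    using m l by (simp add: wk_def kd_def Jb_card)
  have diag: "(\<Sum>a\<in>Jb (Suc k). \<Sum>b\<in>Jb (Suc k). kd a b / (?l * ?m) / (?l * ?m) * kd a b) = 1 / (?l\<^sup>2 * ?m)"
  proof -
    have "(\<Sum>a\<in>Jb (Suc k). \<Sum>b\<in>Jb (Suc k). kd a b / (?l * ?m) / (?l * ?m) * kd a b)
       = (\<Sum>a\<in>Jb (Suc k). kd a a / (?l * ?m) / (?l * ?m))"
      by (intro sum.cong refl kd_sum Jb_finite)
    also have "\<dots> = ?m / (?l * ?m) / (?l * ?m)" using m by (simp add: kd_def Jb_card)
    finally show ?thesis using m l by (simp add: power2_eq_square)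
  qed
  have 2: "(\<Sum>a\<in>Jb (Suc k). \<Sum>b\<in>Jb (Suc k). wk k a b * wk k a b) = 1 / (?l\<^sup>2 * ?m)"
    unfolding diag[symmetric] wk_def by (intro sum.cong refl) simp
  have 3: "(\<Sum>a\<in>Jb (Suc k). \<Sum>b\<in>Jb (Suc k). wk k a b * wk k b a) = 1 / (?l\<^sup>2 * ?m)"
    unfolding diag[symmetric] wk_def by (intro sum.cong refl) (simp add: kd_def)
  have phi: "(\<nu> k + real (card (Jb (Suc k)))) / (\<nu> k + real (card (Jb (Suc k))) + 2) = phik nb \<nu> k"
    unfolding phik_def Jb_card m(1) by (simp add: add.commute add_diff_eq)
  have "phik nb \<nu> k * (- 1 / ?l * (- 1 / ?l) + 1 / (?l\<^sup>2 * ?m) + 1 / (?l\<^sup>2 * ?m)) - - 1 / ?l * (- 1 / ?l) = Xi nb \<nu> A k k"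
    using m l by (simp add: Xi_def field_simps power2_eq_square)
  then show "has_bochner_integral (PL (Jb (Suc k))) (\<lambda>v. Lk k v * Lk k v * tdens (Jb (Suc k)) (nub (Suc k)) v) (Xi nb \<nu> A k k)"
    using tL_cov[OF Jb_finite nu[OF assms], of "Suc k" "wk k" "wk k"]
    unfolding 1 2 3 phi by (simp add: nub_def)
qed (use assms in \<open>auto simp: tL_restrict\<close>)

text \<open>Different blocks are independent and both factors are centred.\<close>

lemma L0_Lk_cov:
  assumes "k < K"
  shows "has_bochner_integral (PL {..<n}) (\<lambda>v. L0 i j v * Lk k v * fV K nb \<nu>0 \<nu> v) 0"
proof -
  have "has_bochner_integral (PL {..<n}) (\<lambda>v. L0 i j v * Lk k v * fV K nb \<nu>0 \<nu> v) (0 * 0)"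
    by (rule fV_expect_two[of 0 "Suc k"])
       (use assms tL_mean[OF Jb_finite nu0] tL_mean[OF Jb_finite nu[OF assms]] in \<open>auto simp: tL_restrict nub_def\<close>)
  then show ?thesis by simp
qed

lemma Lk_Ll_cov:
  assumes "k < K" "l < K" "k \<noteq> l"
  shows "has_bochner_integral (PL {..<n}) (\<lambda>v. Lk k v * Lk l v * fV K nb \<nu>0 \<nu> v) 0"
proof -
  have "has_bochner_integral (PL {..<n}) (\<lambda>v. Lk k v * Lk l v * fV K nb \<nu>0 \<nu> v) (0 * 0)"
    by (rule fV_expect_two[of "Suc k" "Suc l"])
       (use assms tL_mean[OF Jb_finite nu] in \<open>auto simp: tL_restrict nub_def\<close>)
  then show ?thesis by simp
qed

text \<open>Expanding the product of two scores gives four covariances. The mixed ones vanish, and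
  the V_k part survives only if both entries are the same diagonal entry, which is the shape of E_d'
  \<Xi> E_d.\<close>

lemma score_information:
  assumes p: "p < K * K" and q: "q < K * K"
  shows "has_bochner_integral (PL {..<n})
     (\<lambda>v. score K nb U \<nu>0 \<nu> A (mapply n (Lmat K nb U A) v) p
        * score K nb U \<nu>0 \<nu> A (mapply n (Lmat K nb U A) v) q * fV K nb \<nu>0 \<nu> v)
     (info K nb \<nu>0 \<nu> A p q)"
proof -
  obtain i j where ij: "i < K" "j < K" "p = i + K * j" by (rule vec_index_cases[OF p])
  obtain k l where kl: "k < K" "l < K" "q = k + K * l" by (rule vec_index_cases[OF q])
  let ?f = "fV K nb \<nu>0 \<nu>"
  let ?s = "if i = j then 1 else 0 :: real" and ?t = "if k = l then 1 else 0 :: real"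
  let ?X = "if i = k then Xi nb \<nu> A i i else 0"
  have LL: "has_bochner_integral (PL {..<n}) (\<lambda>v. Lk i v * Lk k v * ?f v) ?X"
    using Lk_cov[OF ij(1)] Lk_Ll_cov[OF ij(1) kl(1)] by (cases "i = k") auto
  have "has_bochner_integral (PL {..<n})
     (\<lambda>v. 1 / 4 * (L0 i j v * L0 k l v * ?f v + ?t * (L0 i j v * Lk k v * ?f v)
        + ?s * (L0 k l v * Lk i v * ?f v) + ?s * ?t * (Lk i v * Lk k v * ?f v)))
     (1 / 4 * (phi0 K \<nu>0 * (minv K A j l * minv K A i k + minv K A j k * minv K A i l)
       + (phi0 K \<nu>0 - 1) * minv K A i j * minv K A k l + ?t * 0 + ?s * 0 + ?s * ?t * ?X))"
    by (intro has_bochner_integral_mult_right has_bochner_integral_add L0_cov L0_Lk_cov LL ij kl)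
  moreover have "score K nb U \<nu>0 \<nu> A (mapply n (Lmat K nb U A) v) p
        * score K nb U \<nu>0 \<nu> A (mapply n (Lmat K nb U A) v) q * ?f v
     = 1 / 4 * (L0 i j v * L0 k l v * ?f v + ?t * (L0 i j v * Lk k v * ?f v)
        + ?s * (L0 k l v * Lk i v * ?f v) + ?s * ?t * (Lk i v * Lk k v * ?f v))" for v
    unfolding ij(3) kl(3) score_Lmat[OF ij(1,2)] score_Lmat[OF kl(1,2)]
    by (cases "i = j"; cases "k = l") (simp_all add: algebra_simps)
  moreover have "info K nb \<nu>0 \<nu> A p q = 1 / 4 * (phi0 K \<nu>0 * (minv K A j l * minv K A i k + minv K A j k * minv K A i l)
       + (phi0 K \<nu>0 - 1) * minv K A i j * minv K A k l + ?t * 0 + ?s * 0 + ?s * ?t * ?X)"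
  proof -
    have "(\<Sum>a<K. \<Sum>b<K. Ed K a p * Xi nb \<nu> A a b * Ed K b q)
       = (\<Sum>a<K. \<Sum>b<K. if b = k then (if a = i then ?s * Xi nb \<nu> A a b * ?t else 0) else 0)"
      unfolding ij(3) kl(3) using ij(1) kl(1) by (intro sum.cong refl) (auto simp: Ed_index)
    also have "\<dots> = ?s * Xi nb \<nu> A i k * ?t" using ij(1) kl(1) by simp
    also have "\<dots> = ?s * ?t * ?X" by (simp add: Xi_def)
    finally show ?thesis
      unfolding info_def unfolding ij(3) kl(3)
      by (simp add: Aot_inv_HK[OF admissible_mpd[OF A] ij(1,2) kl(1,2)] vecm_index ij kl)
  qed
  ultimately show ?thesis by (simp only:)
qed

end

end

text \<open>The expectation over Z is written as an integral over v against the density of V, with Z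
  = L v. Integrability is asserted separately because the integral of a non-integrable function is 0
  by convention. The symmetry of the score makes it the unique symmetric gradient.\<close>

theorem theorem6:
  fixes K :: nat and nb :: "nat \<Rightarrow> nat" and U :: "nat \<Rightarrow> rmat"
    and \<nu>0 :: real and \<nu> :: "nat \<Rightarrow> real" and A :: rmat
  assumes K: "K \<ge> 1"
    and nb: "\<forall>k<K. nb k \<ge> 2"
    and U: "\<forall>k<K. is_vperp (nb k) (U k)"
    and Asym: "msym K A" and Apd: "mpd K A"
    and lampos: "\<forall>k<K. lam nb A k > 0"
    and nu0: "\<nu>0 > 2" and nu: "\<forall>k<K. \<nu> k > 2"
  shows "(\<forall>z. has_sym_grad K (\<lambda>B. loglik K nb U \<nu>0 \<nu> B z) A (score K nb U \<nu>0 \<nu> A z))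
    \<and> (\<forall>z. \<forall>p<K*K. score K nb U \<nu>0 \<nu> A z p = score K nb U \<nu>0 \<nu> A z (p div K + K * (p mod K)))
    \<and> (\<forall>p<K*K. \<forall>q<K*K.
         integrable (Pi\<^sub>M {..<ntot K nb} (\<lambda>_. lborel))
           (\<lambda>v. score K nb U \<nu>0 \<nu> A (mapply (ntot K nb) (Lmat K nb U A) v) p
              * score K nb U \<nu>0 \<nu> A (mapply (ntot K nb) (Lmat K nb U A) v) q
              * fV K nb \<nu>0 \<nu> v)
       \<and> (\<integral>v. score K nb U \<nu>0 \<nu> A (mapply (ntot K nb) (Lmat K nb U A) v) p
              * score K nb U \<nu>0 \<nu> A (mapply (ntot K nb) (Lmat K nb U A) v) q
              * fV K nb \<nu>0 \<nu> v \<partial>(Pi\<^sub>M {..<ntot K nb} (\<lambda>_. lborel)))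
         = info K nb \<nu>0 \<nu> A p q)"
proof -
  interpret t_setting K nb U \<nu>0 \<nu>
    by unfold_locales (use K nb U nu0 nu in auto)
  have A: "admissible A" using Asym Apd lampos by (simp add: admissible_def)
  show ?thesis
    using loglik_has_sym_grad[OF A] score_sym[OF A] score_information[OF A]
    by (simp add: has_bochner_integral_iff)
qed

end
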